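(* Let $M=4$, and let $\gamma=(\gamma_{m,i})_{1\le m\le 4,\,0\le i\le m-1}$ be the following real coefficients: $$\gamma_{1,0}=1,\qquad \gamma_{2,0}=-\tfrac14,\ \gamma_{2,1}=\tfrac54,\qquad \gamma_{3,0}=\tfrac56,\ \gamma_{3,1}=-\tfrac23,\ \gamma_{3,2}=\tfrac56,\qquad \gamma_{4,1}=\tfrac12,$$ and, with $$R=\sqrt[3]{73547857887405865499600064\,\sqrt{133495318877644714344377}-23474745371243059566207357648855848671}$$ (real cube root), $$\gamma_{4,2}=\frac{1}{3627134098848}\left(R-\frac{5551049511730043591353151}{R}-456109196575\right),$$ $$\gamma_{4,3}=\frac{1}{18386964471851466374900016}\left(-5586815667458\,R+R^2+\frac{31012690382968488487137089701456460158}{R}+\frac{30814150681678355363112149018994128529535197628801}{R^2}+7974522440634228925392639\right),$$ $$\gamma_{4,0}=1-\tfrac12-\gamma_{4,2}-\gamma_{4,3}$$ (so $\gamma_{4,0}\approx-0.73$, $\gamma_{4,2}\approx-0.73$, $\gamma_{4,3}\approx1.96$). Then the 4-stage threshold dynamics algorithm with these coefficients (defined in the context) is: (i) unconditionally energy stable in any dimension $d\ge 2$: for every time step size $\delta t>0$, with $\tau$ the associated kernel time, every step $\Sigma^k\mapsto\Sigma^{k+1}$ of the algorithm satisfies $E_\tau(\Sigma^{k+1})\le E_\tau(\Sigma^k)$; (ii) first order accurate (for motion by mean curvature) in any dimension $d\ge2$; (iii) second order accurate (for motion by mean curvature) in dimension $d=2$.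
   Context: Gaussian kernel on $\mathbb{R}^d$: $G_t(\mathbf{x})=\frac{1}{(4\pi t)^{d/2}}e^{-|\mathbf{x}|^2/(4t)}$; $*$ is convolution and $\mathbf{1}_\Sigma$ is the characteristic function of $\Sigma$. $M$-stage threshold dynamics algorithm. Given coefficients $\gamma_{m,i}$ ($1\le m\le M$, $0\le i\le m-1$) with $\sum_{i=0}^{m-1}\gamma_{m,i}=1$ for every $m$, define $\beta_{1,0}=0$ and $\beta_{1,m}=1+\sum_{i=0}^{m-1}\gamma_{m,i}\beta_{1,i}$ for $1\le m\le M$. Given a time step size $\delta t>0$, set $\tau=\delta t/\beta_{1,M}$. Given a set $\Sigma^k\subset\mathbb{R}^d$, put $\bar\Sigma_0=\Sigma^k$, and for $m=1,\dots,M$ put $$\bar\Sigma_m=\Big\{x\in\mathbb{R}^d:\ \Big(G_\tau*\sum_{i=0}^{m-1}\gamma_{m,i}\mathbf{1}_{\bar\Sigma_i}\Big)(x)\ge\tfrac12\Big\};$$ finally $\Sigma^{k+1}=\bar\Sigma_M$. Energy: for (measurable) $\Sigma\subset\mathbb{R}^d$, $E_t(\Sigma)=\int_{\mathbb{R}^d}(1-\mathbf{1}_\Sigma)\,G_t*\mathbf{1}_\Sigma\,d\mathbf{x}\in[0,\infty]$. Order of accuracy (consistency): let $f(\mathbf{x},t):\mathbb{R}^{d-1}\times[0,\infty)\to\mathbb{R}$ be smooth with $f(0,0)=0$, $\nabla f(0,0)=0$ (spatial gradient), whose graph moves by mean curvature, i.e. $$f_t=\Delta f-\frac{\sum_{i,j}f_{x_i}f_{x_j}f_{x_ix_j}}{1+|\nabla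 f|^2}.$$ Let $\Sigma^0=\{(\mathbf{x},x_d): x_d\le f(\mathbf{x},0)\}$, let $\Sigma^1$ be the result of one step of the algorithm with time step $\delta t$, and let $z(\delta t)$ be the location, near the origin, at which $\partial\Sigma^1$ meets the $x_d$-axis $\{\mathbf{x}=0\}$ (for small $\delta t$). The algorithm is accurate of order $p$ in dimension $d$ if, for every such $f$, $z(\delta t)=f(0,\delta t)+O(\delta t^{p+1})$ as $\delta t\to0^+$. *)

theory Defs
  imports "HOL-Analysis.Analysis" "HOL-Library.Landau_Symbols"
begin

definition gauss_kernel :: "real \<Rightarrow> 'a::euclidean_space \<Rightarrow> real" where
  "gauss_kernel t x =
     1 / (4 * pi * t) powr (real DIM('a) / 2) * exp (- (norm x)\<^sup>2 / (4 * t))"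

definition conv :: "('a::euclidean_space \<Rightarrow> real) \<Rightarrow> ('a \<Rightarrow> real) \<Rightarrow> 'a \<Rightarrow> real" where
  "conv u v x = (LINT y|lebesgue. u (x - y) * v y)"

definition energy :: "real \<Rightarrow> 'a::euclidean_space set \<Rightarrow> ennreal" where
  "energy t S =
     (\<integral>\<^sup>+x. ennreal ((1 - indicator S x) * conv (gauss_kernel t) (indicator S) x) \<partial>lebesgue)"


text \<open>Only the values \<open>\<gamma> m i\<close> with \<open>i < m\<close> are ever used.\<close>

fun stage_beta :: "(nat \<Rightarrow> nat \<Rightarrow> real) \<Rightarrow> nat \<Rightarrow> real" where
  "stage_beta \<gamma> m = (if m = 0 then 0 else 1 + (\<Sum>i<m. \<gamma> m i * stage_beta \<gamma> i))"

declare stage_beta.simps [simp del]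

fun stage_set ::
  "(nat \<Rightarrow> nat \<Rightarrow> real) \<Rightarrow> real \<Rightarrow> 'a::euclidean_space set \<Rightarrow> nat \<Rightarrow> 'a set" where
  "stage_set \<gamma> \<tau> S m =
     (if m = 0 then S
      else {x. conv (gauss_kernel \<tau>)
                 (\<lambda>y. \<Sum>i<m. \<gamma> m i * indicator (stage_set \<gamma> \<tau> S i) y) x \<ge> 1 / 2})"

declare stage_set.simps [simp del]

definition kernel_time :: "nat \<Rightarrow> (nat \<Rightarrow> nat \<Rightarrow> real) \<Rightarrow> real \<Rightarrow> real" where
  "kernel_time M \<gamma> dt = dt / stage_beta \<gamma> M"

definition threshold_step ::
  "nat \<Rightarrow> (nat \<Rightarrow> nat \<Rightarrow> real) \<Rightarrow> real \<Rightarrow> 'a::euclidean_space set \<Rightarrow> 'a set" where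
  "threshold_step M \<gamma> dt S = stage_set \<gamma> (kernel_time M \<gamma> dt) S M"

definition energy_stable ::
  "'a::euclidean_space itself \<Rightarrow> nat \<Rightarrow> (nat \<Rightarrow> nat \<Rightarrow> real) \<Rightarrow> bool" where
  "energy_stable _ M \<gamma> \<longleftrightarrow>
     (\<forall>dt>0. \<forall>S::'a set. S \<in> sets lebesgue \<longrightarrow>
        energy (kernel_time M \<gamma> dt) (threshold_step M \<gamma> dt S) \<le> energy (kernel_time M \<gamma> dt) S)"


text \<open>
  \<open>C\<^sup>k\<close> regularity relative to \<open>S\<close>. It is used for the closed half-space
  \<open>UNIV \<times> {0..}\<close>, where derivatives within the set are unique and those at \<open>t = 0\<close> are one-sided.
\<close>

primrec Ck_on ::
  "nat \<Rightarrow> 'a::real_normed_vector set \<Rightarrow> ('a \<Rightarrow> 'b::real_normed_vector) \<Rightarrow> bool" where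
  "Ck_on 0 S f \<longleftrightarrow> continuous_on S f"
| "Ck_on (Suc k) S f \<longleftrightarrow>
     (\<exists>f'. (\<forall>x\<in>S. (f has_derivative f' x) (at x within S)) \<and> (\<forall>v. Ck_on k S (\<lambda>x. f' x v)))"

definition smooth_on :: "'a::real_normed_vector set \<Rightarrow> ('a \<Rightarrow> 'b::real_normed_vector) \<Rightarrow> bool" where
  "smooth_on S f \<longleftrightarrow> (\<forall>k. Ck_on k S f)"

definition partial :: "'n::finite \<Rightarrow> (real^'n \<Rightarrow> real) \<Rightarrow> real^'n \<Rightarrow> real" where
  "partial i g x = frechet_derivative g (at x) (axis i 1)"

definition graph_mcf_rhs :: "(real^'n \<Rightarrow> real) \<Rightarrow> real^'n \<Rightarrow> real" where
  "graph_mcf_rhs g x =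
     (\<Sum>i\<in>UNIV. partial i (partial i g) x)
     - (\<Sum>i\<in>UNIV. \<Sum>j\<in>UNIV. partial i g x * partial j g x * partial j (partial i g) x)
       / (1 + (\<Sum>i\<in>UNIV. (partial i g x)\<^sup>2))"

text \<open>
  The function \<open>f\<close> takes a point \<open>(x, t)\<close> of space-time; its values at negative times are irrelevant.
\<close>

definition graph_mcf :: "((real^'n) \<times> real \<Rightarrow> real) \<Rightarrow> bool" where
  "graph_mcf f \<longleftrightarrow>
     (\<forall>x. \<forall>t\<ge>0. ((\<lambda>s. f (x, s)) has_real_derivative graph_mcf_rhs (\<lambda>y. f (y, t)) x)
                    (at t within {0..}))"

definition admissible_graph :: "((real^'n) \<times> real \<Rightarrow> real) \<Rightarrow> bool" where
  "admissible_graph f \<longleftrightarrow>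
     smooth_on (UNIV \<times> {0..}) f \<and> f (0, 0) = 0 \<and> (\<forall>i. partial i (\<lambda>x. f (x, 0)) 0 = 0) \<and>
     graph_mcf f"

definition subgraph :: "(real^'n \<Rightarrow> real) \<Rightarrow> ((real^'n) \<times> real) set" where
  "subgraph g = {(x, s). s \<le> g x}"

text \<open>
  Accuracy of order \<open>p\<close> in the space \<open>real^'n \<times> real\<close>, whose last factor is the
  \<open>x\<^sub>d\<close>-axis, so \<open>d = CARD('n) + 1\<close>. That \<open>z dt\<close> is the location near the origin at which
  the new boundary meets this axis means: for small \<open>dt\<close> it is the only such point in a
  neighbourhood \<open>(-r, r)\<close> not depending on \<open>dt\<close>.
\<close>

definition accurate_of_order ::
  "'n::finite itself \<Rightarrow> nat \<Rightarrow> (nat \<Rightarrow> nat \<Rightarrow> real) \<Rightarrow> nat \<Rightarrow> bool" where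
  "accurate_of_order _ M \<gamma> p \<longleftrightarrow>
     (\<forall>f :: (real^'n) \<times> real \<Rightarrow> real. admissible_graph f \<longrightarrow>
        (\<exists>r>0. \<exists>z :: real \<Rightarrow> real.
           (\<forall>\<^sub>F dt in at_right 0.
              {s. \<bar>s\<bar> < r \<and> (0, s) \<in> frontier (threshold_step M \<gamma> dt (subgraph (\<lambda>x. f (x, 0))))}
              = {z dt}) \<and>
           (\<lambda>dt. z dt - f (0, dt)) \<in> O[at_right 0](\<lambda>dt. dt ^ (p + 1))))"


definition R_const :: real where
  "R_const = root 3 (73547857887405865499600064 * sqrt 133495318877644714344377
                     - 23474745371243059566207357648855848671)"

definition gamma42 :: real where
  "gamma42 = 1 / 3627134098848 *
     (R_const - 5551049511730043591353151 / R_const - 456109196575)"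

definition gamma43 :: real where
  "gamma43 = 1 / 18386964471851466374900016 *
     (- 5586815667458 * R_const + R_const\<^sup>2
      + 31012690382968488487137089701456460158 / R_const
      + 30814150681678355363112149018994128529535197628801 / R_const\<^sup>2
      + 7974522440634228925392639)"

definition gamma_coeffs :: "nat \<Rightarrow> nat \<Rightarrow> real" where
  "gamma_coeffs m i =
     [[1],
      [- 1 / 4, 5 / 4],
      [5 / 6, - 2 / 3, 5 / 6],
      [1 - 1 / 2 - gamma42 - gamma43, 1 / 2, gamma42, gamma43]] ! (m - 1) ! i"

end

theory Submission
  imports Defs "HOL-Probability.Distributions"
begin

text \<open>
  Energy: each stage minimises a linearisation of the energy whose Gaussian form is positive
  semidefinite. Adding up the inequalities that compare each stage with the preceding one leaves
  \<open>E (\<Sigma>\<^sub>4) - E (\<Sigma>\<^sub>0)\<close> bounded by a quadratic form in the differences of the indicator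
  functions, and the coefficients make that form definite with the right sign.

  Accuracy: after rescaling by \<open>\<surd>\<tau>\<close> the stages are almost graphs, whose profiles are found
  recursively from the expansion \<open>z - z\<^sup>3/12\<close> of the Gaussian distribution function. Parity removes
  the odd powers of \<open>\<surd>\<tau>\<close> on the axis. The term of order \<open>\<tau>\<close> is \<open>\<beta>\<^sub>4 \<Delta>f\<close>, whatever the coefficients
  are; for curves the term of order \<open>\<tau>\<^sup>2\<close> is linear in \<open>f\<^sub>x\<^sub>x\<^sub>x\<^sub>x\<close> and \<open>f\<^sub>x\<^sub>x\<^sup>3\<close>, which gives two
  algebraic conditions on the coefficients.
\<close>

text \<open>Three obstacles shape the proof. Some coefficients are negative, so no comparison
  principle orders the stages, and a stage set need not be a subgraph. The function \<open>f\<close>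
  may grow arbitrarily fast. The initial set may have infinite measure. The first two are met by
  \<open>sandwich\<close>: at scaled heights \<open>|v| <= \<rho> / e\<close> a stage set agrees
  with the subgraph of a polynomial profile outside a strip of width
  \<open>O(e^5 (1 + |x|)^N)\<close>; nothing is claimed inside the strip or beyond these heights.
  Gaussian averages turn the polynomial weight into a constant and make the far region
  \<open>O(e^5)\<close>, so the property passes from stage to stage. The exponent 5 is what second
  order needs, since undoing the scaling gives \<open>e^6 = \<tau>^3\<close>. The strip could hide
  several crossings; uniqueness comes from a separate estimate of increments along the axis,
  compared with those of \<open>gphi\<close>. The third is met by expanding the energy around the
  initial set: finite initial energy forces all differences of indicators to be integrable, and only
  terms containing such a difference or the initial energy density occur.\<close>

lemma gauss_kernel_nonneg [simp]: "0 \<le> gauss_kernel t x"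
  by (simp add: gauss_kernel_def)

lemma gauss_kernel_measurable [measurable]: "gauss_kernel t \<in> borel_measurable borel"
  unfolding gauss_kernel_def by measurable

lemma gauss_kernel_minus [simp]: "gauss_kernel t (- x) = gauss_kernel t x"
  by (simp add: gauss_kernel_def)

lemma gauss_kernel_commute: "gauss_kernel t (x - y) = gauss_kernel t (y - x)"
  by (simp add: gauss_kernel_def norm_minus_commute)

lemma gauss_kernel_real:
  assumes "t > 0"
  shows "gauss_kernel t = normal_density 0 (sqrt (2 * t))"
  using assms by (simp add: fun_eq_iff gauss_kernel_def normal_density_def powr_half_sqrt mult.commute mult.left_commute)

lemma gauss_kernel_prod:
  fixes x :: "'a::euclidean_space"
  assumes "t > 0"
  shows "gauss_kernel t x = (\<Prod>b\<in>Basis. gauss_kernel t (x \<bullet> b))"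
proof -
  have "(\<Prod>b\<in>(Basis::'a set). gauss_kernel t (x \<bullet> b))
      = (\<Prod>b\<in>(Basis::'a set). 1 / (4 * pi * t) powr (1/2)) * (\<Prod>b\<in>(Basis::'a set). exp (- (x \<bullet> b)\<^sup>2 / (4 * t)))"
    by (simp add: gauss_kernel_def prod_dividef power_one_over)
  also have "(\<Prod>b\<in>(Basis::'a set). exp (- (x \<bullet> b)\<^sup>2 / (4 * t))) = exp (\<Sum>b\<in>(Basis::'a set). - (x \<bullet> b)\<^sup>2 / (4 * t))"
    by (simp add: exp_sum)
  also have "(\<Sum>b\<in>(Basis::'a set). - (x \<bullet> b)\<^sup>2 / (4 * t)) = - (norm x)\<^sup>2 / (4 * t)"
  proof -
    have "(norm x)\<^sup>2 = (\<Sum>b\<in>Basis. (x \<bullet> b)\<^sup>2)"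
      by (subst power2_norm_eq_inner, subst euclidean_inner) (simp add: power2_eq_square)
    then show ?thesis by (simp add: sum_divide_distrib sum_negf)
  qed
  also have "(\<Prod>b\<in>(Basis::'a set). 1 / (4 * pi * t) powr (1/2)) = 1 / (4 * pi * t) powr (real DIM('a) / 2)"
    using assms by (simp add: power_divide powr_realpow[symmetric] powr_powr)
  finally show ?thesis by (simp add: gauss_kernel_def)
qed

section \<open>Gaussian integrals as products of one-dimensional integrals\<close>

lemma integral_lborel_prod:
  fixes f :: "'a::euclidean_space \<Rightarrow> real \<Rightarrow> real"
  assumes "\<And>b. b \<in> Basis \<Longrightarrow> integrable lborel (f b)"
  shows "(\<integral>x. (\<Prod>b\<in>Basis. f b (x \<bullet> b)) \<partial>lborel) = (\<Prod>b\<in>Basis. \<integral>x. f b x \<partial>lborel)"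
proof -
  interpret product_sigma_finite "\<lambda>_::'a. lborel::real measure"
    by standard
  have m: "\<And>b. b \<in> Basis \<Longrightarrow> f b \<in> borel_measurable borel"
    using assms borel_measurable_integrable by fastforce
  have [measurable]: "(\<lambda>x. \<Prod>b\<in>Basis. f b (x \<bullet> b)) \<in> borel_measurable borel"
    by (intro borel_measurable_prod measurable_compose[OF _ m]) auto
  have "(\<integral>x. (\<Prod>b\<in>Basis. f b (x \<bullet> b)) \<partial>lborel) = (\<integral>x. (\<Prod>b\<in>Basis. f b (x b)) \<partial>(Pi\<^sub>M Basis (\<lambda>_. lborel)))"
    by (subst lborel_def, subst integral_distr) (simp_all add: lborel_eq_real[symmetric])
  also have "\<dots> = (\<Prod>b\<in>Basis. \<integral>x. f b x \<partial>lborel)"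
    by (rule product_integral_prod) (use assms in auto)
  finally show ?thesis .
qed

lemma integrable_lborel_prod:
  fixes f :: "'a::euclidean_space \<Rightarrow> real \<Rightarrow> real"
  assumes "\<And>b. b \<in> Basis \<Longrightarrow> integrable lborel (f b)"
  shows "integrable lborel (\<lambda>x. \<Prod>b\<in>Basis. f b (x \<bullet> b))"
proof -
  interpret product_sigma_finite "\<lambda>_::'a. lborel::real measure"
    by standard
  have m: "\<And>b. b \<in> Basis \<Longrightarrow> f b \<in> borel_measurable borel"
    using assms borel_measurable_integrable by fastforce
  have [measurable]: "(\<lambda>x. \<Prod>b\<in>Basis. f b (x \<bullet> b)) \<in> borel_measurable borel"
    by (intro borel_measurable_prod measurable_compose[OF _ m]) auto
  have "integrable (Pi\<^sub>M Basis (\<lambda>_. lborel)) (\<lambda>x. (\<Prod>b\<in>Basis. f b (x b)))"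
    by (rule product_integrable_prod) (use assms in auto)
  then show ?thesis
    by (subst lborel_def, subst integrable_distr_eq) (simp_all add: lborel_eq_real[symmetric])
qed

lemma gauss_kernel_integrable:
  assumes "t > 0"
  shows "integrable lborel (gauss_kernel t :: 'a::euclidean_space \<Rightarrow> real)"
proof -
  have "integrable lborel (gauss_kernel t :: real \<Rightarrow> real)"
    using assms by (simp add: gauss_kernel_real)
  from integrable_lborel_prod[where f="\<lambda>_::'a. gauss_kernel t", OF this]
  show ?thesis using assms by (simp add: gauss_kernel_prod[symmetric])
qed

lemma gauss_kernel_integral:
  assumes "t > 0"
  shows "(\<integral>x. gauss_kernel t (x::'a::euclidean_space) \<partial>lborel) = 1"
proof -
  have i: "integrable lborel (gauss_kernel t :: real \<Rightarrow> real)"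
    using assms by (simp add: gauss_kernel_real)
  have "(\<integral>x. gauss_kernel t (x::real) \<partial>lborel) = 1"
    using assms by (simp add: gauss_kernel_real)
  with integral_lborel_prod[where f="\<lambda>_::'a. gauss_kernel t", OF i]
  show ?thesis using assms by (simp add: gauss_kernel_prod[symmetric])
qed

text \<open>The Gaussian probability measure with density \<open>G_1\<close>. Every coordinate has
  variance 2 rather than 1; this is where the Laplacian without a factor 1/2 and the moments 2, 12,
  120 come from.\<close>

definition gm :: "'a::euclidean_space measure" where
  "gm = density lborel (\<lambda>x. ennreal (gauss_kernel 1 x))"

lemma sets_gm [measurable_cong, simp]: "sets gm = sets borel"
  by (simp add: gm_def)

lemma space_gm [simp]: "space gm = UNIV"
  by (simp add: gm_def)

lemma measurable_gm [simp]: "measurable gm M = measurable borel M"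
  by (rule measurable_cong_sets) auto

lemma prob_space_gm: "prob_space (gm :: 'a::euclidean_space measure)"
proof
  have "emeasure gm (space gm :: 'a set) = (\<integral>\<^sup>+x. ennreal (gauss_kernel 1 (x::'a)) \<partial>lborel)"
    by (simp add: gm_def emeasure_density)
  also have "\<dots> = 1"
    by (subst nn_integral_eq_integral) (simp_all add: gauss_kernel_integrable gauss_kernel_integral)
  finally show "emeasure gm (space gm :: 'a set) = 1" .
qed

interpretation gm: prob_space gm
  by (rule prob_space_gm)

lemma measure_gm_UNIV [simp]: "measure gm UNIV = 1"
  using gm.prob_space by simp

interpretation gm2: pair_prob_space gm gm ..

lemma integrable_gm:
  fixes f :: "'a::euclidean_space \<Rightarrow> real"
  assumes "f \<in> borel_measurable borel"
  shows "integrable gm f \<longleftrightarrow> integrable lborel (\<lambda>x. gauss_kernel 1 x * f x)"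
  unfolding gm_def using assms by (subst integrable_real_density) auto

lemma integral_gm:
  fixes f :: "'a::euclidean_space \<Rightarrow> real"
  assumes "f \<in> borel_measurable borel"
  shows "integral\<^sup>L gm f = (\<integral>x. gauss_kernel 1 x * f x \<partial>lborel)"
  unfolding gm_def using assms by (subst integral_real_density) auto

lemma gauss_kernel_scale:
  fixes x :: "'a::euclidean_space"
  assumes "t > 0" "c > 0"
  shows "gauss_kernel (c\<^sup>2 * t) (c *\<^sub>R x) * c ^ DIM('a) = gauss_kernel t x"
proof -
  have "(4 * pi * t * c\<^sup>2) powr (real DIM('a) / 2) = (4 * pi * t) powr (real DIM('a) / 2) * (c\<^sup>2) powr (real DIM('a) / 2)"
    by (rule powr_mult)
  also have "(c\<^sup>2) powr (real DIM('a) / 2) = (c powr 2) powr (real DIM('a) / 2)"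
    using assms by simp
  also have "\<dots> = c ^ DIM('a)"
    using assms unfolding powr_powr by (simp add: powr_realpow)
  finally have p: "(4 * pi * (c\<^sup>2 * t)) powr (real DIM('a) / 2) = (4 * pi * t) powr (real DIM('a) / 2) * c ^ DIM('a)"
    by (simp only: mult.assoc mult.commute[of t])
  have n: "- (norm (c *\<^sub>R x))\<^sup>2 / (4 * (c\<^sup>2 * t)) = - (norm x)\<^sup>2 / (4 * t)"
    using assms by (simp add: power_mult_distrib)
  show ?thesis
    unfolding gauss_kernel_def p n using assms by simp
qed

lemma integral_lborel_affine:
  fixes f :: "'a::euclidean_space \<Rightarrow> real"
  assumes [measurable]: "f \<in> borel_measurable borel" and "c \<noteq> 0"
  shows "(\<integral>x. f x \<partial>lborel) = \<bar>c\<bar> ^ DIM('a) * (\<integral>x. f (t + c *\<^sub>R x) \<partial>lborel)"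
proof -
  have "(\<integral>x. f x \<partial>lborel) = integral\<^sup>L (density (distr lborel borel (\<lambda>x. t + c *\<^sub>R x)) (\<lambda>_. \<bar>c\<bar>^DIM('a))) f"
    using lborel_affine[OF \<open>c \<noteq> 0\<close>, of t] by metis
  also have "\<dots> = (\<integral>x. \<bar>c\<bar>^DIM('a) * f x \<partial>distr lborel borel (\<lambda>x. t + c *\<^sub>R x))"
    by (rule integral_real_density) auto
  also have "\<dots> = (\<integral>x. \<bar>c\<bar>^DIM('a) * f (t + c *\<^sub>R x) \<partial>lborel)"
    by (rule integral_distr) auto
  finally show ?thesis by simp
qed

lemma integral_lborel_shift:
  fixes f :: "'a::euclidean_space \<Rightarrow> real"
  assumes "f \<in> borel_measurable borel"
  shows "(\<integral>x. f (t + x) \<partial>lborel) = (\<integral>x. f x \<partial>lborel)"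
  using integral_lborel_affine[OF assms, of 1 t] by simp

lemma integral_lborel_reflect:
  fixes f :: "'a::euclidean_space \<Rightarrow> real"
  assumes "f \<in> borel_measurable borel"
  shows "(\<integral>x. f (t - x) \<partial>lborel) = (\<integral>x. f x \<partial>lborel)"
  using integral_lborel_affine[OF assms, of "-1" t] by simp

lemma integral_gm_reflect:
  fixes f :: "'a::euclidean_space \<Rightarrow> real"
  assumes [measurable]: "f \<in> borel_measurable borel"
  shows "(\<integral>x. f (- x) \<partial>gm) = (\<integral>x. f x \<partial>gm)"
  using integral_lborel_reflect[of "\<lambda>x. gauss_kernel 1 x * f x" 0] by (simp add: integral_gm)

lemma conv_lborel:
  fixes u v :: "'a::euclidean_space \<Rightarrow> real"
  assumes [measurable]: "u \<in> borel_measurable borel" "v \<in> borel_measurable borel"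
  shows "conv u v x = (\<integral>y. u (x - y) * v y \<partial>lborel)"
  unfolding conv_def by (rule integral_completion) simp

text \<open>Parabolic scaling: the substitution \<open>y = x + e z\<close> moves the time step out
  of the kernel and into the set, so that every stage becomes an average over the fixed measure
  \<open>gm\<close>.\<close>

lemma conv_gauss_kernel:
  fixes S :: "'a::euclidean_space \<Rightarrow> real"
  assumes [measurable]: "S \<in> borel_measurable borel" and "e > 0"
  shows "conv (gauss_kernel (e\<^sup>2)) S x = (\<integral>z. S (x + e *\<^sub>R z) \<partial>gm)"
proof -
  have "conv (gauss_kernel (e\<^sup>2)) S x = (\<integral>y. gauss_kernel (e\<^sup>2) (x - y) * S y \<partial>lborel)"
    by (simp add: conv_lborel)
  also have "\<dots> = e ^ DIM('a) * (\<integral>z. gauss_kernel (e\<^sup>2) (e *\<^sub>R z) * S (x + e *\<^sub>R z) \<partial>lborel)"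
    using \<open>e > 0\<close> by (subst integral_lborel_affine[where c=e and t=x]) (simp_all)
  also have "\<dots> = (\<integral>z. (gauss_kernel (e\<^sup>2 * 1) (e *\<^sub>R z) * e ^ DIM('a)) * S (x + e *\<^sub>R z) \<partial>lborel)"
    by (subst integral_mult_right_zero[symmetric]) (simp add: mult_ac)
  also have "\<dots> = (\<integral>z. S (x + e *\<^sub>R z) \<partial>gm)"
    using \<open>e > 0\<close> by (subst gauss_kernel_scale) (auto simp: integral_gm)
  finally show ?thesis .
qed

text \<open>Splits the vertical direction from the horizontal ones: for a subgraph the vertical
  variable can then be integrated exactly, giving \<open>gphi\<close>, and a horizontal average
  remains.\<close>

lemma gm_Pair:
  "(gm :: ('a::euclidean_space \<times> 'b::euclidean_space) measure) = gm \<Otimes>\<^sub>M gm"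
proof -
  have k: "gauss_kernel 1 (x, y) = gauss_kernel 1 x * gauss_kernel 1 y" for x :: 'a and y :: 'b
    by (simp add: gauss_kernel_def norm_Pair add_divide_distrib powr_add exp_add[symmetric])
  have "(gm :: 'a measure) \<Otimes>\<^sub>M (gm :: 'b measure)
     = density (lborel \<Otimes>\<^sub>M lborel) (\<lambda>(x,y). ennreal (gauss_kernel 1 x) * ennreal (gauss_kernel 1 y))"
    unfolding gm_def
    by (rule pair_measure_density)
       (auto intro: sigma_finite_lborel simp: gm_def[symmetric] gm.sigma_finite_measure)
  also have "\<dots> = gm"
    unfolding gm_def lborel_prod
  proof (rule density_cong)
    have "(\<lambda>(x, y). ennreal (gauss_kernel 1 x) * ennreal (gauss_kernel 1 y)) \<in> borel_measurable (borel \<Otimes>\<^sub>M borel)"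
      by measurable
    then show "(\<lambda>(x, y). ennreal (gauss_kernel 1 x) * ennreal (gauss_kernel 1 y)) \<in> borel_measurable (lborel :: ('a \<times> 'b) measure)"
      by (simp add: borel_prod)
  qed (auto simp: k ennreal_mult)
  finally show ?thesis by simp
qed

section \<open>Functions of polynomial growth\<close>

definition polyb :: "('a::euclidean_space \<Rightarrow> real) \<Rightarrow> bool" where
  "polyb f \<longleftrightarrow> f \<in> borel_measurable borel \<and> (\<exists>C N. \<forall>x. \<bar>f x\<bar> \<le> C * (1 + norm x) ^ N)"

lemma integral_gm_prod:
  fixes f :: "'a::euclidean_space \<Rightarrow> real \<Rightarrow> real"
  assumes "\<And>b. b \<in> Basis \<Longrightarrow> integrable gm (f b)"
  shows "(\<integral>x. (\<Prod>b\<in>Basis. f b (x \<bullet> b)) \<partial>gm) = (\<Prod>b\<in>Basis. \<integral>x. f b x \<partial>gm)"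
proof -
  have m: "f b \<in> borel_measurable borel" if "b \<in> Basis" for b
    using borel_measurable_integrable[OF assms[OF that]] by simp
  have m': "(\<lambda>x. \<Prod>b\<in>Basis. f b (x \<bullet> b)) \<in> borel_measurable borel"
    by (intro borel_measurable_prod measurable_compose[OF _ m]) auto
  have k: "gauss_kernel 1 x * (\<Prod>b\<in>Basis. f b (x \<bullet> b)) = (\<Prod>b\<in>Basis. gauss_kernel 1 (x \<bullet> b) * f b (x \<bullet> b))" for x :: 'a
    unfolding gauss_kernel_prod[OF zero_less_one, of x] prod.distrib ..
  have "(\<integral>x. (\<Prod>b\<in>Basis. f b (x \<bullet> b)) \<partial>gm)
     = (\<integral>x. (\<Prod>b\<in>Basis. gauss_kernel 1 (x \<bullet> b) * f b (x \<bullet> b)) \<partial>lborel)"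
    unfolding integral_gm[OF m'] k ..
  also have "\<dots> = (\<Prod>b\<in>Basis. \<integral>x. gauss_kernel 1 x * f b x \<partial>lborel)"
    by (rule integral_lborel_prod) (use assms m in \<open>auto simp: integrable_gm\<close>)
  also have "\<dots> = (\<Prod>b\<in>Basis. \<integral>x. f b x \<partial>gm)"
    by (rule prod.cong[OF refl]) (metis integral_gm m)
  finally show ?thesis .
qed

text \<open>Half of the exponent \<open>r^2/4\<close> pays for the polynomial:
  \<open>(1 + r)^N <= exp (N r)\<close> and \<open>N r <= 2 N^2 + r^2/8\<close>. The other half is
  the exponent of \<open>gauss_kernel 2\<close>, and the power of 2 in the constant is the ratio of
  the normalisations.\<close>

lemma gauss_moment_bound:
  "\<exists>C. \<forall>x::'a::euclidean_space. gauss_kernel 1 x * (1 + norm x) ^ N \<le> C * gauss_kernel 2 x"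
proof -
  define C where "C = 2 powr (real DIM('a) / 2) * exp (2 * (real N)\<^sup>2)"
  have "gauss_kernel 1 x * (1 + norm x) ^ N \<le> C * gauss_kernel 2 x" for x :: 'a
  proof -
    define r where "r = norm x"
    have r: "r \<ge> 0" by (simp add: r_def)
    have "(1 + r) ^ N \<le> exp r ^ N"
      using r by (intro power_mono) (auto simp: exp_ge_add_one_self)
    also have "\<dots> = exp (real N * r)"
      by (simp add: exp_of_nat_mult)
    also have "\<dots> \<le> exp (2 * (real N)\<^sup>2 + r\<^sup>2 / 8)"
    proof -
      have "0 \<le> (4 * real N - r)\<^sup>2 / 8" by simp
      also have "\<dots> = 2 * (real N)\<^sup>2 + r\<^sup>2 / 8 - real N * r"
        by (simp add: power2_eq_square field_simps)
      finally show ?thesis by simp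
    qed
    finally have "exp (- r\<^sup>2 / 4) * (1 + r) ^ N \<le> exp (- r\<^sup>2 / 4) * exp (2 * (real N)\<^sup>2 + r\<^sup>2 / 8)"
      by (rule mult_left_mono) simp
    also have "\<dots> = exp (2 * (real N)\<^sup>2) * exp (- r\<^sup>2 / 8)"
      unfolding exp_add[symmetric] by simp
    finally have *: "exp (- r\<^sup>2 / 4) * (1 + r) ^ N \<le> exp (2 * (real N)\<^sup>2) * exp (- r\<^sup>2 / 8)" .
    have "(4 * pi * 2) powr (real DIM('a) / 2) = (4 * pi) powr (real DIM('a) / 2) * 2 powr (real DIM('a) / 2)"
      by (rule powr_mult)
    then have "C * gauss_kernel 2 x = 1 / (4 * pi) powr (real DIM('a) / 2) * (exp (2 * (real N)\<^sup>2) * exp (- r\<^sup>2 / 8))"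
      by (simp add: C_def gauss_kernel_def r_def)
    moreover have "gauss_kernel 1 x * (1 + norm x) ^ N = 1 / (4 * pi) powr (real DIM('a) / 2) * (exp (- r\<^sup>2 / 4) * (1 + r) ^ N)"
      by (simp add: gauss_kernel_def r_def)
    ultimately show ?thesis
      using mult_left_mono[OF *, of "1 / (4 * pi) powr (real DIM('a) / 2)"] by simp
  qed
  then show ?thesis by blast
qed

text \<open>The purpose of \<open>polyb\<close>: one predicate, closed under algebra, translation,
  slicing and partial integration, that yields integrability against \<open>gm\<close>.
  Measurability is part of it so that it need not be carried along separately.\<close>

lemma polyb_integrable:
  fixes f :: "'a::euclidean_space \<Rightarrow> real"
  assumes "polyb f"
  shows "integrable gm f"
proof -
  obtain C N where f [measurable]: "f \<in> borel_measurable borel" and b: "\<And>x. \<bar>f x\<bar> \<le> C * (1 + norm x) ^ N"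
    using assms by (auto simp: polyb_def)
  obtain K where K: "\<And>x. gauss_kernel 1 (x::'a) * (1 + norm x) ^ N \<le> K * gauss_kernel 2 x"
    using gauss_moment_bound[where 'a='a] by blast
  have C: "0 \<le> C" using b[of 0] by simp
  have "integrable lborel (\<lambda>x::'a. (C * K) * gauss_kernel 2 x)"
    by (intro integrable_mult_right gauss_kernel_integrable) simp
  then have "integrable lborel (\<lambda>x::'a. gauss_kernel 1 x * f x)"
  proof (rule Bochner_Integration.integrable_bound)
    have "\<bar>gauss_kernel 1 x * f x\<bar> \<le> \<bar>(C * K) * gauss_kernel 2 x\<bar>" for x
    proof -
      have "\<bar>gauss_kernel 1 x * f x\<bar> \<le> gauss_kernel 1 x * (C * (1 + norm x) ^ N)"
        unfolding abs_mult using b[of x] by (simp add: mult_left_mono)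
      also have "\<dots> = C * (gauss_kernel 1 x * (1 + norm x) ^ N)" by simp
      also have "\<dots> \<le> C * (K * gauss_kernel 2 x)"
        by (rule mult_left_mono[OF K C])
      finally show ?thesis by linarith
    qed
    then show "AE x in lborel. norm (gauss_kernel 1 x * f x) \<le> norm ((C * K) * gauss_kernel 2 x)"
      by simp
  qed simp
  then show ?thesis by (simp add: integrable_gm)
qed

lemma polyb_measurable [measurable_dest]: "polyb f \<Longrightarrow> f \<in> borel_measurable borel"
  by (simp add: polyb_def)

lemma polybI:
  assumes "f \<in> borel_measurable borel" "\<And>x. \<bar>f x\<bar> \<le> C * (1 + norm x) ^ N"
  shows "polyb f"
  using assms by (auto simp: polyb_def)

lemma polybE:
  assumes "polyb f"
  obtains C N where "C \<ge> 0" "\<And>x. \<bar>f x\<bar> \<le> C * (1 + norm x) ^ N"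
proof -
  obtain C N where b: "\<And>x. \<bar>f x\<bar> \<le> C * (1 + norm x) ^ N"
    using assms by (auto simp: polyb_def)
  show ?thesis
    by (rule that[OF _ b]) (use b[of 0] in simp)
qed

lemma polyb_const [simp]: "polyb (\<lambda>x. c)"
  by (rule polybI[where C="\<bar>c\<bar>" and N=0]) auto

lemma polyb_bound:
  assumes "polyb g" "f \<in> borel_measurable borel" "\<And>x. \<bar>f x\<bar> \<le> g x"
  shows "polyb f"
proof -
  obtain C N where "\<And>x. \<bar>g x\<bar> \<le> C * (1 + norm x) ^ N" using assms(1) by (rule polybE) (rule that)
  then have "\<bar>f x\<bar> \<le> C * (1 + norm x) ^ N" for x using assms(3)[of x] by (meson abs_ge_self order_trans)
  with assms(2) show ?thesis by (rule polybI)
qed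

lemma polyb_abs [simp]: "polyb f \<Longrightarrow> polyb (\<lambda>x. \<bar>f x\<bar>)"
  by (auto simp: polyb_def)

lemma polyb_add [simp]:
  assumes "polyb f" "polyb g"
  shows "polyb (\<lambda>x. f x + g x)"
proof -
  obtain C N where 1: "C \<ge> 0" "\<And>x. \<bar>f x\<bar> \<le> C * (1 + norm x) ^ N" using assms(1) by (rule polybE) (rule that)
  obtain D M where 2: "D \<ge> 0" "\<And>x. \<bar>g x\<bar> \<le> D * (1 + norm x) ^ M" using assms(2) by (rule polybE) (rule that)
  have "\<bar>f x + g x\<bar> \<le> (C + D) * (1 + norm x) ^ (N + M)" for x
  proof -
    have "\<bar>f x\<bar> \<le> C * (1 + norm x) ^ (N + M)"
      by (rule order_trans[OF 1(2)]) (intro mult_left_mono power_increasing, auto simp: 1)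
    moreover have "\<bar>g x\<bar> \<le> D * (1 + norm x) ^ (N + M)"
      by (rule order_trans[OF 2(2)]) (intro mult_left_mono power_increasing, auto simp: 2)
    ultimately show ?thesis by (simp add: distrib_right)
  qed
  then show ?thesis using assms[THEN polyb_measurable] by (intro polybI) auto
qed

lemma polyb_mult [simp]:
  assumes "polyb f" "polyb g"
  shows "polyb (\<lambda>x. f x * g x)"
proof -
  obtain C N where 1: "C \<ge> 0" "\<And>x. \<bar>f x\<bar> \<le> C * (1 + norm x) ^ N" using assms(1) by (rule polybE) (rule that)
  obtain D M where 2: "D \<ge> 0" "\<And>x. \<bar>g x\<bar> \<le> D * (1 + norm x) ^ M" using assms(2) by (rule polybE) (rule that)
  have "\<bar>f x * g x\<bar> \<le> (C * D) * (1 + norm x) ^ (N + M)" for x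
    using mult_mono[OF 1(2)[of x] 2(2)[of x]] 1(1) by (simp add: abs_mult power_add mult_ac)
  then show ?thesis using assms[THEN polyb_measurable] by (intro polybI) auto
qed

lemma polyb_uminus [simp]: "polyb f \<Longrightarrow> polyb (\<lambda>x. - f x)"
  using polyb_mult[OF polyb_const[of "-1"]] by simp

lemma polyb_diff [simp]: "polyb f \<Longrightarrow> polyb g \<Longrightarrow> polyb (\<lambda>x. f x - g x)"
  using polyb_add[OF _ polyb_uminus] by simp

lemma polyb_divide [simp]: "polyb f \<Longrightarrow> polyb (\<lambda>x. f x / c)"
  using polyb_mult[OF _ polyb_const[of "1/c"]] by simp

lemma polyb_power [simp]: "polyb f \<Longrightarrow> polyb (\<lambda>x. f x ^ n)"
  by (induction n) auto

lemma polyb_sum [simp]: "(\<And>i. i \<in> I \<Longrightarrow> polyb (f i)) \<Longrightarrow> polyb (\<lambda>x. \<Sum>i\<in>I. f i x)"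
  by (induction I rule: infinite_finite_induct) auto

lemma polyb_norm [simp]: "polyb norm"
  by (rule polybI[where C=1 and N=1]) auto

lemma polyb_inner [simp]: "polyb (\<lambda>x. x \<bullet> b)"
  by (rule polyb_bound[of "\<lambda>x. norm x * norm b"]) (auto simp: Cauchy_Schwarz_ineq2)

lemma polyb_compose:
  fixes g :: "'a::euclidean_space \<Rightarrow> 'b::euclidean_space"
  assumes "polyb f" "g \<in> borel_measurable borel" "\<And>x. norm (g x) \<le> c * norm x"
  shows "polyb (\<lambda>x. f (g x))"
proof -
  obtain C N where 1: "C \<ge> 0" "\<And>x. \<bar>f x\<bar> \<le> C * (1 + norm x) ^ N" using assms(1) by (rule polybE) (rule that)
  have "polyb (\<lambda>x::'a. C * (1 + c * norm x) ^ N)" by simp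
  moreover have "\<bar>f (g x)\<bar> \<le> C * (1 + c * norm x) ^ N" for x
    by (rule order_trans[OF 1(2)]) (intro mult_left_mono power_mono, auto simp: 1 assms)
  ultimately show ?thesis
    using assms(2) polyb_measurable[OF assms(1)] by (intro polyb_bound[OF _ measurable_compose])
qed

lemma polyb_fst [simp]: "polyb f \<Longrightarrow> polyb (\<lambda>p. f (fst p))"
  by (rule polyb_compose[where c=1]) (auto simp: norm_fst_le borel_measurable_continuous_onI continuous_intros)

lemma polyb_snd [simp]: "polyb f \<Longrightarrow> polyb (\<lambda>p. f (snd p))"
  by (rule polyb_compose[where c=1]) (auto simp: norm_snd_le borel_measurable_continuous_onI continuous_intros)

lemma polyb_shift [simp]:
  fixes f :: "'a::euclidean_space \<Rightarrow> real"
  assumes "polyb f"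
  shows "polyb (\<lambda>p. f (fst p + snd p))"
proof (rule polyb_compose[OF assms, where c=2])
  show "norm (fst x + snd x) \<le> 2 * norm x" for x :: "'a \<times> 'a"
    using norm_triangle_ineq[of "fst x" "snd x"] norm_fst_le[of "fst x" "snd x"] norm_snd_le[of "snd x" "fst x"]
    by simp
qed (auto simp: borel_measurable_continuous_onI continuous_intros)

lemma polyb_slice:
  assumes "polyb F"
  shows "polyb (\<lambda>y. F (x, y))"
proof -
  obtain C N where 1: "C \<ge> 0" "\<And>x. \<bar>F x\<bar> \<le> C * (1 + norm x) ^ N" using assms(1) by (rule polybE) (rule that)
  have [measurable]: "F \<in> borel_measurable (borel \<Otimes>\<^sub>M borel)"
    using assms by (simp add: polyb_def borel_prod)
  have "\<bar>F (x, y)\<bar> \<le> C * (1 + norm x + norm y) ^ N" for y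
    by (rule order_trans[OF 1(2)]) (intro mult_left_mono power_mono, auto simp: 1 norm_Pair_le add.assoc)
  moreover have "polyb (\<lambda>y::'b. C * (1 + norm x + norm y) ^ N)" by simp
  ultimately show ?thesis
    by (intro polyb_bound[where f="\<lambda>y. F (x, y)" and g="\<lambda>y. C * (1 + norm x + norm y) ^ N"]) simp_all
qed

text \<open>\<open>1 + |(x, y)| <= (1 + |x|) (1 + |y|)\<close> separates the variables; the factor
  in \<open>y\<close> integrates to a finite moment and the exponent in \<open>x\<close> is
  kept.\<close>

lemma polyb_integral [simp]:
  fixes F :: "'a::euclidean_space \<times> 'b::euclidean_space \<Rightarrow> real"
  assumes "polyb F"
  shows "polyb (\<lambda>x. \<integral>y. F (x, y) \<partial>gm)"
proof -
  obtain C N where 1: "C \<ge> 0" "\<And>x. \<bar>F x\<bar> \<le> C * (1 + norm x) ^ N" using assms(1) by (rule polybE) (rule that)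
  have "F \<in> borel_measurable (borel \<Otimes>\<^sub>M borel)"
    using assms by (simp add: polyb_def borel_prod)
  then have F: "F \<in> borel_measurable (borel \<Otimes>\<^sub>M gm)"
    using measurable_cong_sets[OF sets_pair_measure_cong[OF refl sets_gm] refl] by blast
  have m: "(\<lambda>x. \<integral>y. F (x, y) \<partial>gm) \<in> borel_measurable borel"
    using gm.borel_measurable_lebesgue_integral[of "curry F" borel] F by (simp add: curry_def case_prod_beta')
  have i: "integrable gm (\<lambda>y::'b. (1 + norm y) ^ N)" by (rule polyb_integrable) simp
  have "\<bar>\<integral>y. F (x, y) \<partial>gm\<bar> \<le> (C * (\<integral>y. (1 + norm y) ^ N \<partial>(gm::'b measure))) * (1 + norm x) ^ N" for x
  proof -
    have "\<bar>\<integral>y. F (x, y) \<partial>gm\<bar> \<le> (\<integral>y. \<bar>F (x, y)\<bar> \<partial>gm)" by (rule integral_abs_bound)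
    also have "\<dots> \<le> (\<integral>y. C * (1 + norm x) ^ N * (1 + norm (y::'b)) ^ N \<partial>gm)"
    proof (rule integral_mono)
      show "integrable gm (\<lambda>y. \<bar>F (x, y)\<bar>)"
        using polyb_integrable[OF polyb_slice[OF assms]] by simp
      show "integrable gm (\<lambda>y::'b. C * (1 + norm x) ^ N * (1 + norm y) ^ N)"
        using i by simp
      fix y :: 'b
      have "1 + norm (x, y) \<le> (1 + norm x) * (1 + norm y)"
        using norm_Pair_le[of x y] by (simp add: algebra_simps) (smt (verit) mult_nonneg_nonneg norm_ge_zero)
      then have "C * (1 + norm (x, y)) ^ N \<le> C * ((1 + norm x) * (1 + norm y)) ^ N"
        by (intro mult_left_mono power_mono) (auto simp: 1)
      with 1(2)[of "(x, y)"] show "\<bar>F (x, y)\<bar> \<le> C * (1 + norm x) ^ N * (1 + norm y) ^ N"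
        by (simp add: power_mult_distrib mult.assoc)
    qed
    finally show ?thesis by (simp add: mult_ac)
  qed
  with m show ?thesis by (rule polybI)
qed

section \<open>Moments of the Gaussian measure\<close>

lemma gm_odd_moment: "(\<integral>w. w ^ (2 * k + 1) \<partial>(gm :: real measure)) = 0"
  using integral_normal_moment_odd[of "sqrt 2" 0 k]
  by (simp add: integral_gm gauss_kernel_real)

lemma gm_even_moment: "(\<integral>w. w ^ (2 * k) \<partial>(gm :: real measure)) = fact (2 * k) / fact k"
  using integral_normal_moment_even[of "sqrt 2" 0 k]
  by (simp add: integral_gm gauss_kernel_real)

lemma integral_gm_coord:
  fixes b :: "'a::euclidean_space"
  assumes "b \<in> Basis" "polyb f"
  shows "(\<integral>x. f (x \<bullet> b) \<partial>gm) = (\<integral>w. f w \<partial>gm)"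
proof -
  have "(\<integral>x. (\<Prod>c\<in>Basis. (if c = b then f else (\<lambda>_. 1)) (x \<bullet> c)) \<partial>gm)
      = (\<Prod>c\<in>(Basis::'a set). \<integral>w. (if c = b then f else (\<lambda>_. 1)) w \<partial>gm)"
    using assms by (intro integral_gm_prod) (auto intro: polyb_integrable)
  moreover have "(if c = b then f else (\<lambda>_. 1)) w = (if c = b then f w else 1)" for c w
    by simp
  moreover have "(\<integral>w. (if c = b then f w else 1) \<partial>gm) = (if c = b then (\<integral>w. f w \<partial>gm) else 1)" for c
    by simp
  ultimately show ?thesis using assms(1) by simp
qed

lemma gm_covariance:
  fixes b c :: "'a::euclidean_space"
  assumes "b \<in> Basis" "c \<in> Basis"
  shows "(\<integral>x. (x \<bullet> b) * (x \<bullet> c) \<partial>gm) = (if b = c then 2 else 0)"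
proof (cases "b = c")
  case True
  have "(\<integral>x. (x \<bullet> b)\<^sup>2 \<partial>gm) = (\<integral>w. w\<^sup>2 \<partial>(gm::real measure))"
    using integral_gm_coord[OF assms(1), of "\<lambda>w. w\<^sup>2"] polyb_power[OF polyb_inner[of "1::real"], of 2] by simp
  also have "\<dots> = 2" using gm_even_moment[of 1] by (simp add: fact_numeral)
  finally show ?thesis using True by (simp add: power2_eq_square)
next
  case False
  have p: "polyb (\<lambda>w::real. w)" using polyb_inner[of "1::real"] by simp
  let ?f = "\<lambda>d w. if d = b \<or> d = c then w else (1::real)"
  have i: "integrable gm (?f d)" for d
    using polyb_integrable[OF p] by (cases "d = b \<or> d = c") auto
  have "(\<integral>x. (\<Prod>d\<in>Basis. ?f d (x \<bullet> d)) \<partial>gm) = (\<Prod>d\<in>(Basis::'a set). \<integral>w. ?f d w \<partial>gm)"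
    using i by (rule integral_gm_prod)
  also have "\<dots> = 0"
    using assms(1) gm_odd_moment[of 0] by (intro prod_zero bexI[of _ b]) auto
  also have "(\<lambda>x::'a. \<Prod>d\<in>Basis. ?f d (x \<bullet> d)) = (\<lambda>x. (x \<bullet> b) * (x \<bullet> c))"
  proof
    fix x :: 'a
    have "(\<Prod>d\<in>Basis. ?f d (x \<bullet> d)) = (\<Prod>d\<in>{b, c}. x \<bullet> d)"
      using assms by (intro prod.mono_neutral_cong_right) auto
    then show "(\<Prod>d\<in>Basis. ?f d (x \<bullet> d)) = (x \<bullet> b) * (x \<bullet> c)" using False by simp
  qed
  finally show ?thesis using False by simp
qed

section \<open>Energy stability\<close>

text \<open>Convolution with \<open>G_t\<close> over \<open>lborel\<close>. For Borel functions it
  equals \<open>conv\<close>, which integrates over the completed measure; Fubini and the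
  measurability rules are available for this version.\<close>

definition gauss_op :: "real \<Rightarrow> ('a::euclidean_space \<Rightarrow> real) \<Rightarrow> 'a \<Rightarrow> real" where
  "gauss_op t f x = (\<integral>y. gauss_kernel t (x - y) * f y \<partial>lborel)"

definition gauss_form :: "real \<Rightarrow> ('a::euclidean_space \<Rightarrow> real) \<Rightarrow> ('a \<Rightarrow> real) \<Rightarrow> real" where
  "gauss_form t a b = (\<integral>x. a x * gauss_op t b x \<partial>lborel)"

lemma gauss_kernel_le: "t > 0 \<Longrightarrow> gauss_kernel t (x::'a::euclidean_space) \<le> gauss_kernel t (0::'a)"
  by (simp add: gauss_kernel_def divide_right_mono)

lemma gauss_op_measurable [measurable]:
  assumes [measurable]: "f \<in> borel_measurable borel"
  shows "gauss_op t f \<in> borel_measurable borel"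
proof -
  have "(\<lambda>(x, y). gauss_kernel t (x - y) * f y) \<in> borel_measurable (borel \<Otimes>\<^sub>M lborel)"
    by measurable
  then have "(\<lambda>x. \<integral>y. gauss_kernel t (x - y) * f y \<partial>lborel) \<in> borel_measurable borel"
    by (intro lborel.borel_measurable_lebesgue_integral) simp
  then show ?thesis by (simp add: gauss_op_def[abs_def])
qed

lemma conv_gauss_op:
  "f \<in> borel_measurable borel \<Longrightarrow> conv (gauss_kernel t) f x = gauss_op t f x"
  by (simp add: conv_lborel gauss_op_def)

context
  fixes t :: real
  assumes t: "t > 0"
begin

lemma integrable_gauss_kernel_shift: "integrable lborel (\<lambda>x::'a::euclidean_space. gauss_kernel t (x - y))"
  and integral_gauss_kernel_shift: "(\<integral>x. gauss_kernel t (x - y) \<partial>lborel) = (1::real)"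
proof -
  show "(\<integral>x. gauss_kernel t (x - y) \<partial>lborel) = 1"
    using integral_lborel_shift[of "gauss_kernel t" "- y"] gauss_kernel_integral[OF t, where 'a='a] by simp
  then show "integrable lborel (\<lambda>x. gauss_kernel t (x - y))"
    using not_integrable_integral_eq by fastforce
qed

lemma gauss_kernel_integrable_pair:
  fixes e :: "'a::euclidean_space \<Rightarrow> real"
  assumes e: "integrable lborel e"
  shows "integrable (lborel \<Otimes>\<^sub>M lborel) (\<lambda>(y, x). gauss_kernel t (x - y) * e y)"
proof (rule lborel_pair.Fubini_integrable)
  have [measurable]: "e \<in> borel_measurable borel" using e by auto
  show "(\<lambda>(y, x). gauss_kernel t (x - y) * e y) \<in> borel_measurable (lborel \<Otimes>\<^sub>M lborel)"
    by measurable
  show "integrable lborel (\<lambda>y. \<integral>x. norm (case (y, x) of (y, x) \<Rightarrow> gauss_kernel t (x - y) * e y) \<partial>lborel)"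
    using e by (simp add: abs_mult integral_gauss_kernel_shift)
  show "AE y in lborel. integrable lborel (\<lambda>x. case (y, x) of (y, x) \<Rightarrow> gauss_kernel t (x - y) * e y)"
    by (simp add: integrable_gauss_kernel_shift)
qed

lemma gauss_op_integrable:
  assumes "integrable lborel e"
  shows "integrable lborel (gauss_op t e)"
  using lborel_pair.integrable_snd[OF gauss_kernel_integrable_pair[OF assms]]
  by (simp add: gauss_op_def[abs_def])

lemma integral_gauss_op:
  assumes "integrable lborel e"
  shows "(\<integral>x. gauss_op t e x \<partial>lborel) = (\<integral>x. e x \<partial>lborel)"
  using lborel_pair.Fubini_integral[OF gauss_kernel_integrable_pair[OF assms]]
  by (simp add: gauss_op_def integral_gauss_kernel_shift)

lemma integrable_gauss_kernel_mult_bounded: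
  fixes b :: "'a::euclidean_space \<Rightarrow> real"
  assumes [measurable]: "b \<in> borel_measurable borel" and "\<And>y. \<bar>b y\<bar> \<le> B"
  shows "integrable lborel (\<lambda>y. gauss_kernel t (x - y) * b y)"
proof (rule Bochner_Integration.integrable_bound)
  show "integrable lborel (\<lambda>y. gauss_kernel t (y - x) * B)"
    by (simp add: integrable_gauss_kernel_shift)
  show "AE y in lborel. norm (gauss_kernel t (x - y) * b y) \<le> norm (gauss_kernel t (y - x) * B)"
  proof (rule AE_I2)
    fix y :: 'a
    have "\<bar>b y\<bar> \<le> \<bar>B\<bar>" using assms(2)[of y] by simp
    then show "norm (gauss_kernel t (x - y) * b y) \<le> norm (gauss_kernel t (y - x) * B)"
      by (simp add: abs_mult gauss_kernel_commute[of t x y] mult_left_mono)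
  qed
qed measurable

lemma gauss_op_bounded:
  fixes b :: "'a::euclidean_space \<Rightarrow> real"
  assumes [measurable]: "b \<in> borel_measurable borel" and b: "\<And>y. \<bar>b y\<bar> \<le> B"
  shows "\<bar>gauss_op t b x\<bar> \<le> B"
proof -
  have "\<bar>gauss_op t b x\<bar> \<le> (\<integral>y. \<bar>gauss_kernel t (x - y) * b y\<bar> \<partial>lborel)"
    unfolding gauss_op_def by (rule integral_abs_bound)
  also have "\<dots> \<le> (\<integral>y. gauss_kernel t (y - x) * B \<partial>lborel)"
    using integrable_gauss_kernel_mult_bounded[OF assms, THEN integrable_abs, of x] b
    by (intro integral_mono) (auto simp: abs_mult gauss_kernel_commute[of t x] mult_left_mono integrable_gauss_kernel_shift
        intro!: integrable_abs)
  finally show ?thesis by (simp add: integral_gauss_kernel_shift)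
qed

lemma gauss_op_integrable_at:
  fixes e :: "'a::euclidean_space \<Rightarrow> real"
  assumes "integrable lborel e"
  shows "integrable lborel (\<lambda>y. gauss_kernel t (x - y) * e y)"
proof (rule Bochner_Integration.integrable_bound)
  have [measurable]: "e \<in> borel_measurable borel" using assms by auto
  show "integrable lborel (\<lambda>y. gauss_kernel t (0::'a) * e y)" using assms by simp
  show "AE y in lborel. norm (gauss_kernel t (x - y) * e y) \<le> norm (gauss_kernel t (0::'a) * e y)"
    by (auto simp: abs_mult gauss_kernel_le[OF t] intro!: mult_right_mono)
  show "(\<lambda>y. gauss_kernel t (x - y) * e y) \<in> borel_measurable lborel" by measurable
qed

text \<open>One factor is merely bounded, since the indicator of the initial set need not be
  integrable; the other one supplies the integrable majorant \<open>G_t(x - y) |e(y)| |B|\<close>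
  for Fubini.\<close>

lemma gauss_op_symmetric:
  fixes e b :: "'a::euclidean_space \<Rightarrow> real"
  assumes e: "integrable lborel e" and [measurable]: "b \<in> borel_measurable borel" and b: "\<And>y. \<bar>b y\<bar> \<le> B"
  shows "(\<integral>x. e x * gauss_op t b x \<partial>lborel) = (\<integral>x. b x * gauss_op t e x \<partial>lborel)"
proof -
  have [measurable]: "e \<in> borel_measurable borel" using e by auto
  have "integrable (lborel \<Otimes>\<^sub>M lborel) (\<lambda>(y, x). gauss_kernel t (x - y) * e y * b x)"
  proof (rule Bochner_Integration.integrable_bound)
    show "integrable (lborel \<Otimes>\<^sub>M lborel) (\<lambda>p. (case p of (y, x) \<Rightarrow> gauss_kernel t (x - y) * e y) * B)"
      using gauss_kernel_integrable_pair[OF e] by simp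
    show "(\<lambda>(y, x). gauss_kernel t (x - y) * e y * b x) \<in> borel_measurable (lborel \<Otimes>\<^sub>M lborel)"
      by measurable
    have "\<bar>b x\<bar> \<le> \<bar>B\<bar>" for x using b[of x] by simp
    then show "AE p in lborel \<Otimes>\<^sub>M lborel. norm (case p of (y, x) \<Rightarrow> gauss_kernel t (x - y) * e y * b x)
         \<le> norm ((case p of (y, x) \<Rightarrow> gauss_kernel t (x - y) * e y) * B)"
      by (auto simp: abs_mult mult_left_mono)
  qed
  then have f1: "(\<integral>x. \<integral>y. gauss_kernel t (x - y) * e y * b x \<partial>lborel \<partial>lborel)
       = (\<integral>y. \<integral>x. gauss_kernel t (x - y) * e y * b x \<partial>lborel \<partial>lborel)"
    by (rule lborel_pair.Fubini_integral)
  have f2: "(\<integral>x. gauss_kernel t (x - y) * e y * b x \<partial>lborel) = e y * gauss_op t b y" for y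
    unfolding gauss_op_def integral_mult_right_zero[symmetric]
    by (intro Bochner_Integration.integral_cong) (simp_all add: gauss_kernel_commute[of t y])
  have f3: "(\<integral>y. gauss_kernel t (x - y) * e y * b x \<partial>lborel) = b x * gauss_op t e x" for x
    unfolding gauss_op_def integral_mult_right_zero[symmetric]
    by (intro Bochner_Integration.integral_cong) simp_all
  show ?thesis using f1 unfolding f2 f3 by (rule sym)
qed

end

text \<open>Completing the square; the value of the constant (which is 1) is irrelevant.\<close>

lemma gauss_kernel_semigroup:
  assumes t: "t > 0"
  shows "\<exists>c>0. \<forall>x y::'a::euclidean_space.
    (\<integral>z. gauss_kernel (t/2) (x - z) * gauss_kernel (t/2) (z - y) \<partial>lborel) = c * gauss_kernel t (x - y)"
proof -
  let ?n = "\<lambda>s. (4 * pi * s) powr (real DIM('a) / 2)"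
  define c where "c = ?n t * ?n (t/4) / (?n (t/2))\<^sup>2"
  have pos: "?n s > 0" if "s > 0" for s using that by simp
  have c: "c > 0" using t unfolding c_def by simp
  have eq: "gauss_kernel (t/2) (x - z) * gauss_kernel (t/2) (z - y)
      = c * gauss_kernel t (x - y) * gauss_kernel (t/4) (z - (1/2) *\<^sub>R (x + y))" for x y z :: 'a
  proof -
    define a b where "a = x - z" and "b = z - y"
    have ab: "x - y = a + b" "z - (1/2) *\<^sub>R (x + y) = (1/2) *\<^sub>R (b - a)"
      unfolding a_def b_def by (simp_all add: algebra_simps scaleR_2[symmetric] flip: scaleR_scaleR)
        (simp add: scaleR_2 flip: scaleR_add_left)
    have "(norm a)\<^sup>2 / (2 * t) + (norm b)\<^sup>2 / (2 * t) = (norm (a + b))\<^sup>2 / (4 * t) + (norm ((1/2) *\<^sub>R (b - a)))\<^sup>2 / t"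
      using t by (simp add: power2_norm_eq_inner inner_simps inner_commute field_simps)
    then have e: "exp (- (norm a)\<^sup>2 / (4 * (t/2))) * exp (- (norm b)\<^sup>2 / (4 * (t/2)))
        = exp (- (norm (a + b))\<^sup>2 / (4 * t)) * exp (- (norm ((1/2) *\<^sub>R (b - a)))\<^sup>2 / (4 * (t/4)))"
      unfolding exp_add[symmetric] by (simp add: add_divide_distrib)
    have n: "1 / ?n (t/2) * (1 / ?n (t/2)) = c * (1 / ?n t) * (1 / ?n (t/4))"
      using pos[of t] pos[of "t/2"] pos[of "t/4"] t by (simp add: c_def power2_eq_square)
    have "gauss_kernel (t/2) a * gauss_kernel (t/2) b
      = (1 / ?n (t/2) * (1 / ?n (t/2))) * (exp (- (norm a)\<^sup>2 / (4 * (t/2))) * exp (- (norm b)\<^sup>2 / (4 * (t/2))))"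
      unfolding gauss_kernel_def by (simp only: mult_ac)
    also have "\<dots> = c * gauss_kernel t (a + b) * gauss_kernel (t/4) ((1/2) *\<^sub>R (b - a))"
      unfolding n e gauss_kernel_def by (simp only: mult_ac)
    finally show ?thesis unfolding ab a_def[symmetric] b_def[symmetric] .
  qed
  have "(\<integral>z. gauss_kernel (t/2) (x - z) * gauss_kernel (t/2) (z - y) \<partial>lborel) = c * gauss_kernel t (x - y)" for x y :: 'a
    unfolding eq using t by (simp add: integral_gauss_kernel_shift)
  with c show ?thesis by blast
qed

text \<open>The semigroup law makes the form a positive multiple of the squared norm of
  \<open>gauss_op (t/2) e\<close>, which gives positivity without a Fourier transform.\<close>

lemma gauss_form_nonneg:
  fixes e :: "'a::euclidean_space \<Rightarrow> real"
  assumes t: "t > 0" and e: "integrable lborel e" and b: "\<And>y. \<bar>e y\<bar> \<le> B"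
  shows "0 \<le> gauss_form t e e"
proof -
  obtain c where c: "c > 0" and
    sg: "\<And>x y::'a. (\<integral>z. gauss_kernel (t/2) (x - z) * gauss_kernel (t/2) (z - y) \<partial>lborel) = c * gauss_kernel t (x - y)"
    using gauss_kernel_semigroup[OF t, where 'a='a] by blast
  have t2: "t / 2 > 0" using t by simp
  have [measurable]: "e \<in> borel_measurable borel" using e by auto
  define F where "F = gauss_op (t/2) e"
  have [measurable]: "F \<in> borel_measurable borel" by (simp add: F_def)
  have FB: "\<bar>F y\<bar> \<le> B" for y unfolding F_def by (rule gauss_op_bounded[OF t2]) (auto simp: b)
  have "gauss_op (t/2) F x = c * gauss_op t e x" for x
  proof -
    have "integrable (lborel \<Otimes>\<^sub>M lborel) (\<lambda>(y, z). gauss_kernel (t/2) (x - z) * (gauss_kernel (t/2) (z - y) * e y))"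
    proof (rule Bochner_Integration.integrable_bound)
      show "integrable (lborel \<Otimes>\<^sub>M lborel) (\<lambda>p. gauss_kernel (t/2) (0::'a) * (case p of (y, z) \<Rightarrow> gauss_kernel (t/2) (z - y) * e y))"
        using gauss_kernel_integrable_pair[OF t2 e] by simp
      show "AE p in lborel \<Otimes>\<^sub>M lborel. norm (case p of (y, z) \<Rightarrow> gauss_kernel (t/2) (x - z) * (gauss_kernel (t/2) (z - y) * e y))
         \<le> norm (gauss_kernel (t/2) (0::'a) * (case p of (y, z) \<Rightarrow> gauss_kernel (t/2) (z - y) * e y))"
        by (auto simp: abs_mult gauss_kernel_le[OF t2] split_beta intro!: mult_right_mono AE_I2)
    qed measurable
    then have "(\<integral>z. \<integral>y. gauss_kernel (t/2) (x - z) * (gauss_kernel (t/2) (z - y) * e y) \<partial>lborel \<partial>lborel)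
       = (\<integral>y. \<integral>z. gauss_kernel (t/2) (x - z) * (gauss_kernel (t/2) (z - y) * e y) \<partial>lborel \<partial>lborel)"
      by (rule lborel_pair.Fubini_integral)
    moreover have "(\<integral>z. gauss_kernel (t/2) (x - z) * (gauss_kernel (t/2) (z - y) * e y) \<partial>lborel)
        = c * (gauss_kernel t (x - y) * e y)" for y
    proof -
      have "(\<integral>z. gauss_kernel (t/2) (x - z) * (gauss_kernel (t/2) (z - y) * e y) \<partial>lborel)
        = (\<integral>z. gauss_kernel (t/2) (x - z) * gauss_kernel (t/2) (z - y) \<partial>lborel) * e y"
        unfolding integral_mult_left_zero[symmetric] by (simp only: mult.assoc)
      then show ?thesis by (simp add: sg)
    qed
    ultimately show ?thesis by (simp add: gauss_op_def F_def)
  qed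
  then have "(\<integral>x. e x * gauss_op (t/2) F x \<partial>lborel) = c * gauss_form t e e"
    by (simp add: gauss_form_def mult.left_commute)
  moreover have "(\<integral>x. e x * gauss_op (t/2) F x \<partial>lborel) = (\<integral>x. F x * F x \<partial>lborel)"
    using gauss_op_symmetric[OF t2 e _ FB] by (simp add: F_def)
  moreover have "0 \<le> (\<integral>x. F x * F x \<partial>lborel)" by (rule integral_nonneg_AE) simp
  ultimately show ?thesis using c by (simp add: zero_le_mult_iff)
qed

section \<open>Bilinear calculus on bounded integrable functions\<close>

definition bdd_int :: "('a::euclidean_space \<Rightarrow> real) \<Rightarrow> bool" where
  "bdd_int e \<longleftrightarrow> integrable lborel e \<and> (\<exists>B. \<forall>y. \<bar>e y\<bar> \<le> B)"

lemma bdd_int_add: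
  assumes "bdd_int a" "bdd_int b"
  shows "bdd_int (\<lambda>x. a x + b x)"
proof -
  obtain A B where "\<And>y. \<bar>a y\<bar> \<le> A" "\<And>y. \<bar>b y\<bar> \<le> B" using assms unfolding bdd_int_def by blast
  then have "\<bar>a y + b y\<bar> \<le> A + B" for y by (meson abs_triangle_ineq add_mono order_trans)
  with assms show ?thesis unfolding bdd_int_def by (auto intro!: exI[of _ "A + B"])
qed

lemma bdd_int_scale:
  assumes "bdd_int a"
  shows "bdd_int (\<lambda>x. c * a x)"
proof -
  obtain A where A: "\<And>y. \<bar>a y\<bar> \<le> A" using assms unfolding bdd_int_def by blast
  then have "\<bar>c * a y\<bar> \<le> \<bar>c\<bar> * A" for y by (simp add: abs_mult mult_left_mono)
  with assms show ?thesis unfolding bdd_int_def by (auto intro!: exI[of _ "\<bar>c\<bar> * A"])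
qed

lemma bdd_int_zero [simp]: "bdd_int (\<lambda>x. 0)"
  unfolding bdd_int_def by auto

lemma bdd_int_diff: "bdd_int a \<Longrightarrow> bdd_int b \<Longrightarrow> bdd_int (\<lambda>x. a x - b x)"
  using bdd_int_add[OF _ bdd_int_scale[of b "-1"]] by simp

lemma bdd_int_integrable_mult:
  assumes a: "bdd_int a" and [measurable]: "f \<in> borel_measurable borel" and f: "\<And>x. \<bar>f x\<bar> \<le> B"
  shows "integrable lborel (\<lambda>x. a x * f x)"
proof (rule Bochner_Integration.integrable_bound)
  have [measurable]: "a \<in> borel_measurable borel" using a unfolding bdd_int_def by auto
  show "integrable lborel (\<lambda>x. a x * B)" using a by (simp add: bdd_int_def)
  have "\<bar>f x\<bar> \<le> \<bar>B\<bar>" for x using f[of x] by simp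
  then show "AE x in lborel. norm (a x * f x) \<le> norm (a x * B)" by (simp add: abs_mult mult_left_mono)
  show "(\<lambda>x. a x * f x) \<in> borel_measurable lborel" by measurable
qed

context
  fixes t :: real
  assumes t: "t > 0"
begin

lemma bdd_int_gauss_op: 
  assumes "bdd_int e"
  shows "bdd_int (gauss_op t e)"
proof -
  obtain B where B: "\<And>y. \<bar>e y\<bar> \<le> B" and i: "integrable lborel e" using assms unfolding bdd_int_def by blast
  have "e \<in> borel_measurable borel" using i by auto
  then have "\<bar>gauss_op t e x\<bar> \<le> B" for x using B by (rule gauss_op_bounded[OF t])
  with gauss_op_integrable[OF t i] show ?thesis unfolding bdd_int_def by blast
qed

lemma gauss_form_integrable:
  assumes "bdd_int a" "bdd_int b"
  shows "integrable lborel (\<lambda>x. a x * gauss_op t b x)"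
proof -
  obtain B where B: "\<And>y. \<bar>gauss_op t b y\<bar> \<le> B" using bdd_int_gauss_op[OF assms(2)] unfolding bdd_int_def by blast
  have "gauss_op t b \<in> borel_measurable borel" using bdd_int_gauss_op[OF assms(2)] unfolding bdd_int_def by auto
  then show ?thesis using B by (rule bdd_int_integrable_mult[OF assms(1)])
qed

lemma gauss_form_commute:
  assumes "bdd_int a" "bdd_int b"
  shows "gauss_form t a b = gauss_form t b a"
proof -
  obtain B where B: "\<And>y. \<bar>b y\<bar> \<le> B" using assms(2) unfolding bdd_int_def by blast
  show ?thesis unfolding gauss_form_def
    by (rule gauss_op_symmetric[OF t _ _ B]) (use assms in \<open>auto simp: bdd_int_def\<close>)
qed

lemma gauss_form_add_left:
  assumes "bdd_int a" "bdd_int b" "bdd_int c"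
  shows "gauss_form t (\<lambda>x. a x + b x) c = gauss_form t a c + gauss_form t b c"
  unfolding gauss_form_def distrib_right
  by (rule Bochner_Integration.integral_add) (intro gauss_form_integrable assms)+

lemma gauss_form_scale_left: "gauss_form t (\<lambda>x. k * a x) c = k * gauss_form t a c"
  unfolding gauss_form_def mult.assoc by simp

lemma gauss_form_diff_left:
  assumes "bdd_int a" "bdd_int b" "bdd_int c"
  shows "gauss_form t (\<lambda>x. a x - b x) c = gauss_form t a c - gauss_form t b c"
  using gauss_form_add_left[OF assms(1) bdd_int_scale[OF assms(2)] assms(3), of "-1"] gauss_form_scale_left[of "-1" b c]
  by simp

lemma gauss_form_nonneg': "bdd_int a \<Longrightarrow> 0 \<le> gauss_form t a a"
  unfolding bdd_int_def using gauss_form_nonneg[OF t] by blast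

end

lemma integrable_gauss_kernel_mult:
  assumes "t > 0" "f \<in> borel_measurable borel" "\<And>y. \<bar>f y\<bar> \<le> B"
  shows "integrable lborel (\<lambda>y. gauss_kernel t (x - y) * f y)"
  using integrable_gauss_kernel_mult_bounded[OF assms] .

section \<open>Stage sets and energies of Borel sets\<close>

lemma stage_set_0 [simp]: "stage_set \<gamma> t S 0 = S"
  by (subst stage_set.simps) simp

lemma stage_set_pos:
  "m > 0 \<Longrightarrow> stage_set \<gamma> t S m =
    {x. conv (gauss_kernel t) (\<lambda>y. \<Sum>i<m. \<gamma> m i * indicator (stage_set \<gamma> t S i) y) x \<ge> 1 / 2}"
  by (subst stage_set.simps) simp

lemma stage_set_borel:
  assumes "S \<in> sets borel"
  shows "stage_set \<gamma> t S m \<in> sets borel"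
proof (induction m rule: less_induct)
  case (less m)
  show ?case
  proof (cases "m = 0")
    case False
    have f [measurable]: "(\<lambda>y. \<Sum>i<m. \<gamma> m i * indicator (stage_set \<gamma> t S i) y :: real) \<in> borel_measurable borel"
      using less by (intro borel_measurable_sum borel_measurable_times) auto
    have "Measurable.pred borel (\<lambda>x. 1 / 2 \<le> gauss_op t (\<lambda>y. \<Sum>i<m. \<gamma> m i * indicator (stage_set \<gamma> t S i) y) x)"
      by measurable
    then show ?thesis using False by (simp only: stage_set_pos conv_gauss_op[OF f] pred_def neq0_conv space_borel Collect_conj_eq Collect_mem_eq Int_UNIV_left)
  qed (use assms in simp)
qed

lemma energy_lborel:
  assumes "S \<in> sets borel"
  shows "energy t S = (\<integral>\<^sup>+x. ennreal ((1 - indicator S x) * gauss_op t (indicator S) x) \<partial>lborel)"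
  using assms unfolding energy_def nn_integral_completion by (simp add: conv_gauss_op)

text \<open>With \<open>w m\<close> the function thresholded for stage \<open>m + 1\<close>, the
  indicator of that stage minimises the integral of \<open>(1 - 2 * w m) * u\<close> among functions
  with values in \<open>[0, 1]\<close>; the competitor is stage \<open>m\<close>. In terms of the
  differences \<open>d m\<close> to the initial set, the linear parts \<open>L\<close> telescope to
  \<open>L (d M)\<close>, while the energy changes by
  \<open>L (d M) - gauss_form t (d M) (d M)\<close>. The hypothesis \<open>Q\<close> closes the gap,
  so stability is reduced to the positivity of a form in the coefficients alone. Infinite initial
  energy is trivial.\<close>

lemma stage_energy_le:
  fixes S :: "'a::euclidean_space set"
  assumes t: "t > 0" and S: "S \<in> sets borel"
    and sum1: "\<And>m. m < M \<Longrightarrow> (\<Sum>i<Suc m. \<gamma> (Suc m) i) = 1"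
    and Q: "\<And>d. (\<And>i. bdd_int (d i)) \<Longrightarrow> d 0 = (\<lambda>_::'a. 0) \<Longrightarrow>
      0 \<le> gauss_form t (d M) (d M)
         - 2 * (\<Sum>m<M. \<Sum>i<Suc m. \<gamma> (Suc m) i * gauss_form t (\<lambda>x. d (Suc m) x - d m x) (d i))"
  shows "energy t (stage_set \<gamma> t S M) \<le> energy t S"
proof (cases "energy t S = \<infinity>")
  case False
  define A where "A m = stage_set \<gamma> t S m" for m
  define u where "u m = (indicator (A m) :: 'a \<Rightarrow> real)" for m
  have A [measurable]: "A m \<in> sets borel" for m unfolding A_def by (rule stage_set_borel[OF S])
  have u [measurable]: "u m \<in> borel_measurable borel" for m unfolding u_def by measurable
  have u01: "0 \<le> u m x" "u m x \<le> 1" "\<bar>u m x\<bar> \<le> 1" for m x by (auto simp: u_def indicator_def)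
  have iG: "integrable lborel (\<lambda>y. gauss_kernel t (x - y) * f y)" if "f \<in> borel_measurable borel" "\<And>y. \<bar>f y\<bar> \<le> B" for f x B
    using integrable_gauss_kernel_mult[OF t that] .
  define P where "P = gauss_op t (u 0)"
  have P [measurable]: "P \<in> borel_measurable borel" unfolding P_def by measurable
  have P0: "0 \<le> P x" for x unfolding P_def gauss_op_def by (rule integral_nonneg_AE) (simp add: u01)
  have P1: "\<bar>P x\<bar> \<le> 1" for x unfolding P_def by (rule gauss_op_bounded[OF t]) (auto simp: u01)
  define \<alpha> where "\<alpha> x = (1 - u 0 x) * P x" for x
  define \<beta> where "\<beta> x = u 0 x * (1 - P x)" for x
  have \<alpha>0: "0 \<le> \<alpha> x" and \<beta>0: "0 \<le> \<beta> x" for x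
    using P0[of x] P1[of x] u01(1,2)[of 0 x] by (auto simp: \<alpha>_def \<beta>_def)
  have [measurable]: "\<alpha> \<in> borel_measurable borel" "\<beta> \<in> borel_measurable borel" unfolding \<alpha>_def \<beta>_def by measurable
  have en0: "energy t S = (\<integral>\<^sup>+x. ennreal (\<alpha> x) \<partial>lborel)"
    using S by (simp add: energy_lborel \<alpha>_def u_def A_def P_def)
  have i\<alpha>: "integrable lborel \<alpha>"
    using False en0 \<alpha>0 by (intro integrableI_nonneg) (auto simp: less_top[symmetric])
  \<comment> \<open>Besides \<alpha>, whose integral is the energy, \<beta> has to be integrable. As
    double integrals over pairs of points on different sides of the set the two coincide, by
    symmetry of the kernel; their sum is the distance of \<open>P\<close> from the indicator
    \<open>u 0\<close>.\<close>
  have oneP: "1 - P x = (\<integral>y. gauss_kernel t (x - y) * (1 - u 0 y) \<partial>lborel)" for x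
  proof -
    have "(\<integral>y. gauss_kernel t (x - y) * (1 - u 0 y) \<partial>lborel)
       = (\<integral>y. gauss_kernel t (x - y) * 1 \<partial>lborel) - (\<integral>y. gauss_kernel t (x - y) * u 0 y \<partial>lborel)"
      unfolding right_diff_distrib by (rule Bochner_Integration.integral_diff) (intro iG[of _ 1]; simp add: u01)+
    also have "(\<integral>y. gauss_kernel t (x - y) * 1 \<partial>lborel) = 1"
      using integral_gauss_kernel_shift[OF t, of x] by (simp add: gauss_kernel_commute[of t x])
    finally show ?thesis by (simp add: P_def gauss_op_def)
  qed
  have "(\<integral>\<^sup>+x. ennreal (\<beta> x) \<partial>lborel)
      = (\<integral>\<^sup>+x. (\<integral>\<^sup>+y. ennreal (u 0 x * (gauss_kernel t (x - y) * (1 - u 0 y))) \<partial>lborel) \<partial>lborel)"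
  proof (rule nn_integral_cong)
    fix x
    have i: "integrable lborel (\<lambda>y. gauss_kernel t (x - y) * (1 - u 0 y))"
      by (rule iG[of _ 1]) (use u01[of 0] in auto)
    show "ennreal (\<beta> x) = (\<integral>\<^sup>+y. ennreal (u 0 x * (gauss_kernel t (x - y) * (1 - u 0 y))) \<partial>lborel)"
      using i u01(1,2)[of 0] by (subst nn_integral_eq_integral) (simp_all add: \<beta>_def oneP)
  qed
  also have "\<dots> = (\<integral>\<^sup>+y. (\<integral>\<^sup>+x. ennreal (u 0 x * (gauss_kernel t (x - y) * (1 - u 0 y))) \<partial>lborel) \<partial>lborel)"
    by (rule lborel_pair.Fubini') measurable
  also have "\<dots> = (\<integral>\<^sup>+y. ennreal (\<alpha> y) \<partial>lborel)"
  proof (rule nn_integral_cong)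
    fix y
    have i: "integrable lborel (\<lambda>x. gauss_kernel t (y - x) * u 0 x)"
      by (rule iG[of _ 1]) (use u01[of 0] in auto)
    have eq: "u 0 x * (gauss_kernel t (x - y) * (1 - u 0 y)) = (1 - u 0 y) * (gauss_kernel t (y - x) * u 0 x)" for x
      by (simp add: gauss_kernel_commute[of t y])
    show "(\<integral>\<^sup>+x. ennreal (u 0 x * (gauss_kernel t (x - y) * (1 - u 0 y))) \<partial>lborel) = ennreal (\<alpha> y)"
      unfolding eq using i u01(1,2)[of 0]
      by (subst nn_integral_eq_integral) (simp_all add: \<alpha>_def P_def gauss_op_def)
  qed
  finally have i\<beta>: "integrable lborel \<beta>"
    using False en0 \<beta>0 by (intro integrableI_nonneg) (auto simp: less_top[symmetric])
  \<comment> \<open>Indices beyond \<open>M\<close> are padded with 0: the rows of \<gamma> are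
    assumed to sum to 1 only up to \<open>M\<close>, and the integrability of
    \<open>u m - u 0\<close> rests on this.\<close>
  define d where "d m = (if m \<le> M then (\<lambda>x. u m x - u 0 x) else (\<lambda>_. 0))" for m
  have d0: "d 0 = (\<lambda>_. 0)" by (simp add: d_def)
  have dB: "\<bar>d m x\<bar> \<le> 1" for m x using u01(1,2)[of m x] u01(1,2)[of 0 x] by (auto simp: d_def)
  have dm [measurable]: "d m \<in> borel_measurable borel" for m unfolding d_def by (cases "m \<le> M") auto
  define w where "w m x = P x + (\<Sum>i<Suc m. \<gamma> (Suc m) i * gauss_op t (d i) x)" for m x
  have w [measurable]: "w m \<in> borel_measurable borel" for m unfolding w_def by measurable
  have ASuc: "A (Suc m) = {x. w m x \<ge> 1/2}" if "m < M" for m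
  proof -
    have "gauss_op t (\<lambda>y. \<Sum>i<Suc m. \<gamma> (Suc m) i * u i y) x = w m x" for x
    proof -
      have gi: "gauss_op t (d i) x = gauss_op t (u i) x - P x" if "i < Suc m" for i
      proof -
        have "i \<le> M" using that \<open>m < M\<close> by simp
        then show ?thesis
          unfolding d_def P_def gauss_op_def by (simp add: right_diff_distrib iG[OF u u01(3)])
      qed
      have "gauss_op t (\<lambda>y. \<Sum>i<Suc m. \<gamma> (Suc m) i * u i y) x
          = (\<integral>y. (\<Sum>i<Suc m. \<gamma> (Suc m) i * (gauss_kernel t (x - y) * u i y)) \<partial>lborel)"
        unfolding gauss_op_def by (simp add: sum_distrib_left mult.left_commute del: sum.lessThan_Suc)
      also have "\<dots> = (\<Sum>i<Suc m. \<gamma> (Suc m) i * gauss_op t (u i) x)"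
        unfolding gauss_op_def
        by (subst Bochner_Integration.integral_sum) (auto simp: iG[OF u u01(3)] simp del: sum.lessThan_Suc)
      also have "\<dots> = (\<Sum>i<Suc m. \<gamma> (Suc m) i * (P x + gauss_op t (d i) x))"
        by (rule sum.cong) (auto simp: gi)
      also have "\<dots> = w m x"
        using sum1[OF that] unfolding w_def distrib_left sum.distrib sum_distrib_right[symmetric] by simp
      finally show ?thesis .
    qed
    then show ?thesis
      unfolding A_def stage_set_pos[OF zero_less_Suc] unfolding A_def[symmetric] u_def[symmetric]
      by (subst conv_gauss_op) (auto simp del: sum.lessThan_Suc)
  qed
  have bd: "bdd_int (d m)" for m
  proof (induction m rule: less_induct)
    case (less m)
    show ?case
    proof (cases "m = 0 \<or> m > M")
      case True
      then show ?thesis by (auto simp: d_def)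
    next
      case False
      then obtain n where n: "m = Suc n" "n < M" by (cases m) auto
      define g where "g x = 2 * (\<alpha> x + \<beta> x + (\<Sum>i<m. \<bar>\<gamma> m i\<bar> * \<bar>gauss_op t (d i) x\<bar>))" for x
      have "integrable lborel (\<lambda>x. \<Sum>i<m. \<bar>\<gamma> m i\<bar> * \<bar>gauss_op t (d i) x\<bar>)"
        using less bdd_int_gauss_op[OF t] unfolding bdd_int_def
        by (intro Bochner_Integration.integrable_sum integrable_mult_right integrable_abs) auto
      then have "integrable lborel g" using i\<alpha> i\<beta> unfolding g_def by auto
      then have "integrable lborel (d m)"
      proof (rule Bochner_Integration.integrable_bound)
        show "AE x in lborel. norm (d m x) \<le> norm (g x)"
        proof (rule AE_I2)
          fix x
          define r where "r = (\<Sum>i<m. \<gamma> m i * gauss_op t (d i) x)"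
          have r: "\<bar>r\<bar> \<le> (\<Sum>i<m. \<bar>\<gamma> m i\<bar> * \<bar>gauss_op t (d i) x\<bar>)"
            unfolding r_def abs_mult[symmetric] by (rule sum_abs)
          \<comment> \<open>Where stage \<open>m\<close> and the initial set differ,
            \<open>P + r\<close> and \<open>u 0\<close> lie on opposite sides of 1/2, hence
            \<open>\<alpha> + \<beta> + |r| >= 1/2\<close>: a Chebyshev bound for the difference of
            the indicators.\<close>
          have mem: "x \<in> A m \<longleftrightarrow> P x + r \<ge> 1/2" unfolding n(1) ASuc[OF n(2)] w_def r_def by simp
          have "\<bar>d m x\<bar> \<le> 2 * (\<alpha> x + \<beta> x + \<bar>r\<bar>)"
            using mem n(2) \<alpha>0[of x] \<beta>0[of x] unfolding d_def \<alpha>_def \<beta>_def u_def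
            by (cases "x \<in> A 0"; cases "x \<in> A m") (auto simp: n(1))
          with r \<alpha>0[of x] \<beta>0[of x] show "norm (d m x) \<le> norm (g x)" unfolding g_def by simp
        qed
      qed measurable
      then show ?thesis using dB unfolding bdd_int_def by blast
    qed
  qed
  have bds: "bdd_int (\<lambda>x. d (Suc m) x - d m x)" for m by (intro bdd_int_diff bd)
  define L where "L e = (\<integral>x. e x \<partial>lborel) - 2 * (\<integral>x. e x * P x \<partial>lborel)" for e
  have iP: "integrable lborel (\<lambda>x. e x * P x)" if "bdd_int e" for e
    using bdd_int_integrable_mult[OF that P P1] .
  have Ldiff: "L (\<lambda>x. a x - b x) = L a - L b" if "bdd_int a" "bdd_int b" for a b
    using that iP[OF that(1)] iP[OF that(2)] unfolding L_def left_diff_distrib bdd_int_def by simp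
  have step: "L (\<lambda>x. d (Suc m) x - d m x)
      - 2 * (\<Sum>i<Suc m. \<gamma> (Suc m) i * gauss_form t (\<lambda>x. d (Suc m) x - d m x) (d i)) \<le> 0" if "m < M" for m
  proof -
    let ?e = "\<lambda>x. d (Suc m) x - d m x"
    have ie: "integrable lborel ?e" using bds[of m] unfolding bdd_int_def by blast
    have isum: "integrable lborel (\<lambda>x. \<Sum>i<Suc m. \<gamma> (Suc m) i * (?e x * gauss_op t (d i) x))"
      by (intro Bochner_Integration.integrable_sum integrable_mult_right gauss_form_integrable[OF t] bds bd)
    have eq: "(1 - 2 * w m x) * ?e x = (?e x - 2 * (?e x * P x)) - 2 * (\<Sum>i<Suc m. \<gamma> (Suc m) i * (?e x * gauss_op t (d i) x))" for x
      unfolding w_def by (simp add: sum_distrib_left algebra_simps del: sum.lessThan_Suc)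
    have "(\<integral>x. (1 - 2 * w m x) * ?e x \<partial>lborel) = L ?e - 2 * (\<integral>x. (\<Sum>i<Suc m. \<gamma> (Suc m) i * (?e x * gauss_op t (d i) x)) \<partial>lborel)"
      unfolding eq L_def using ie iP[OF bds[of m]] isum by (simp del: sum.lessThan_Suc)
    also have "(\<integral>x. (\<Sum>i<Suc m. \<gamma> (Suc m) i * (?e x * gauss_op t (d i) x)) \<partial>lborel)
       = (\<Sum>i<Suc m. \<gamma> (Suc m) i * gauss_form t ?e (d i))"
      unfolding gauss_form_def
      by (subst Bochner_Integration.integral_sum) (auto simp del: sum.lessThan_Suc intro!: gauss_form_integrable[OF t] bds bd)
    finally have I: "(\<integral>x. (1 - 2 * w m x) * ?e x \<partial>lborel) = L ?e - 2 * (\<Sum>i<Suc m. \<gamma> (Suc m) i * gauss_form t ?e (d i))" .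
    \<comment> \<open>The increment is 1 only where \<open>w m >= 1/2\<close> and -1 only where
      \<open>w m < 1/2\<close>; this is the minimising property of thresholding.\<close>
    have "(1 - 2 * w m x) * ?e x \<le> 0" for x
      using that ASuc[OF that] unfolding d_def u_def
      by (cases "x \<in> A m"; cases "x \<in> A (Suc m)") (auto simp: mult_le_0_iff)
    then have "(\<integral>x. - ((1 - 2 * w m x) * ?e x) \<partial>lborel) \<ge> 0"
      by (intro integral_nonneg_AE AE_I2) (smt (verit))
    with I show ?thesis by simp
  qed
  have "(\<Sum>m<M. L (\<lambda>x. d (Suc m) x - d m x)) = (\<Sum>m<M. L (d (Suc m)) - L (d m))"
    by (simp add: Ldiff bd)
  also have "\<dots> = L (d M)" using sum_lessThan_telescope[of "\<lambda>m. L (d m)" M] by (simp add: d0 L_def[of "\<lambda>_. 0"])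
  finally have tel: "(\<Sum>m<M. L (\<lambda>x. d (Suc m) x - d m x)) = L (d M)" .
  have "(\<Sum>m<M. L (\<lambda>x. d (Suc m) x - d m x)
      - 2 * (\<Sum>i<Suc m. \<gamma> (Suc m) i * gauss_form t (\<lambda>x. d (Suc m) x - d m x) (d i))) \<le> 0"
    by (rule sum_nonpos) (use step in \<open>auto simp del: sum.lessThan_Suc\<close>)
  then have "L (d M) - 2 * (\<Sum>m<M. \<Sum>i<Suc m. \<gamma> (Suc m) i * gauss_form t (\<lambda>x. d (Suc m) x - d m x) (d i)) \<le> 0"
    by (simp only: sum_subtractf sum_distrib_left[symmetric] tel)
  with Q[of d, OF bd d0] have main: "L (d M) - gauss_form t (d M) (d M) \<le> 0" by simp
  define e where "e = d M"
  have be: "bdd_int e" unfolding e_def by (rule bd)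
  have ie: "integrable lborel e" using be by (simp add: bdd_int_def)
  have ige: "integrable lborel (gauss_op t e)" by (rule gauss_op_integrable[OF t ie])
  have uM: "u M x = u 0 x + e x" for x by (simp add: e_def d_def)
  have gM: "gauss_op t (u M) x = P x + gauss_op t e x" for x
    unfolding uM[abs_def] P_def gauss_op_def distrib_left
    by (rule Bochner_Integration.integral_add[OF iG[OF u u01(3)] gauss_op_integrable_at[OF t ie]])
  have iu: "integrable lborel (\<lambda>x. u 0 x * gauss_op t e x)"
    using bdd_int_integrable_mult[OF bdd_int_gauss_op[OF t be] u u01(3)] by (simp add: mult.commute)
  \<comment> \<open>Expansion around the initial set: every term contains \<alpha> or
    \<open>e\<close> and is therefore integrable, although \<open>u 0\<close> need not be.\<close>
  have eqM: "(1 - u M x) * gauss_op t (u M) x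
     = \<alpha> x - e x * P x + gauss_op t e x - u 0 x * gauss_op t e x - e x * gauss_op t e x" for x
    unfolding gM by (simp add: uM \<alpha>_def algebra_simps)
  have iall: "integrable lborel (\<lambda>x. (1 - u M x) * gauss_op t (u M) x)"
    unfolding eqM by (intro Bochner_Integration.integrable_add Bochner_Integration.integrable_diff i\<alpha> iP be ige iu gauss_form_integrable t)
  have "(\<integral>x. (1 - u M x) * gauss_op t (u M) x \<partial>lborel)
     = (\<integral>x. \<alpha> x \<partial>lborel) - (\<integral>x. e x * P x \<partial>lborel) + (\<integral>x. gauss_op t e x \<partial>lborel)
       - (\<integral>x. u 0 x * gauss_op t e x \<partial>lborel) - gauss_form t e e"
    unfolding eqM gauss_form_def
    using i\<alpha> iP[OF be] ige iu gauss_form_integrable[OF t be be] by simp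
  also have "(\<integral>x. gauss_op t e x \<partial>lborel) = (\<integral>x. e x \<partial>lborel)" by (rule integral_gauss_op[OF t ie])
  also have "(\<integral>x. u 0 x * gauss_op t e x \<partial>lborel) = (\<integral>x. e x * P x \<partial>lborel)"
    unfolding P_def by (rule gauss_op_symmetric[OF t ie u u01(3), symmetric])
  finally have "(\<integral>x. (1 - u M x) * gauss_op t (u M) x \<partial>lborel) = (\<integral>x. \<alpha> x \<partial>lborel) + (L e - gauss_form t e e)"
    by (simp add: L_def)
  with main have le: "(\<integral>x. (1 - u M x) * gauss_op t (u M) x \<partial>lborel) \<le> (\<integral>x. \<alpha> x \<partial>lborel)"
    by (simp add: e_def)
  have gn: "0 \<le> gauss_op t (u M) x" for x
    unfolding gauss_op_def by (rule integral_nonneg_AE) (simp add: u01)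
  have "energy t (A M) = (\<integral>\<^sup>+x. ennreal ((1 - u M x) * gauss_op t (u M) x) \<partial>lborel)"
    unfolding u_def by (rule energy_lborel) simp
  also have "\<dots> = ennreal (\<integral>x. (1 - u M x) * gauss_op t (u M) x \<partial>lborel)"
    by (rule nn_integral_eq_integral[OF iall]) (simp add: gn u01)
  also have "\<dots> \<le> ennreal (\<integral>x. \<alpha> x \<partial>lborel)" using le by (rule ennreal_leI)
  also have "\<dots> = energy t S"
    unfolding en0 by (rule nn_integral_eq_integral[OF i\<alpha>, symmetric]) (simp add: \<alpha>0)
  finally show ?thesis by (simp add: A_def)
qed simp

section \<open>Passage from Lebesgue to Borel initial sets\<close>

lemma lebesgue_sets_AE_borel:
  fixes S :: "'a::euclidean_space set"
  assumes "S \<in> sets lebesgue"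
  obtains T where "T \<in> sets borel" "AE x in lborel. x \<in> S \<longleftrightarrow> x \<in> T"
proof -
  have "(indicator S :: 'a \<Rightarrow> real) \<in> borel_measurable (completion lborel)"
    using assms by measurable
  then obtain g :: "'a \<Rightarrow> real" where g: "g \<in> borel_measurable lborel" "AE x in lborel. indicator S x = g x"
    using completion_ex_borel_measurable_real[of "indicator S :: 'a \<Rightarrow> real" lborel] by auto
  show ?thesis
  proof (rule that[of "{x. g x = 1}"])
    show "{x. g x = 1} \<in> sets borel" using g(1) by measurable
    show "AE x in lborel. x \<in> S \<longleftrightarrow> x \<in> {x. g x = 1}"
      using g(2) by eventually_elim (auto simp: indicator_def split: if_splits)
  qed
qed

lemma conv_cong_AE:
  fixes f g :: "'a::euclidean_space \<Rightarrow> real"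
  assumes "f \<in> borel_measurable lebesgue" "g \<in> borel_measurable borel" "AE x in lborel. f x = g x"
  shows "conv (gauss_kernel t) f = conv (gauss_kernel t) g"
proof
  fix x :: 'a
  have [measurable]: "f \<in> borel_measurable lebesgue" "g \<in> borel_measurable lebesgue"
    using assms by (auto intro: measurable_completion)
  have [measurable]: "(\<lambda>y. gauss_kernel t (x - y)) \<in> borel_measurable lebesgue"
    by (rule measurable_completion) simp
  show "conv (gauss_kernel t) f x = conv (gauss_kernel t) g x"
    unfolding conv_def using AE_completion[OF assms(3)]
    by (intro integral_cong_AE) (measurable, auto)
qed

text \<open>Convolution does not see null sets, so from the first stage on the two runs coincide
  exactly, not only almost everywhere.\<close>

lemma stage_set_cong_AE:
  fixes S :: "'a::euclidean_space set"
  assumes S: "S \<in> sets lebesgue" and T: "T \<in> sets borel" and ae: "AE x in lborel. x \<in> S \<longleftrightarrow> x \<in> T"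
  shows "m > 0 \<Longrightarrow> stage_set \<gamma> t S m = stage_set \<gamma> t T m"
proof (induction m rule: less_induct)
  case (less m)
  have eq: "stage_set \<gamma> t S i = stage_set \<gamma> t T i" if "i < m" "i > 0" for i
    using less.IH[OF that] .
  have ms: "stage_set \<gamma> t S i \<in> sets lebesgue" "stage_set \<gamma> t T i \<in> sets borel" if "i < m" for i
  proof -
    show 1: "stage_set \<gamma> t T i \<in> sets borel" by (rule stage_set_borel[OF T])
    show "stage_set \<gamma> t S i \<in> sets lebesgue"
      using eq[OF that] 1 S by (cases "i = 0") auto
  qed
  have "conv (gauss_kernel t) (\<lambda>y. \<Sum>i<m. \<gamma> m i * indicator (stage_set \<gamma> t S i) y)
      = conv (gauss_kernel t) (\<lambda>y. \<Sum>i<m. \<gamma> m i * indicator (stage_set \<gamma> t T i) y)"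
  proof (rule conv_cong_AE)
    show "(\<lambda>y. \<Sum>i<m. \<gamma> m i * indicator (stage_set \<gamma> t S i) y) \<in> borel_measurable lebesgue"
      using ms by (intro borel_measurable_sum borel_measurable_times) auto
    show "(\<lambda>y. \<Sum>i<m. \<gamma> m i * indicator (stage_set \<gamma> t T i) y) \<in> borel_measurable borel"
      using ms by (intro borel_measurable_sum borel_measurable_times) auto
    show "AE x in lborel. (\<Sum>i<m. \<gamma> m i * indicator (stage_set \<gamma> t S i) x) = (\<Sum>i<m. \<gamma> m i * indicator (stage_set \<gamma> t T i) x)"
      using ae
    proof eventually_elim
      case (elim x)
      have "x \<in> stage_set \<gamma> t S i \<longleftrightarrow> x \<in> stage_set \<gamma> t T i" if "i < m" for i
        using elim eq[OF that] by (cases "i = 0") auto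
      then show ?case by (intro sum.cong refl) (auto simp: indicator_def)
    qed
  qed
  then show ?case by (simp add: stage_set_pos[OF less.prems])
qed

lemma energy_cong_AE:
  fixes S :: "'a::euclidean_space set"
  assumes S: "S \<in> sets lebesgue" and T: "T \<in> sets borel" and ae: "AE x in lborel. x \<in> S \<longleftrightarrow> x \<in> T"
  shows "energy t S = energy t T"
proof -
  have "AE x in lborel. indicator S x = (indicator T x :: real)"
    using ae by eventually_elim (auto simp: indicator_def)
  then have c: "conv (gauss_kernel t) (indicator S) = conv (gauss_kernel t) (indicator T)"
    using S T by (intro conv_cong_AE) auto
  show ?thesis
    unfolding energy_def c using AE_completion[OF ae]
    by (intro nn_integral_cong_AE) (auto simp: indicator_def)
qed

section \<open>The Gaussian distribution function\<close>

text \<open>The distribution function of the normal law of variance 2, minus 1/2. Centring makes it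
  odd, and since the coefficients of a stage add up to 1 the constant 1/2 cancels against the
  threshold.\<close>

definition gphi :: "real \<Rightarrow> real" where
  "gphi z = measure gm {..z} - 1 / 2"

lemma gauss_kernel_1_real: "gauss_kernel 1 (w::real) = exp (- w\<^sup>2 / 4) / sqrt (4 * pi)"
  by (simp add: gauss_kernel_def powr_half_sqrt)

lemma sqrt_4pi_bounds: "1 \<le> sqrt (4 * pi)" "sqrt (4 * pi) \<le> 4"
proof -
  show "1 \<le> sqrt (4 * pi)" using pi_gt3 by (intro real_le_rsqrt) simp
  show "sqrt (4 * pi) \<le> 4" using pi_less_4 by (intro real_le_lsqrt) simp_all
qed

lemma gauss_kernel_1_real_le: "gauss_kernel 1 (w::real) \<le> 1"
proof -
  have "exp (- w\<^sup>2 / 4) \<le> sqrt (4 * pi)"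
    by (rule order_trans[OF _ sqrt_4pi_bounds(1)]) simp
  then show ?thesis unfolding gauss_kernel_1_real by (subst divide_le_eq) simp
qed

lemma gauss_kernel_1_real_ge: 
  assumes "\<bar>w::real\<bar> \<le> 1"
  shows "1 / 8 \<le> gauss_kernel 1 w"
proof -
  have "w\<^sup>2 \<le> 1" using assms by (simp add: abs_square_le_1)
  then have "3 / 4 \<le> exp (- w\<^sup>2 / 4)" using exp_ge_add_one_self[of "- w\<^sup>2 / 4"] by simp
  then have "sqrt (4 * pi) / 8 \<le> exp (- w\<^sup>2 / 4)" using sqrt_4pi_bounds(2) by simp
  then show ?thesis unfolding gauss_kernel_1_real by (subst le_divide_eq) simp
qed

lemma measure_gm_eq_integral:
  assumes [measurable]: "A \<in> sets borel"
  shows "measure gm A = (\<integral>w. gauss_kernel 1 w * indicator A w \<partial>lborel)"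
proof -
  have "measure gm A = (\<integral>w. indicator A w \<partial>gm)" by simp
  also have "\<dots> = (\<integral>w. gauss_kernel 1 w * indicator A w \<partial>lborel)" by (rule integral_gm) measurable
  finally show ?thesis .
qed

lemma integrable_gauss_kernel_indicator:
  "A \<in> sets borel \<Longrightarrow> integrable lborel (\<lambda>w. gauss_kernel 1 w * indicator A w :: real)"
  using integrable_mult_indicator[OF _ gauss_kernel_integrable[of 1], of A] by (simp add: mult.commute)

lemma gphi_diff: "a \<le> b \<Longrightarrow> gphi b - gphi a = measure gm {a<..b}"
proof -
  assume "a \<le> b"
  then have "{..b} = {..a} \<union> {a<..b}" by auto
  moreover have "measure gm ({..a} \<union> {a<..b}) = measure gm {..a} + measure gm {a<..b}"
    by (intro gm.finite_measure_Union) auto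
  ultimately show ?thesis by (simp add: gphi_def)
qed

lemma measure_gm_interval_le:
  assumes "a \<le> b"
  shows "measure gm {a..b::real} \<le> b - a"
proof -
  have "measure gm {a..b} \<le> (\<integral>w. indicator {a..b} w \<partial>lborel)"
    unfolding measure_gm_eq_integral[OF atLeastAtMost_borel]
  proof (rule integral_mono)
    show "integrable lborel (indicator {a..b} :: real \<Rightarrow> real)" by (rule integrable_real_indicator) (simp_all add: emeasure_lborel_Icc_eq)
  qed (auto intro!: integrable_gauss_kernel_indicator gauss_kernel_1_real_le split: split_indicator)
  then show ?thesis using assms by simp
qed

lemma gphi_mono: "a \<le> b \<Longrightarrow> gphi a \<le> gphi b"
  using gphi_diff[of a b] measure_nonneg[of gm "{a<..b}"] by linarith

lemma gphi_Lipschitz: "\<bar>gphi a - gphi b\<bar> \<le> \<bar>a - b\<bar>"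
proof -
  have *: "\<bar>gphi b - gphi a\<bar> \<le> b - a" if "a \<le> b" for a b
  proof -
    have "measure gm {a<..b} \<le> measure gm {a..b}" by (intro gm.finite_measure_mono) auto
    also have "\<dots> \<le> b - a" by (rule measure_gm_interval_le[OF that])
    finally show ?thesis using gphi_diff[OF that] gphi_mono[OF that] by simp
  qed
  show ?thesis using *[of a b] *[of b a] by (cases "a \<le> b") (auto simp: abs_minus_commute)
qed

lemma gphi_measurable [measurable]: "gphi \<in> borel_measurable borel"
  by (rule borel_measurable_mono) (simp add: mono_def gphi_mono)

lemma measure_gm_singleton [simp]: "measure gm {z::real} = 0"
  using measure_gm_interval_le[of z z] measure_nonneg[of gm "{z}"] by (simp add: order_antisym)

lemma gphi_minus: "gphi (- z) = - gphi z"
proof -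
  have "measure gm {..- z} = (\<integral>w. indicator {..- z} (- w) \<partial>gm)"
    by (subst integral_gm_reflect) auto
  also have "\<dots> = (\<integral>w. indicator {z..} w \<partial>gm)"
    by (intro Bochner_Integration.integral_cong) (auto simp: indicator_def)
  also have "\<dots> = measure gm {z..}" by simp
  also have "\<dots> = measure gm ({z} \<union> (UNIV - {..z}))" by (intro arg_cong[where f="measure gm"]) auto
  also have "\<dots> = measure gm {z} + measure gm (UNIV - {..z})"
    by (intro gm.finite_measure_Union) auto
  also have "measure gm (UNIV - {..z}) = 1 - measure gm {..z}"
    using gm.prob_compl[of "{..z}"] by simp
  finally show ?thesis by (simp add: gphi_def)
qed

lemma gphi_0 [simp]: "gphi 0 = 0"
  using gphi_minus[of 0] by simp

lemma gphi_eq: "0 \<le> z \<Longrightarrow> gphi z = measure gm {0..z}"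
proof -
  assume z: "0 \<le> z"
  have "measure gm ({0} \<union> {0<..z}) = measure gm {0::real} + measure gm {0<..z}"
    by (intro gm.finite_measure_Union) auto
  moreover have "{0} \<union> {0<..z} = {0..z}" using z by auto
  ultimately show ?thesis using gphi_diff[OF z] by simp
qed

text \<open>The density is at least 1/8 on \<open>[-1, 1]\<close>, and beyond 1 monotonicity only
  preserves what has been gained there. This serves heights far from the graph, where the Taylor
  expansion gives nothing.\<close>

lemma gphi_lower:
  assumes "0 \<le> z"
  shows "min z 1 / 8 \<le> gphi z"
proof -
  let ?m = "min z 1"
  have m: "0 \<le> ?m" using assms by simp
  have "(\<integral>w. (1/8) * indicator {0..?m} w \<partial>lborel) \<le> measure gm {0..?m}"
    unfolding measure_gm_eq_integral[OF atLeastAtMost_borel]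
  proof (rule integral_mono)
    show "integrable lborel (\<lambda>w. (1/8) * indicator {0..?m} w :: real)"
      by (intro integrable_mult_right integrable_real_indicator) (simp_all add: emeasure_lborel_Icc_eq)
    show "(1/8) * indicator {0..?m} w \<le> gauss_kernel 1 w * indicator {0..?m} w" for w :: real
      using gauss_kernel_1_real_ge[of w] by (auto split: split_indicator)
  qed (simp add: integrable_gauss_kernel_indicator)
  then have "?m / 8 \<le> gphi ?m" using gphi_eq[OF m] m by simp
  also have "\<dots> \<le> gphi z" by (rule gphi_mono) simp
  finally show ?thesis .
qed

text \<open>The upper bound comes from a product:
  \<open>(1 - x + x^2/2) (1 + x + x^2/2) = 1 + x^4/4 >= 1\<close>, so the quadratic lower bound for
  \<open>exp x\<close> can be inverted.\<close>

lemma exp_minus_bounds: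
  assumes "0 \<le> (x::real)"
  shows "1 - x \<le> exp (- x)" "exp (- x) \<le> 1 - x + x\<^sup>2 / 2"
proof -
  show "1 - x \<le> exp (- x)" using exp_ge_add_one_self[of "- x"] by simp
  have e: "1 + x + x\<^sup>2 / 2 \<le> exp x" by (rule exp_lower_Taylor_quadratic[OF assms])
  have p: "0 < 1 - x + x\<^sup>2 / 2"
  proof -
    have "1 - x + x\<^sup>2 / 2 = ((1 - x)\<^sup>2 + 1) / 2" by (simp add: power2_eq_square field_simps)
    also have "\<dots> > 0" by (intro divide_pos_pos add_nonneg_pos) auto
    finally show ?thesis .
  qed
  have "1 \<le> 1 + x ^ 4 / 4" by simp
  also have "\<dots> = (1 - x + x\<^sup>2 / 2) * (1 + x + x\<^sup>2 / 2)"
    by (simp add: power2_eq_square power4_eq_xxxx field_simps)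
  also have "\<dots> \<le> (1 - x + x\<^sup>2 / 2) * exp x" using e p by (intro mult_left_mono) auto
  finally have "1 \<le> (1 - x + x\<^sup>2 / 2) * exp x" .
  then show "exp (- x) \<le> 1 - x + x\<^sup>2 / 2" by (simp add: exp_minus divide_simps)
qed

text \<open>Integrating the bounds for \<open>exp (- w^2/4)\<close> over \<open>[0, z]\<close>
  leaves a remainder of at most \<open>z^5/160\<close>, and oddness covers negative
  \<open>z\<close>. No smallness of \<open>z\<close> is required, so unbounded profiles may be
  inserted.\<close>

lemma gphi_Taylor: "\<bar>sqrt (4 * pi) * gphi z - (z - z ^ 3 / 12)\<bar> \<le> \<bar>z\<bar> ^ 5"
proof -
  have pos: "\<bar>sqrt (4 * pi) * gphi z - (z - z ^ 3 / 12)\<bar> \<le> z ^ 5" if z: "0 \<le> z" for z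
  proof -
    let ?I = "\<integral>w. exp (- w\<^sup>2 / 4) * indicator {0..z} w \<partial>lborel"
    have s: "sqrt (4 * pi) \<noteq> 0" by simp
    have eq: "sqrt (4 * pi) * gphi z = ?I"
      unfolding gphi_eq[OF z] measure_gm_eq_integral[OF atLeastAtMost_borel] gauss_kernel_1_real
        integral_mult_right_zero[symmetric] by simp
    have iE: "integrable lborel (\<lambda>w. exp (- w\<^sup>2 / 4) * indicator {0..z} w)"
      using integrable_mult_right[OF integrable_gauss_kernel_indicator[of "{0..z}"], of "sqrt (4 * pi)"]
      by (simp add: gauss_kernel_1_real)
    have A: "has_bochner_integral lborel (\<lambda>w. (1 - w\<^sup>2 / 4) * indicator {0..z} w) ((z - z ^ 3 / 12) - (0 - 0 ^ 3 / 12))"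
      by (rule has_bochner_integral_FTC_Icc_real[OF z]) (auto intro!: derivative_eq_intros)
    have B: "has_bochner_integral lborel (\<lambda>w. (1 - w\<^sup>2 / 4 + w ^ 4 / 32) * indicator {0..z} w)
        ((z - z ^ 3 / 12 + z ^ 5 / 160) - (0 - 0 ^ 3 / 12 + 0 ^ 5 / 160))"
      by (rule has_bochner_integral_FTC_Icc_real[OF z]) (auto intro!: derivative_eq_intros)
    have "(\<integral>w. (1 - w\<^sup>2 / 4) * indicator {0..z} w \<partial>lborel) \<le> ?I"
      using exp_minus_bounds(1)[of "w\<^sup>2 / 4" for w]
      by (intro integral_mono iE integrable.intros[OF A]) (auto simp: indicator_def)
    moreover have "?I \<le> (\<integral>w. (1 - w\<^sup>2 / 4 + w ^ 4 / 32) * indicator {0..z} w \<partial>lborel)"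
      using exp_minus_bounds(2)[of "w\<^sup>2 / 4" for w]
      by (intro integral_mono iE integrable.intros[OF B]) (auto simp: indicator_def power_divide)
    ultimately have "z - z ^ 3 / 12 \<le> ?I" "?I \<le> z - z ^ 3 / 12 + z ^ 5 / 160"
      using A B by (simp_all add: has_bochner_integral_integral_eq)
    moreover have "0 \<le> z ^ 5" using z by simp
    ultimately show ?thesis unfolding eq by linarith
  qed
  show ?thesis
  proof (cases "0 \<le> z")
    case True
    then show ?thesis using pos[OF True] by simp
  next
    case False
    then have "0 \<le> - z" by simp
    from pos[OF this] show ?thesis using False by (simp add: gphi_minus abs_minus_commute)
  qed
qed

section \<open>Expansion of one stage\<close>

text \<open>
  In the scaled variables \<open>x = e \<xi>\<close>, \<open>x\<^sub>d = e v\<close> with \<open>e = \<surd>\<tau>\<close> the kernel is \<open>G\<^sub>1\<close>.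
  \<open>BO k f\<close>: \<open>f\<close> is \<open>O(e\<^sup>k)\<close> with polynomial growth in \<open>\<xi>\<close>. The bound is required for all
  large constants and exponents so that several such bounds can share them.
\<close>

definition BO :: "nat \<Rightarrow> (real \<Rightarrow> 'a::euclidean_space \<Rightarrow> real) \<Rightarrow> bool" where
  "BO k f \<longleftrightarrow> (\<exists>K0 N0. \<forall>K\<ge>K0. \<forall>N\<ge>N0. \<forall>e x. 0 < e \<longrightarrow> e < 1 \<longrightarrow> \<bar>f e x\<bar> \<le> K * e ^ k * (1 + norm x) ^ N)"

lemma BOI:
  assumes "\<And>e x. 0 < e \<Longrightarrow> e < 1 \<Longrightarrow> \<bar>f e x\<bar> \<le> K * e ^ k * (1 + norm x) ^ N"
  shows "BO k f"
proof -
  have "\<bar>f e x\<bar> \<le> K' * e ^ k * (1 + norm x) ^ N'" if "K' \<ge> \<bar>K\<bar>" "N' \<ge> N" "0 < e" "e < 1" for K' N' e x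
  proof -
    have "\<bar>f e x\<bar> \<le> K * e ^ k * (1 + norm x) ^ N" by (rule assms) fact+
    also have "\<dots> \<le> K' * e ^ k * (1 + norm x) ^ N"
      using that by (intro mult_right_mono) auto
    also have "\<dots> \<le> K' * e ^ k * (1 + norm x) ^ N'"
      using that by (intro mult_left_mono power_increasing) auto
    finally show ?thesis .
  qed
  then show ?thesis unfolding BO_def by blast
qed

lemma BOE:
  assumes "BO k f"
  obtains K N where "K \<ge> 0" "\<And>e x. 0 < e \<Longrightarrow> e < 1 \<Longrightarrow> \<bar>f e x\<bar> \<le> K * e ^ k * (1 + norm x) ^ N"
proof -
  obtain K0 N0 where *: "\<And>K N e x. K \<ge> K0 \<Longrightarrow> N \<ge> N0 \<Longrightarrow> 0 < e \<Longrightarrow> e < 1 \<Longrightarrow> \<bar>f e x\<bar> \<le> K * e ^ k * (1 + norm x) ^ N"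
    using assms unfolding BO_def by blast
  show ?thesis by (rule that[of "max 0 K0" N0]) (auto intro: *)
qed

lemma BOE':
  assumes "BO k f"
  obtains K0 N0 where "\<And>K N e x. K \<ge> K0 \<Longrightarrow> N \<ge> N0 \<Longrightarrow> 0 < e \<Longrightarrow> e < 1 \<Longrightarrow> \<bar>f e x\<bar> \<le> K * e ^ k * (1 + norm x) ^ N"
  using assms unfolding BO_def by blast

lemma BO_le:
  assumes "BO k g" "\<And>e x. 0 < e \<Longrightarrow> e < 1 \<Longrightarrow> \<bar>f e x\<bar> \<le> g e x"
  shows "BO k f"
proof -
  obtain K N where 1: "\<And>e x. 0 < e \<Longrightarrow> e < 1 \<Longrightarrow> \<bar>g e x\<bar> \<le> K * e ^ k * (1 + norm x) ^ N"
    using assms(1) by (rule BOE) (rule that)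
  show ?thesis
    by (rule BOI[of f K k N]) (meson 1 assms(2) abs_ge_self order_trans)
qed

lemma BO_polyb: "polyb f \<Longrightarrow> BO k (\<lambda>e x. e ^ k * f x)"
proof -
  assume "polyb f"
  then obtain C N where *: "\<And>x. \<bar>f x\<bar> \<le> C * (1 + norm x) ^ N" by (rule polybE) (rule that)
  show ?thesis
    by (rule BOI[of _ C k N]) (use * in \<open>simp add: abs_mult mult.assoc mult.left_commute[of C] mult_left_mono\<close>)
qed

lemma BO_add:
  assumes "BO k f" "BO k g"
  shows "BO k (\<lambda>e x. f e x + g e x)"
proof -
  obtain K0 N0 where 1: "\<And>K N e x. K \<ge> K0 \<Longrightarrow> N \<ge> N0 \<Longrightarrow> 0 < e \<Longrightarrow> e < 1 \<Longrightarrow> \<bar>f e x\<bar> \<le> K * e ^ k * (1 + norm x) ^ N"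
    using assms(1) by (rule BOE') (rule that)
  obtain K1 N1 where 2: "\<And>K N e x. K \<ge> K1 \<Longrightarrow> N \<ge> N1 \<Longrightarrow> 0 < e \<Longrightarrow> e < 1 \<Longrightarrow> \<bar>g e x\<bar> \<le> K * e ^ k * (1 + norm x) ^ N"
    using assms(2) by (rule BOE') (rule that)
  show ?thesis
  proof (rule BOI[of _ "max K0 K1 + max K0 K1" k "max N0 N1"])
    fix e and x :: 'a assume "0 < (e::real)" "e < 1"
    then show "\<bar>f e x + g e x\<bar> \<le> (max K0 K1 + max K0 K1) * e ^ k * (1 + norm x) ^ max N0 N1"
      using 1[of "max K0 K1" "max N0 N1" e x] 2[of "max K0 K1" "max N0 N1" e x] by (simp add: distrib_right)
  qed
qed

lemma BO_mult:
  assumes "BO k f" "BO l g"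
  shows "BO (k + l) (\<lambda>e x. f e x * g e x)"
proof -
  obtain K N where 1: "K \<ge> 0" "\<And>e x. 0 < e \<Longrightarrow> e < 1 \<Longrightarrow> \<bar>f e x\<bar> \<le> K * e ^ k * (1 + norm x) ^ N"
    using assms(1) by (rule BOE) (rule that)
  obtain L M where 2: "L \<ge> 0" "\<And>e x. 0 < e \<Longrightarrow> e < 1 \<Longrightarrow> \<bar>g e x\<bar> \<le> L * e ^ l * (1 + norm x) ^ M"
    using assms(2) by (rule BOE) (rule that)
  show ?thesis
  proof (rule BOI[of _ "K * L" _ "N + M"])
    fix e and x :: 'a assume e: "0 < (e::real)" "e < 1"
    have "\<bar>f e x * g e x\<bar> \<le> (K * e ^ k * (1 + norm x) ^ N) * (L * e ^ l * (1 + norm x) ^ M)"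
      unfolding abs_mult using 1 2 e by (intro mult_mono) auto
    then show "\<bar>f e x * g e x\<bar> \<le> K * L * e ^ (k + l) * (1 + norm x) ^ (N + M)"
      by (simp add: power_add mult_ac)
  qed
qed

lemma BO_mono:
  assumes "BO l f" "k \<le> l"
  shows "BO k f"
proof -
  obtain K N where 1: "K \<ge> 0" "\<And>e x. 0 < e \<Longrightarrow> e < 1 \<Longrightarrow> \<bar>f e x\<bar> \<le> K * e ^ l * (1 + norm x) ^ N"
    using assms(1) by (rule BOE) (rule that)
  show ?thesis
  proof (rule BOI[of _ K k N])
    fix e and x :: 'a assume e: "0 < (e::real)" "e < 1"
    have "K * e ^ l * (1 + norm x) ^ N \<le> K * e ^ k * (1 + norm x) ^ N"
      using e 1 assms(2) by (intro mult_right_mono mult_left_mono power_decreasing) auto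
    with 1(2)[OF e, of x] show "\<bar>f e x\<bar> \<le> K * e ^ k * (1 + norm x) ^ N" by linarith
  qed
qed

lemma BO_cmult:
  assumes "BO k f"
  shows "BO k (\<lambda>e x. c * f e x)"
  using BO_mult[OF BO_polyb[OF polyb_const[of c], of 0] assms] by simp

lemma BO_zero [simp]: "BO k (\<lambda>e x. 0)"
  by (rule BOI[of _ 0 k 0]) simp

lemma BO_sum: "(\<And>i. i \<in> I \<Longrightarrow> BO k (f i)) \<Longrightarrow> BO k (\<lambda>e x. \<Sum>i\<in>I. f i e x)"
  by (induction I rule: infinite_finite_induct) (auto intro: BO_add)

lemma BO_power: "BO k f \<Longrightarrow> BO (k * n) (\<lambda>e x. f e x ^ n)"
proof (induction n)
  case 0
  show ?case using BO_polyb[OF polyb_const[of 1], of 0] by simp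
next
  case (Suc n)
  then show ?case using BO_mult[OF Suc(2) Suc(1)[OF Suc(2)]] by simp
qed

lemma one_plus_norm_add: "1 + norm (x + y) \<le> (1 + norm x) * (1 + norm y)"
  using norm_triangle_ineq[of x y] by (simp add: algebra_simps) (smt (verit) mult_nonneg_nonneg norm_ge_zero)

lemma polyb_one_norm [simp]: "polyb (\<lambda>x. (1 + norm (c + x)) ^ N)"
proof -
  have "polyb (\<lambda>x. (1 + norm c) ^ N * (1 + norm x) ^ N)" by simp
  then show ?thesis
  proof (rule polyb_bound)
    show "\<bar>(1 + norm (c + x)) ^ N\<bar> \<le> (1 + norm c) ^ N * (1 + norm x) ^ N" for x
      using power_mono[OF one_plus_norm_add[of c x], of N] by (simp add: power_mult_distrib)
  qed measurable
qed

lemma mean_one_norm: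
  "\<exists>B\<ge>0. \<forall>x::'a::euclidean_space. (\<integral>y. (1 + norm (x + y)) ^ N \<partial>gm) \<le> B * (1 + norm x) ^ N"
proof (intro exI conjI allI)
  let ?B = "\<integral>y. (1 + norm (y::'a)) ^ N \<partial>gm"
  show "0 \<le> ?B" by (rule integral_nonneg_AE) simp
  fix x :: 'a
  have "(\<integral>y. (1 + norm (x + y)) ^ N \<partial>gm) \<le> (\<integral>y. (1 + norm x) ^ N * (1 + norm (y::'a)) ^ N \<partial>gm)"
  proof (rule integral_mono)
    show "integrable gm (\<lambda>y. (1 + norm (x + y)) ^ N)" by (rule polyb_integrable) simp
    show "integrable gm (\<lambda>y::'a. (1 + norm x) ^ N * (1 + norm y) ^ N)" by (rule polyb_integrable) simp
    show "(1 + norm (x + y)) ^ N \<le> (1 + norm x) ^ N * (1 + norm y) ^ N" for y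
      using power_mono[OF one_plus_norm_add[of x y], of N] by (simp add: power_mult_distrib)
  qed
  then show "(\<integral>y. (1 + norm (x + y)) ^ N \<partial>gm) \<le> ?B * (1 + norm x) ^ N" by (simp add: mult.commute)
qed

text \<open>\<open>1 + |x + y| <= (1 + |x|) (1 + |y|)\<close> and the Gaussian moments are finite:
  order and exponent survive averaging, only the constant grows.\<close>

lemma BO_mean:
  assumes "BO k f"
  shows "BO k (\<lambda>e x. \<integral>y. \<bar>f e (x + y)\<bar> \<partial>gm)"
proof -
  obtain K N where 1: "K \<ge> 0" "\<And>e x. 0 < e \<Longrightarrow> e < 1 \<Longrightarrow> \<bar>f e x\<bar> \<le> K * e ^ k * (1 + norm x) ^ N"
    using assms by (rule BOE) (rule that)
  obtain B where B: "B \<ge> 0" "\<And>x::'a. (\<integral>y. (1 + norm (x + y)) ^ N \<partial>gm) \<le> B * (1 + norm x) ^ N"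
    using mean_one_norm by blast
  show ?thesis
  proof (rule BOI[of _ "K * B" k N])
    fix e and x :: 'a assume e: "0 < (e::real)" "e < 1"
    \<comment> \<open>Nothing is assumed about measurability of \<open>f e\<close>; a nonintegrable
      integrand has integral 0, for which the bound holds as well.\<close>
    have "(\<integral>y. \<bar>f e (x + y)\<bar> \<partial>gm) \<le> (\<integral>y. K * e ^ k * (1 + norm (x + y)) ^ N \<partial>gm)"
      by (rule Bochner_Integration.integral_mono') (use 1 e in \<open>auto intro!: polyb_integrable polyb_mult\<close>)
    also have "\<dots> \<le> K * e ^ k * (B * (1 + norm x) ^ N)"
      using B(2)[of x] 1(1) e by (simp add: mult_left_mono)
    finally show "\<bar>\<integral>y. \<bar>f e (x + y)\<bar> \<partial>gm\<bar> \<le> K * B * e ^ k * (1 + norm x) ^ N"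
      by (simp add: mult_ac integral_nonneg_AE)
  qed
qed

lemma polyb_translate: "polyb f \<Longrightarrow> polyb (\<lambda>y. f (x + y))"
  using polyb_slice[OF polyb_shift[of f], of x] by simp

lemma gm_Fubini:
  fixes f :: "'a::euclidean_space \<times> 'b::euclidean_space \<Rightarrow> real"
  assumes "integrable gm f"
  shows "(\<integral>p. f p \<partial>gm) = (\<integral>x. \<integral>y. f (x, y) \<partial>gm \<partial>gm)"
  using assms unfolding gm_Pair by (rule gm2.integral_fst'[symmetric])

lemma polyb_bounded:
  assumes "f \<in> borel_measurable borel" "\<And>x. \<bar>f x\<bar> \<le> B"
  shows "polyb f"
  using assms by (intro polybI[where C=B and N=0]) auto

lemma polyb_indicator [simp]: "A \<in> sets borel \<Longrightarrow> polyb (indicator A)"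
  by (rule polyb_bounded[of _ 1]) auto

lemma BO_imp_polyb:
  assumes "BO k f" "0 < e" "e < 1" "f e \<in> borel_measurable borel"
  shows "polyb (f e)"
proof -
  obtain K N where "\<And>e x. 0 < e \<Longrightarrow> e < 1 \<Longrightarrow> \<bar>f e x\<bar> \<le> K * e ^ k * (1 + norm x) ^ N"
    using assms(1) by (rule BOE) (rule that)
  with assms show ?thesis by (intro polybI[where C="K * e ^ k" and N=N]) auto
qed

text \<open>Inside the strip nothing is claimed, so \<open>A e\<close> need not be a subgraph. The
  window \<open>|v| <= \<rho> / e\<close> is a fixed distance \<rho> in the unscaled vertical
  variable, and the constants are uniform in \<open>e\<close> and \<open>x\<close>.\<close>

definition sandwich ::
  "nat \<Rightarrow> real \<Rightarrow> (real \<Rightarrow> ('a::euclidean_space \<times> real) set) \<Rightarrow> (real \<Rightarrow> 'a \<Rightarrow> real) \<Rightarrow> bool" where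
  "sandwich k \<rho> A q \<longleftrightarrow> (\<exists>C\<ge>0. \<exists>N. \<forall>e x v. 0 < e \<longrightarrow> e < 1 \<longrightarrow> \<bar>v\<bar> \<le> \<rho> / e \<longrightarrow>
     C * e ^ k * (1 + norm x) ^ N < \<bar>v - q e x\<bar> \<longrightarrow> ((x, v) \<in> A e \<longleftrightarrow> v < q e x))"

text \<open>Two events separate the mean over \<open>A e\<close> from the mean over the subgraph of
  \<open>q e\<close>. The point may fall into the strip: the vertical density is at most 1, so this
  costs the width of the strip, averaged horizontally. Or the height leaves the window: from
  \<open>|v| <= \<rho> / (2 e)\<close> this needs a vertical displacement of at least
  \<open>\<rho> / (2 e)\<close>, and Markov's inequality with the \<open>k\<close>-th moment gives
  \<open>O(e^k)\<close>. Hence the window is halved. For the subgraph itself the vertical integral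
  is \<open>1/2 + gphi (q - v)\<close>.\<close>

lemma sandwich_mean:
  fixes A :: "real \<Rightarrow> ('a::euclidean_space \<times> real) set"
  assumes sand: "sandwich k \<rho> A q" and \<rho>: "\<rho> > 0"
    and mA: "\<And>e. 0 < e \<Longrightarrow> e < 1 \<Longrightarrow> A e \<in> sets borel"
    and mq: "\<And>e. 0 < e \<Longrightarrow> e < 1 \<Longrightarrow> q e \<in> borel_measurable borel"
  shows "\<exists>B. BO k B \<and> (\<forall>e x v. 0 < e \<longrightarrow> e < 1 \<longrightarrow> \<bar>v\<bar> \<le> \<rho> / 2 / e \<longrightarrow>
    \<bar>(\<integral>p. indicator (A e) ((x, v) + p) \<partial>gm) - (1 / 2 + (\<integral>y. gphi (q e (x + y) - v) \<partial>gm))\<bar> \<le> B e x)"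
proof -
  obtain C N where C: "C \<ge> 0" and s: "\<And>e x v. 0 < e \<Longrightarrow> e < 1 \<Longrightarrow> \<bar>v\<bar> \<le> \<rho> / e \<Longrightarrow>
     C * e ^ k * (1 + norm x) ^ N < \<bar>v - q e x\<bar> \<Longrightarrow> ((x, v) \<in> A e \<longleftrightarrow> v < q e x)"
    using sand unfolding sandwich_def by blast
  define R where "R e x = C * e ^ k * (1 + norm x) ^ N" for e and x :: 'a
  have R0: "0 \<le> R e x" if "0 < e" for e x using C that by (simp add: R_def)
  have pR: "polyb (R e)" for e unfolding R_def by simp
  define c2 where "c2 = (2 / \<rho>) ^ k * (\<integral>w. \<bar>w\<bar> ^ k \<partial>(gm :: real measure))"
  define B where "B e x = 2 * (\<integral>y. \<bar>R e (x + y)\<bar> \<partial>gm) + e ^ k * c2" for e and x :: 'a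
  have "BO k R"
    unfolding R_def by (rule BOI[of _ C k N]) (use C in \<open>simp add: abs_mult\<close>)
  then have "BO k B"
    unfolding B_def by (intro BO_add BO_cmult BO_mean BO_polyb) simp_all
  moreover have "\<bar>(\<integral>p. indicator (A e) ((x, v) + p) \<partial>gm) - (1 / 2 + (\<integral>y. gphi (q e (x + y) - v) \<partial>gm))\<bar> \<le> B e x"
    if e: "0 < e" "e < 1" and v: "\<bar>v\<bar> \<le> \<rho> / 2 / e" for e x v
  proof -
    have [measurable]: "q e \<in> borel_measurable borel" "A e \<in> sets borel" "R e \<in> borel_measurable borel"
      using mq mA e pR by (auto simp: polyb_def)
    have bp: "borel_measurable (borel :: ('a \<times> real) measure) = borel_measurable (borel \<Otimes>\<^sub>M borel)"
      by (simp add: borel_prod)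
    \<comment> \<open>\<open>f1\<close> and \<open>f2\<close> are the indicators of
      \<open>A e\<close> and of the subgraph; \<open>b1\<close> marks the strip, and
      \<open>b2\<close> is at least 1 on displacements out of the window.\<close>
    define f1 where "f1 p = (indicator (A e) ((x, v) + p) :: real)" for p
    define f2 where "f2 p = (if v + snd p \<le> q e (x + fst p) then 1 else 0 :: real)" for p :: "'a \<times> real"
    define b1 where "b1 p = (if \<bar>v + snd p - q e (x + fst p)\<bar> \<le> R e (x + fst p) then 1 else 0 :: real)" for p :: "'a \<times> real"
    define b2 where "b2 p = (2 * e / \<rho>) ^ k * \<bar>snd p\<bar> ^ k" for p :: "'a \<times> real"
    have "(\<lambda>p. (x, v) + p) \<in> borel_measurable (borel :: ('a \<times> real) measure)"
      by (intro borel_measurable_continuous_onI continuous_intros)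
    then have [measurable]: "f1 \<in> borel_measurable borel" unfolding f1_def by measurable
    have [measurable]: "f2 \<in> borel_measurable borel" "b1 \<in> borel_measurable borel"
      unfolding bp f2_def b1_def by measurable
    have i1: "integrable gm f1" by (rule polyb_integrable, rule polyb_bounded[of _ 1]) (auto simp: f1_def)
    have i2: "integrable gm f2" by (rule polyb_integrable, rule polyb_bounded[of _ 1]) (auto simp: f2_def)
    have i3: "integrable gm b1" by (rule polyb_integrable, rule polyb_bounded[of _ 1]) (auto simp: b1_def)
    have pb: "polyb (\<lambda>p::'a \<times> real. \<bar>snd p\<bar> ^ k)"
      using polyb_power[OF polyb_snd[OF polyb_abs[OF polyb_inner[of "1::real"]]], of k] by simp
    have i4: "integrable gm b2" unfolding b2_def by (rule polyb_integrable) (intro polyb_mult polyb_const pb)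
    have pt: "\<bar>f1 p - f2 p\<bar> \<le> b1 p + b2 p" for p
    proof -
      obtain y w where p: "p = (y, w)" by (cases p)
      have b2: "0 \<le> b2 p" using e \<rho> by (simp add: b2_def)
      have f12: "\<bar>f1 p - f2 p\<bar> \<le> 1" by (auto simp: f1_def f2_def indicator_def)
      show ?thesis
      proof (cases "\<bar>v + w\<bar> \<le> \<rho> / e")
        case True
        show ?thesis
        proof (cases "\<bar>v + w - q e (x + y)\<bar> \<le> R e (x + y)")
          case True
          then have "b1 p = 1" by (simp add: b1_def p)
          with b2 f12 show ?thesis by simp
        next
          case False
          then have "(x + y, v + w) \<in> A e \<longleftrightarrow> v + w < q e (x + y)"
            using s[OF e True] by (simp add: R_def)
          moreover have "v + w \<noteq> q e (x + y)" using False R0[OF e(1), of "x + y"] by auto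
          ultimately have "f1 p = f2 p" by (auto simp: f1_def f2_def p indicator_def)
          then show ?thesis using b2 by (simp add: b1_def)
        qed
      next
        case False
        have "\<rho> / e - \<rho> / 2 / e = \<rho> / (2 * e)" using e by (simp add: field_simps)
        then have "\<rho> / (2 * e) \<le> \<bar>w\<bar>" using False v by linarith
        then have "1 \<le> 2 * e / \<rho> * \<bar>w\<bar>" using e \<rho> by (simp add: field_simps)
        then have "1 \<le> (2 * e / \<rho> * \<bar>w\<bar>) ^ k" by (rule one_le_power)
        then have "1 \<le> b2 p" by (simp only: b2_def p power_mult_distrib snd_conv)
        with f12 show ?thesis by (simp add: b1_def)
      qed
    qed
    have "\<bar>(\<integral>p. f1 p \<partial>gm) - (\<integral>p. f2 p \<partial>gm)\<bar> = \<bar>\<integral>p. f1 p - f2 p \<partial>gm\<bar>"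
      using i1 i2 by simp
    also have "\<dots> \<le> (\<integral>p. \<bar>f1 p - f2 p\<bar> \<partial>gm)" by (rule integral_abs_bound)
    also have "\<dots> \<le> (\<integral>p. b1 p + b2 p \<partial>gm)"
      using i1 i2 i3 i4 pt by (intro integral_mono) auto
    also have "\<dots> = (\<integral>p. b1 p \<partial>gm) + (\<integral>p. b2 p \<partial>gm)" using i3 i4 by simp
    finally have main: "\<bar>(\<integral>p. f1 p \<partial>gm) - (\<integral>p. f2 p \<partial>gm)\<bar> \<le> (\<integral>p. b1 p \<partial>gm) + (\<integral>p. b2 p \<partial>gm)" .
    have "(\<integral>p. b2 p \<partial>gm) = (\<integral>y. \<integral>w. (2 * e / \<rho>) ^ k * \<bar>w\<bar> ^ k \<partial>gm \<partial>(gm :: 'a measure))"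
      unfolding gm_Fubini[OF i4] by (simp add: b2_def)
    also have "\<dots> = e ^ k * c2"
      using \<rho> by (simp add: c2_def power_divide power_mult_distrib)
    finally have I2: "(\<integral>p. b2 p \<partial>gm) = e ^ k * c2" .
    have "(\<integral>p. b1 p \<partial>gm) = (\<integral>y. \<integral>w. b1 (y, w) \<partial>gm \<partial>gm)" by (rule gm_Fubini[OF i3])
    also have "\<dots> \<le> (\<integral>y. 2 * \<bar>R e (x + y)\<bar> \<partial>gm)"
    proof (rule integral_mono')
      show "integrable gm (\<lambda>y. 2 * \<bar>R e (x + y)\<bar>)"
        by (rule polyb_integrable) (intro polyb_mult polyb_const polyb_abs polyb_translate pR)
      fix y
      have eq: "b1 (y, w) = indicator {q e (x + y) - v - R e (x + y)..q e (x + y) - v + R e (x + y)} w" for w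
        by (auto simp: b1_def indicator_def abs_le_iff)
      have "(\<integral>w. b1 (y, w) \<partial>gm) = measure gm {q e (x + y) - v - R e (x + y)..q e (x + y) - v + R e (x + y)}"
        unfolding eq by simp
      also have "\<dots> \<le> (q e (x + y) - v + R e (x + y)) - (q e (x + y) - v - R e (x + y))"
        using R0[OF e(1), of "x + y"] by (intro measure_gm_interval_le) simp
      finally show "(\<integral>w. b1 (y, w) \<partial>gm) \<le> 2 * \<bar>R e (x + y)\<bar>" using R0[OF e(1), of "x + y"] by simp
    qed simp
    finally have I1: "(\<integral>p. b1 p \<partial>gm) \<le> 2 * (\<integral>y. \<bar>R e (x + y)\<bar> \<partial>gm)" by simp
    have "(\<integral>p. f2 p \<partial>gm) = (\<integral>y. \<integral>w. f2 (y, w) \<partial>gm \<partial>gm)" by (rule gm_Fubini[OF i2])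
    also have "\<dots> = (\<integral>y. 1 / 2 + gphi (q e (x + y) - v) \<partial>gm)"
    proof (rule Bochner_Integration.integral_cong[OF refl])
      fix y
      have eq: "f2 (y, w) = indicator {..q e (x + y) - v} w" for w by (auto simp: f2_def indicator_def)
      show "(\<integral>w. f2 (y, w) \<partial>gm) = 1 / 2 + gphi (q e (x + y) - v)"
        unfolding eq gphi_def by simp
    qed
    also have "\<dots> = 1 / 2 + (\<integral>y. gphi (q e (x + y) - v) \<partial>gm)"
    proof (subst Bochner_Integration.integral_add)
      have "\<bar>gphi z\<bar> \<le> 1" for z
        using gm.prob_le_1[of "{..z}"] measure_nonneg[of gm "{..z}"] unfolding gphi_def by linarith
      then show "integrable gm (\<lambda>y. gphi (q e (x + y) - v))"
        by (intro polyb_integrable polyb_bounded[of _ 1]) auto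
    qed auto
    finally show ?thesis using main I1 I2 unfolding f1_def B_def by linarith
  qed
  ultimately show ?thesis by blast
qed

lemma sum_mult_diff_bound:
  fixes c a b r :: "'i \<Rightarrow> real"
  assumes "\<And>i. i \<in> I \<Longrightarrow> \<bar>a i - b i\<bar> \<le> r i"
  shows "\<bar>(\<Sum>i\<in>I. c i * a i) - (\<Sum>i\<in>I. c i * b i)\<bar> \<le> (\<Sum>i\<in>I. \<bar>c i\<bar> * r i)"
proof -
  have "\<bar>(\<Sum>i\<in>I. c i * a i) - (\<Sum>i\<in>I. c i * b i)\<bar> = \<bar>\<Sum>i\<in>I. c i * (a i - b i)\<bar>"
    by (simp add: sum_subtractf right_diff_distrib)
  also have "\<dots> \<le> (\<Sum>i\<in>I. \<bar>c i * (a i - b i)\<bar>)" by (rule sum_abs)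
  also have "\<dots> \<le> (\<Sum>i\<in>I. \<bar>c i\<bar> * r i)"
    using assms by (intro sum_mono) (simp add: abs_mult mult_left_mono)
  finally show ?thesis .
qed

text \<open>Convexity of the fifth power, made explicit by factoring out \<open>(u - v)^2\<close>.
  It splits the Taylor remainder into a part depending on the profile and a part depending on the
  height.\<close>

lemma power5_add_le: "\<bar>a - b :: real\<bar> ^ 5 \<le> 16 * (\<bar>a\<bar> ^ 5 + \<bar>b\<bar> ^ 5)"
proof -
  have *: "(2 * m) ^ 5 \<le> 16 * (m ^ 5 + m ^ 5)" for m :: real by (simp add: power_mult_distrib)
  have aux: "(u + v) ^ 5 \<le> 16 * (u ^ 5 + v ^ 5)" if "0 \<le> u" "0 \<le> v" for u v :: real
  proof -
    have "16 * (u ^ 5 + v ^ 5) - (u + v) ^ 5 = 5 * (u + v) * (u - v)\<^sup>2 * (3 * u\<^sup>2 + 2 * u * v + 3 * v\<^sup>2)"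
      by (simp add: eval_nat_numeral algebra_simps)
    also have "\<dots> \<ge> 0" using that by simp
    finally show ?thesis by simp
  qed
  have "\<bar>a - b\<bar> ^ 5 \<le> (\<bar>a\<bar> + \<bar>b\<bar>) ^ 5" by (intro power_mono) auto
  also have "\<dots> \<le> 16 * (\<bar>a\<bar> ^ 5 + \<bar>b\<bar> ^ 5)" by (rule aux) auto
  finally show ?thesis .
qed

text \<open>
  With \<open>Z\<^sub>i = q\<^sub>i(\<xi> + \<eta>) - q(\<xi>)\<close> and \<open>\<surd>(4\<pi>) gphi(z) = z - z\<^sup>3/12 + O(z\<^sup>5)\<close>, the level set of the
  stage is the graph of \<open>q\<close> up to \<open>O(e\<^sup>k)\<close> as soon as the mean of \<open>\<Sum> c\<^sub>i (Z\<^sub>i - Z\<^sub>i\<^sup>3/12)\<close> is \<open>O(e\<^sup>k)\<close>.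
  Where \<open>e (1 + |\<xi>|)\<^sup>N\<close> is not small the claim is vacuous.
\<close>

lemma stage_expansion:
  fixes A :: "'i \<Rightarrow> real \<Rightarrow> ('a::euclidean_space \<times> real) set"
  assumes fin: "finite I" and c1: "(\<Sum>i\<in>I. c i) = 1" and \<rho>: "\<rho> > 0" and k: "1 \<le> k" "k \<le> 5"
    and sand: "\<And>i. i \<in> I \<Longrightarrow> sandwich k \<rho> (A i) (q i)"
    and mA: "\<And>i e. i \<in> I \<Longrightarrow> 0 < e \<Longrightarrow> e < 1 \<Longrightarrow> A i e \<in> sets borel"
    and mq: "\<And>i e. i \<in> I \<Longrightarrow> 0 < e \<Longrightarrow> e < 1 \<Longrightarrow> q i e \<in> borel_measurable borel"
    and Oq: "\<And>i. i \<in> I \<Longrightarrow> BO 1 (q i)" and Oq': "BO 1 q'"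
    and res: "BO k (\<lambda>e x. \<Sum>i\<in>I. c i * (\<integral>y. (q i e (x + y) - q' e x) - (q i e (x + y) - q' e x) ^ 3 / 12 \<partial>gm))"
  shows "\<exists>C\<ge>0. \<exists>N. \<forall>e x v. 0 < e \<longrightarrow> e < 1 \<longrightarrow> \<bar>v\<bar> \<le> \<rho> / 2 / e \<longrightarrow>
     C * e ^ k * (1 + norm x) ^ N < \<bar>v - q' e x\<bar> \<longrightarrow>
     (v < q' e x \<longrightarrow> 1 / 2 < (\<Sum>i\<in>I. c i * (\<integral>p. indicator (A i e) ((x, v) + p) \<partial>gm))) \<and>
     (q' e x < v \<longrightarrow> (\<Sum>i\<in>I. c i * (\<integral>p. indicator (A i e) ((x, v) + p) \<partial>gm)) < 1 / 2)"
proof -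
  let ?W = "\<lambda>e x v. \<Sum>i\<in>I. c i * (\<integral>p. indicator (A i e) ((x, v) + p) \<partial>gm)"
  have "\<forall>i\<in>I. \<exists>B. BO k B \<and> (\<forall>e x v. 0 < e \<longrightarrow> e < 1 \<longrightarrow> \<bar>v\<bar> \<le> \<rho> / 2 / e \<longrightarrow>
    \<bar>(\<integral>p. indicator (A i e) ((x, v) + p) \<partial>gm) - (1 / 2 + (\<integral>y. gphi (q i e (x + y) - v) \<partial>gm))\<bar> \<le> B e x)"
    using sandwich_mean[OF sand \<rho> mA mq] by blast
  then obtain B where B: "\<And>i. i \<in> I \<Longrightarrow> BO k (B i)" and Bb: "\<And>i e x v. i \<in> I \<Longrightarrow> 0 < e \<Longrightarrow> e < 1 \<Longrightarrow> \<bar>v\<bar> \<le> \<rho> / 2 / e \<Longrightarrow>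
    \<bar>(\<integral>p. indicator (A i e) ((x, v) + p) \<partial>gm) - (1 / 2 + (\<integral>y. gphi (q i e (x + y) - v) \<partial>gm))\<bar> \<le> B i e x"
    by metis
  define H where "H n e x = (\<Sum>i\<in>I. \<bar>c i\<bar> * (\<integral>y. \<bar>q i e (x + y) ^ n\<bar> \<partial>gm))" for n e x
  have OH: "BO n (H n)" for n
    unfolding H_def using BO_power[OF Oq, of _ n] by (intro BO_sum BO_cmult BO_mean[where f="\<lambda>e x. q _ e x ^ n"]) simp
  define EB where "EB e x = (\<Sum>i\<in>I. \<bar>c i\<bar> * B i e x)" for e x
  have OEB: "BO k EB" unfolding EB_def by (intro BO_sum BO_cmult B)
  define Rs where "Rs e x = (\<Sum>i\<in>I. c i * (\<integral>y. (q i e (x + y) - q' e x) - (q i e (x + y) - q' e x) ^ 3 / 12 \<partial>gm))" for e x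
  have ORs: "BO k Rs" using res unfolding Rs_def .
  define G where "G = (\<Sum>i\<in>I. \<bar>c i\<bar>)"
  have G0: "0 \<le> G" unfolding G_def by (simp add: sum_nonneg)
  obtain K1 N1 where k1: "\<And>K N e x. K \<ge> K1 \<Longrightarrow> N \<ge> N1 \<Longrightarrow> 0 < e \<Longrightarrow> e < 1 \<Longrightarrow> \<bar>H 1 e x\<bar> \<le> K * e ^ 1 * (1 + norm x) ^ N"
    using OH[of 1] by (rule BOE') (rule that)
  obtain K2 N2 where k2: "\<And>K N e x. K \<ge> K2 \<Longrightarrow> N \<ge> N2 \<Longrightarrow> 0 < e \<Longrightarrow> e < 1 \<Longrightarrow> \<bar>H 2 e x\<bar> \<le> K * e ^ 2 * (1 + norm x) ^ N"
    using OH[of 2] by (rule BOE') (rule that)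
  obtain K3 N3 where k3: "\<And>K N e x. K \<ge> K3 \<Longrightarrow> N \<ge> N3 \<Longrightarrow> 0 < e \<Longrightarrow> e < 1 \<Longrightarrow> \<bar>H 5 e x\<bar> \<le> K * e ^ 5 * (1 + norm x) ^ N"
    using OH[of 5] by (rule BOE') (rule that)
  obtain K4 N4 where k4: "\<And>K N e x. K \<ge> K4 \<Longrightarrow> N \<ge> N4 \<Longrightarrow> 0 < e \<Longrightarrow> e < 1 \<Longrightarrow> \<bar>EB e x\<bar> \<le> K * e ^ k * (1 + norm x) ^ N"
    using OEB by (rule BOE') (rule that)
  obtain K5 N5 where k5: "\<And>K N e x. K \<ge> K5 \<Longrightarrow> N \<ge> N5 \<Longrightarrow> 0 < e \<Longrightarrow> e < 1 \<Longrightarrow> \<bar>Rs e x\<bar> \<le> K * e ^ k * (1 + norm x) ^ N"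
    using ORs by (rule BOE') (rule that)
  obtain K6 N6 where k6: "\<And>K N e x. K \<ge> K6 \<Longrightarrow> N \<ge> N6 \<Longrightarrow> 0 < e \<Longrightarrow> e < 1 \<Longrightarrow> \<bar>q' e x\<bar> \<le> K * e ^ 1 * (1 + norm x) ^ N"
    using Oq' by (rule BOE') (rule that)
  define K where "K = Max {1, G, K1, K2, K3, K4, K5, K6}"
  define N where "N = Max {N1, N2, N3, N4, N5, N6}"
  have K: "1 \<le> K" "G \<le> K" "K1 \<le> K" "K2 \<le> K" "K3 \<le> K" "K4 \<le> K" "K5 \<le> K" "K6 \<le> K"
    unfolding K_def by (rule Max_ge; simp)+
  have N: "N1 \<le> N" "N2 \<le> N" "N3 \<le> N" "N4 \<le> N" "N5 \<le> N" "N6 \<le> N"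
    unfolding N_def by (rule Max_ge; simp)+
  \<comment> \<open>For \<open>|v| > M * X\<close> the bound
    \<open>min |v| 1 / 8 >= 5 * K * X\<close> beats the two errors of size \<open>K * X\<close>;
    this is the 40. \<open>C1\<close> collects the fifth order remainders, \<open>C2\<close> bounds
    the deviation of the cubic from slope 1, and \<open>M'\<close> is so large that
    \<open>M' * X <= 1\<close> implies both \<open>M * X <= 1\<close> and
    \<open>C2 * X^2 <= 1\<close>. The second part of \<open>C\<close> makes the claim vacuous when
    \<open>M' * X > 1\<close>.\<close>
  define M where "M = 40 * K"
  define C1 where "C1 = 16 * (K + K * M ^ 5)"
  define C2 where "C2 = 10 * K + 10 * K ^ 3 + 3 * K * (M + K)\<^sup>2"
  define M' where "M' = M + C2"
  have M: "0 \<le> M" using K by (simp add: M_def)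
  have C10: "0 \<le> C1" using K M by (simp add: C1_def)
  have C20: "1 \<le> C2"
  proof -
    have "0 \<le> 10 * K ^ 3 + 3 * K * (M + K)\<^sup>2" using K by simp
    then show ?thesis using K unfolding C2_def by linarith
  qed
  have M': "1 \<le> M'" "M \<le> M'" "C2 \<le> M'" using C20 M by (auto simp: M'_def)
  define C where "C = 2 * (5 * K + C1) + (\<rho> * M' ^ Suc k + K * M' ^ k)"
  define N' where "N' = 5 * N + N * Suc k"
  have Ca: "0 \<le> \<rho> * M' ^ Suc k + K * M' ^ k" using \<rho> M' K by simp
  have Cb: "0 \<le> 2 * (5 * K + C1)" using K C10 by simp
  have "(v < q' e x \<longrightarrow> 1 / 2 < ?W e x v) \<and> (q' e x < v \<longrightarrow> ?W e x v < 1 / 2)"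
    if e: "0 < e" "e < 1" and v: "\<bar>v\<bar> \<le> \<rho> / 2 / e" and big: "C * e ^ k * (1 + norm x) ^ N' < \<bar>v - q' e x\<bar>" for e x v
  proof -
    define L where "L = 1 + norm x"
    have L: "1 \<le> L" by (simp add: L_def)
    define X where "X = e * L ^ N"
    have X: "0 < X" using e L by (simp add: X_def)
    have LN: "1 \<le> L ^ N" using L by simp
    define Z where "Z = e ^ k * L ^ (5 * N)"
    define y where "y = v - q' e x"
    have Y: "e ^ k * L ^ N \<le> Z" unfolding Z_def using e L by (intro mult_left_mono power_increasing) auto
    have YX: "e ^ k * L ^ N \<le> X"
      unfolding X_def using e LN k power_decreasing[of 1 k e] by (intro mult_right_mono) auto
    have X5: "X ^ 5 \<le> Z"
    proof -
      have "(L ^ N) ^ 5 = L ^ (5 * N)" by (simp add: power_mult[symmetric] mult.commute)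
      then show ?thesis
        unfolding X_def Z_def power_mult_distrib using e L k by (simp add: mult_right_mono power_decreasing)
    qed
    have h1: "H 1 e x \<le> K * X" using k1[OF K(3) N(1) e, of x] by (simp add: X_def L_def mult.assoc)
    have h2: "H 2 e x \<le> K * X\<^sup>2"
    proof -
      have "H 2 e x \<le> K * e ^ 2 * L ^ N" using k2[OF K(4) N(2) e, of x] by (simp add: L_def)
      also have "\<dots> \<le> K * e ^ 2 * L ^ (N * 2)" using K L e by (intro mult_left_mono power_increasing) auto
      finally show ?thesis by (simp add: X_def power_mult_distrib power_mult)
    qed
    have h5: "H 5 e x \<le> K * X ^ 5"
    proof -
      have "H 5 e x \<le> K * e ^ 5 * L ^ N" using k3[OF K(5) N(3) e, of x] by (simp add: L_def)
      also have "\<dots> \<le> K * e ^ 5 * L ^ (N * 5)" using K L e by (intro mult_left_mono power_increasing) auto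
      finally show ?thesis by (simp add: X_def power_mult_distrib power_mult)
    qed
    have hE: "EB e x \<le> K * (e ^ k * L ^ N)" using k4[OF K(6) N(4) e, of x] by (simp add: L_def mult.assoc)
    have hR: "\<bar>Rs e x\<bar> \<le> K * (e ^ k * L ^ N)" using k5[OF K(7) N(5) e, of x] by (simp add: L_def mult.assoc)
    have hq: "\<bar>q' e x\<bar> \<le> K * X" using k6[OF K(8) N(6) e, of x] by (simp add: L_def X_def mult.assoc)
    define S where "S = (\<Sum>i\<in>I. c i * (\<integral>y. gphi (q i e (x + y) - v) \<partial>gm))"
    have "\<bar>?W e x v - (\<Sum>i\<in>I. c i * (1 / 2 + (\<integral>y. gphi (q i e (x + y) - v) \<partial>gm)))\<bar> \<le> EB e x"
      unfolding EB_def by (intro sum_mult_diff_bound Bb e v)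
    moreover have "(\<Sum>i\<in>I. c i * (1 / 2 + (\<integral>y. gphi (q i e (x + y) - v) \<partial>gm))) = 1 / 2 + S"
      unfolding S_def distrib_left sum.distrib sum_distrib_right[symmetric] c1 by simp
    ultimately have WS: "\<bar>(?W e x v - 1 / 2) - S\<bar> \<le> K * (e ^ k * L ^ N)" using hE by linarith
    have pq: "polyb (\<lambda>y. q i e (x + y))" if "i \<in> I" for i
      by (intro polyb_translate BO_imp_polyb[OF Oq[OF that] e] mq that e)
    have pphi: "polyb (\<lambda>y. gphi (q i e (x + y) - v))" if "i \<in> I" for i
    proof (rule polyb_bound)
      show "polyb (\<lambda>y. \<bar>q i e (x + y) - v\<bar>)" using pq[OF that] by simp
      show "(\<lambda>y. gphi (q i e (x + y) - v)) \<in> borel_measurable borel"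
        using polyb_measurable[OF pq[OF that]] by measurable
      show "\<bar>gphi (q i e (x + y) - v)\<bar> \<le> \<bar>q i e (x + y) - v\<bar>" for y
        using gphi_Lipschitz[of "q i e (x + y) - v" 0] by simp
    qed
    note pint = polyb_integrable
    show ?thesis
    proof (cases "M' * X \<le> 1")
      case False
      then have 1: "1 \<le> M' * X" by simp
      \<comment> \<open>This factor supplies the missing \<open>e ^ k\<close>: the crude bounds for
        \<open>v\<close> and \<open>q'\<close> are thereby turned into a contradiction to
        \<open>big\<close>.\<close>
      have p1: "1 \<le> (M' * X) ^ k" using 1 by (rule one_le_power)
      have "\<bar>v\<bar> \<le> \<rho> / e" using v \<rho> e by (simp add: field_simps)
      also have "\<dots> \<le> \<rho> * (M' * L ^ N)" using 1 \<rho> e by (simp add: X_def field_simps)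
      also have "\<dots> \<le> \<rho> * (M' * L ^ N) * (M' * X) ^ k"
        using mult_left_mono[OF p1, of "\<rho> * (M' * L ^ N)"] \<rho> M' L by simp
      finally have v1: "\<bar>v\<bar> \<le> \<rho> * (M' * L ^ N) * (M' * X) ^ k" .
      have "\<bar>q' e x\<bar> \<le> K * L ^ N"
        using hq e LN K by (simp add: X_def) (smt (verit) mult_le_cancel_left1 mult_le_cancel_right1 mult_mono zero_le_mult_iff)
      also have "\<dots> \<le> K * L ^ N * (M' * X) ^ k"
        using mult_left_mono[OF p1, of "K * L ^ N"] K L by simp
      finally have "\<bar>q' e x\<bar> \<le> K * L ^ N * (M' * X) ^ k" .
      with v1 have "\<bar>v - q' e x\<bar> \<le> \<rho> * (M' * L ^ N) * (M' * X) ^ k + K * L ^ N * (M' * X) ^ k" by linarith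
      also have "\<dots> = (\<rho> * M' ^ Suc k + K * M' ^ k) * e ^ k * L ^ (N * Suc k)"
        by (simp add: X_def power_mult_distrib power_add power_mult[symmetric] algebra_simps)
      also have "\<dots> \<le> (\<rho> * M' ^ Suc k + K * M' ^ k) * e ^ k * L ^ N'"
        using Ca e L unfolding N'_def by (intro mult_left_mono power_increasing) auto
      also have "\<dots> \<le> C * e ^ k * L ^ N'"
        using Cb e L unfolding C_def by (intro mult_right_mono) auto
      finally show ?thesis using big by (simp add: L_def)
    next
      case True
      have MX: "M * X \<le> 1" using True M'(2) X by (meson mult_right_mono less_imp_le order_trans)
      show ?thesis
      proof (cases "\<bar>v\<bar> \<le> M * X")
        case False
        \<comment> \<open>Far from the graph the profiles are negligible against \<open>v\<close>:
          by Lipschitz continuity every \<open>gphi (q_i - v)\<close> may be replaced by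
          \<open>gphi (- v)\<close>, and the coefficients add up to 1.\<close>
        have "\<bar>S - (\<Sum>i\<in>I. c i * gphi (- v))\<bar> \<le> H 1 e x"
          unfolding S_def H_def
        proof (rule sum_mult_diff_bound)
          fix i assume i: "i \<in> I"
          have "(\<integral>y. gphi (q i e (x + y) - v) \<partial>gm) - gphi (- v) = (\<integral>y. gphi (q i e (x + y) - v) - gphi (- v) \<partial>gm)"
            using pint[OF pphi[OF i]] by simp
          also have "\<bar>\<dots>\<bar> \<le> (\<integral>y. \<bar>gphi (q i e (x + y) - v) - gphi (- v)\<bar> \<partial>gm)" by (rule integral_abs_bound)
          also have "\<dots> \<le> (\<integral>y. \<bar>q i e (x + y) ^ 1\<bar> \<partial>gm)"
          proof (rule integral_mono')
            show "integrable gm (\<lambda>y. \<bar>q i e (x + y) ^ 1\<bar>)" using pq[OF i] by (intro pint) simp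
            show "\<bar>gphi (q i e (x + y) - v) - gphi (- v)\<bar> \<le> \<bar>q i e (x + y) ^ 1\<bar>" for y
              using gphi_Lipschitz[of "q i e (x + y) - v" "- v"] by simp
          qed simp
          finally show "\<bar>(\<integral>y. gphi (q i e (x + y) - v) \<partial>gm) - gphi (- v)\<bar> \<le> (\<integral>y. \<bar>q i e (x + y) ^ 1\<bar> \<partial>gm)" .
        qed
        then have S1: "\<bar>S - gphi (- v)\<bar> \<le> K * X" using c1 h1 by (simp add: sum_distrib_right[symmetric])
        have g: "5 * (K * X) \<le> gphi \<bar>v\<bar>"
        proof -
          have "5 * (K * X) \<le> min \<bar>v\<bar> 1 / 8" using False MX unfolding M_def by auto
          also have "\<dots> \<le> gphi \<bar>v\<bar>" by (rule gphi_lower) simp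
          finally show ?thesis .
        qed
        have KX: "0 < K * X" using K X by simp
        have qv: "\<bar>q' e x\<bar> < \<bar>v\<bar>" using hq False KX unfolding M_def by linarith
        have Y2: "K * (e ^ k * L ^ N) \<le> K * X" using YX K by (intro mult_left_mono) auto
        show ?thesis
        proof (cases "0 \<le> v")
          case True
          then have "gphi (- v) \<le> - (5 * (K * X))" using g by (simp add: gphi_minus)
          then show ?thesis using WS S1 Y2 KX qv True by linarith
        next
          case False
          then have "5 * (K * X) \<le> gphi (- v)" using g by simp
          then show ?thesis using WS S1 Y2 KX qv False by linarith
        qed
      next
        case vM: True
        define s where "s = sqrt (4 * pi)"
        have s: "1 \<le> s" "s \<le> 4" using sqrt_4pi_bounds by (auto simp: s_def)
        \<comment> \<open>The mean of the Taylor polynomial at height \<open>u\<close>. At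
          \<open>u = q' e x\<close> it is the residual \<open>Rs\<close>, which is
          \<open>O(e^k)\<close> by hypothesis; the next estimates transport this to
          \<open>u = v\<close>.\<close>
        define F where "F u = (\<Sum>i\<in>I. c i * (\<integral>y. (q i e (x + y) - u) - (q i e (x + y) - u) ^ 3 / 12 \<partial>gm))" for u
        have "\<bar>(\<Sum>i\<in>I. c i * (s * (\<integral>y. gphi (q i e (x + y) - v) \<partial>gm))) - F v\<bar>
            \<le> (\<Sum>i\<in>I. \<bar>c i\<bar> * (16 * (\<integral>y. \<bar>q i e (x + y) ^ 5\<bar> \<partial>gm) + 16 * \<bar>v\<bar> ^ 5))"
          unfolding F_def
        proof (rule sum_mult_diff_bound)
          fix i assume i: "i \<in> I"
          have i1: "integrable gm (\<lambda>y. s * gphi (q i e (x + y) - v))"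
            using pphi[OF i] by (intro pint) simp
          have i2: "integrable gm (\<lambda>y. (q i e (x + y) - v) - (q i e (x + y) - v) ^ 3 / 12)"
            using pq[OF i] by (intro pint) simp
          have ieq: "s * (\<integral>y. gphi (q i e (x + y) - v) \<partial>gm) - (\<integral>y. (q i e (x + y) - v) - (q i e (x + y) - v) ^ 3 / 12 \<partial>gm)
            = (\<integral>y. s * gphi (q i e (x + y) - v) - ((q i e (x + y) - v) - (q i e (x + y) - v) ^ 3 / 12) \<partial>gm)"
            unfolding Bochner_Integration.integral_diff[OF i1 i2] by simp
          have "\<bar>s * (\<integral>y. gphi (q i e (x + y) - v) \<partial>gm) - (\<integral>y. (q i e (x + y) - v) - (q i e (x + y) - v) ^ 3 / 12 \<partial>gm)\<bar> \<le> (\<integral>y. \<bar>s * gphi (q i e (x + y) - v) - ((q i e (x + y) - v) - (q i e (x + y) - v) ^ 3 / 12)\<bar> \<partial>gm)"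
            unfolding ieq by (rule integral_abs_bound)
          also have "\<dots> \<le> (\<integral>y. 16 * \<bar>q i e (x + y) ^ 5\<bar> + 16 * \<bar>v\<bar> ^ 5 \<partial>gm)"
          proof (rule integral_mono')
            show "integrable gm (\<lambda>y. 16 * \<bar>q i e (x + y) ^ 5\<bar> + 16 * \<bar>v\<bar> ^ 5)" using pq[OF i] by (intro pint) simp
            show "\<bar>s * gphi (q i e (x + y) - v) - ((q i e (x + y) - v) - (q i e (x + y) - v) ^ 3 / 12)\<bar>
                \<le> 16 * \<bar>q i e (x + y) ^ 5\<bar> + 16 * \<bar>v\<bar> ^ 5" for y
              using gphi_Taylor[of "q i e (x + y) - v"] power5_add_le[of "q i e (x + y)" v]
              by (simp add: s_def power_abs)
          qed simp
          also have "\<dots> = 16 * (\<integral>y. \<bar>q i e (x + y) ^ 5\<bar> \<partial>gm) + 16 * \<bar>v\<bar> ^ 5"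
          proof -
            have "integrable gm (\<lambda>y. \<bar>q i e (x + y) ^ 5\<bar>)" using pq[OF i] by (intro pint) simp
            then show ?thesis by simp
          qed
          finally show "\<bar>s * (\<integral>y. gphi (q i e (x + y) - v) \<partial>gm) - (\<integral>y. (q i e (x + y) - v) - (q i e (x + y) - v) ^ 3 / 12 \<partial>gm)\<bar>
            \<le> 16 * (\<integral>y. \<bar>q i e (x + y) ^ 5\<bar> \<partial>gm) + 16 * \<bar>v\<bar> ^ 5" .
        qed
        also have "\<dots> = 16 * H 5 e x + 16 * (G * \<bar>v\<bar> ^ 5)"
          unfolding H_def G_def by (simp add: distrib_left sum.distrib sum_distrib_left sum_distrib_right mult_ac)
        also have "\<dots> \<le> 16 * (K * X ^ 5) + 16 * (K * (M * X) ^ 5)"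
          using h5 K G0 vM by (intro add_mono mult_left_mono mult_mono power_mono) auto
        also have "\<dots> = C1 * X ^ 5" by (simp add: C1_def power_mult_distrib algebra_simps)
        also have "(\<Sum>i\<in>I. c i * (s * (\<integral>y. gphi (q i e (x + y) - v) \<partial>gm))) = s * S"
          by (simp add: S_def sum_distrib_left mult.left_commute)
        finally have SF: "\<bar>s * S - F v\<bar> \<le> C1 * X ^ 5" .
        \<comment> \<open>Moving the height by \<open>y\<close> changes \<open>z - z^3/12\<close> by
          \<open>- y\<close> up to \<open>y\<close> times a quadratic expression; for small
          \<open>X\<close> that expression is at most 1, so the slope is -1 up to 1/12.\<close>
        have FvB: "\<bar>F v - (\<Sum>i\<in>I. c i * ((\<integral>y. (q i e (x + y) - q' e x) - (q i e (x + y) - q' e x) ^ 3 / 12 \<partial>gm) - y))\<bar>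
            \<le> (\<Sum>i\<in>I. \<bar>c i\<bar> * (\<bar>y\<bar> / 12 * (10 * (\<integral>y. \<bar>q i e (x + y) ^ 2\<bar> \<partial>gm) + 10 * (q' e x)\<^sup>2 + 3 * y\<^sup>2)))"
          unfolding F_def
        proof (rule sum_mult_diff_bound)
          fix i assume i: "i \<in> I"
          let ?Q = "\<lambda>w. q i e (x + w)" and ?q = "q' e x"
          have i1: "integrable gm (\<lambda>w. (?Q w - v) - (?Q w - v) ^ 3 / 12)"
            using pq[OF i] by (intro pint) simp
          have i2: "integrable gm (\<lambda>w. (?Q w - ?q) - (?Q w - ?q) ^ 3 / 12)"
            using pq[OF i] by (intro pint) simp
          have i2': "integrable gm (\<lambda>w. ((?Q w - ?q) - (?Q w - ?q) ^ 3 / 12) - y)"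
            using i2 by simp
          have i3: "integrable gm (\<lambda>w. \<bar>(?Q w)\<^sup>2\<bar>)" using pq[OF i] by (intro pint) simp
          have pt: "\<bar>((?Q w - v) - (?Q w - v) ^ 3 / 12) - (((?Q w - ?q) - (?Q w - ?q) ^ 3 / 12) - y)\<bar>
              \<le> \<bar>y\<bar> / 12 * (10 * \<bar>(?Q w)\<^sup>2\<bar> + 10 * ?q\<^sup>2 + 3 * y\<^sup>2)" for w
          proof -
            define z where "z = ?Q w - ?q"
            have qv: "?Q w - v = z - y" by (simp add: z_def y_def)
            have id3: "((z - y) - (z - y) ^ 3 / 12) - ((z - z ^ 3 / 12) - y) = y / 12 * (3 * z\<^sup>2 - 3 * z * y + y\<^sup>2)"
              by (simp add: power2_eq_square power3_eq_cube field_simps)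
            have "\<bar>3 * z\<^sup>2 - 3 * z * y + y\<^sup>2\<bar> \<le> 5 * z\<^sup>2 + 3 * y\<^sup>2"
            proof -
              have "0 \<le> (z - y)\<^sup>2" "0 \<le> (z + y)\<^sup>2" "0 \<le> z\<^sup>2" "0 \<le> y\<^sup>2" by simp_all
              then show ?thesis unfolding power2_sum power2_diff abs_le_iff mult.assoc by linarith
            qed
            moreover have "5 * z\<^sup>2 \<le> 10 * (?Q w)\<^sup>2 + 10 * ?q\<^sup>2"
            proof -
              have "10 * (?Q w)\<^sup>2 + 10 * ?q\<^sup>2 - 5 * z\<^sup>2 = 5 * (?Q w + ?q)\<^sup>2"
                by (simp add: z_def power2_eq_square algebra_simps)
              then show ?thesis using zero_le_power2[of "?Q w + ?q"] by linarith
            qed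
            ultimately show ?thesis
              unfolding qv z_def[symmetric] id3 abs_mult by (intro mult_mono) simp_all
          qed
          have ieq: "(\<integral>w. (?Q w - v) - (?Q w - v) ^ 3 / 12 \<partial>gm) - ((\<integral>w. (?Q w - ?q) - (?Q w - ?q) ^ 3 / 12 \<partial>gm) - y)
            = (\<integral>w. ((?Q w - v) - (?Q w - v) ^ 3 / 12) - (((?Q w - ?q) - (?Q w - ?q) ^ 3 / 12) - y) \<partial>gm)"
            unfolding Bochner_Integration.integral_diff[OF i1 i2'] using i2 by simp
          have "\<bar>(\<integral>w. (?Q w - v) - (?Q w - v) ^ 3 / 12 \<partial>gm) - ((\<integral>w. (?Q w - ?q) - (?Q w - ?q) ^ 3 / 12 \<partial>gm) - y)\<bar> \<le> (\<integral>w. \<bar>((?Q w - v) - (?Q w - v) ^ 3 / 12) - (((?Q w - ?q) - (?Q w - ?q) ^ 3 / 12) - y)\<bar> \<partial>gm)"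
            unfolding ieq by (rule integral_abs_bound)
          also have "\<dots> \<le> (\<integral>w. \<bar>y\<bar> / 12 * (10 * \<bar>(?Q w)\<^sup>2\<bar> + 10 * ?q\<^sup>2 + 3 * y\<^sup>2) \<partial>gm)"
            by (rule integral_mono'[OF _ pt]) (use i3 in simp_all)
          also have "\<dots> = \<bar>y\<bar> / 12 * (10 * (\<integral>w. \<bar>(?Q w)\<^sup>2\<bar> \<partial>gm) + 10 * ?q\<^sup>2 + 3 * y\<^sup>2)"
            using i3 by simp
          finally show "\<bar>(\<integral>w. (?Q w - v) - (?Q w - v) ^ 3 / 12 \<partial>gm) - ((\<integral>w. (?Q w - ?q) - (?Q w - ?q) ^ 3 / 12 \<partial>gm) - y)\<bar>
             \<le> \<bar>y\<bar> / 12 * (10 * (\<integral>w. \<bar>(?Q w)\<^sup>2\<bar> \<partial>gm) + 10 * ?q\<^sup>2 + 3 * y\<^sup>2)" .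
        qed
        have "(\<Sum>i\<in>I. c i * ((\<integral>y. (q i e (x + y) - q' e x) - (q i e (x + y) - q' e x) ^ 3 / 12 \<partial>gm) - y)) = Rs e x - y"
          unfolding Rs_def right_diff_distrib sum_subtractf sum_distrib_right[symmetric] c1 by simp
        note FvB = FvB[unfolded this]
        have "(\<Sum>i\<in>I. \<bar>c i\<bar> * (\<bar>y\<bar> / 12 * (10 * (\<integral>y. \<bar>q i e (x + y) ^ 2\<bar> \<partial>gm) + 10 * (q' e x)\<^sup>2 + 3 * y\<^sup>2)))
           = \<bar>y\<bar> / 12 * (10 * H 2 e x + 10 * (G * (q' e x)\<^sup>2) + 3 * (G * y\<^sup>2))"
          unfolding H_def G_def by (simp add: distrib_left sum.distrib sum_distrib_left sum_distrib_right mult_ac)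
        also have "\<dots> \<le> \<bar>y\<bar> / 12 * (C2 * X\<^sup>2)"
        proof (rule mult_left_mono)
          have "\<bar>y\<bar> \<le> (M + K) * X" using vM hq unfolding y_def by (simp add: distrib_right)
          then have "y\<^sup>2 \<le> ((M + K) * X)\<^sup>2" by (metis abs_ge_zero power2_abs power_mono)
          moreover have "(q' e x)\<^sup>2 \<le> (K * X)\<^sup>2" using hq by (metis abs_ge_zero power2_abs power_mono)
          ultimately have "10 * H 2 e x + 10 * (G * (q' e x)\<^sup>2) + 3 * (G * y\<^sup>2)
             \<le> 10 * (K * X\<^sup>2) + 10 * (K * (K * X)\<^sup>2) + 3 * (K * ((M + K) * X)\<^sup>2)"
            using h2 K G0 by (intro add_mono mult_left_mono mult_mono) auto
          also have "\<dots> = C2 * X\<^sup>2" by (simp add: C2_def power2_eq_square power3_eq_cube algebra_simps)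
          finally show "10 * H 2 e x + 10 * (G * (q' e x)\<^sup>2) + 3 * (G * y\<^sup>2) \<le> C2 * X\<^sup>2" .
        qed simp
        also have "\<dots> \<le> \<bar>y\<bar> / 12 * 1"
        proof (rule mult_left_mono)
          have "C2 * X\<^sup>2 \<le> (M' * X)\<^sup>2"
          proof -
            have "C2 \<le> M' * M'" using mult_mono[of C2 M' 1 M'] M' C20 by simp
            then have "C2 * X\<^sup>2 \<le> (M' * M') * X\<^sup>2" by (rule mult_right_mono) simp
            then show ?thesis by (simp only: power_mult_distrib power2_eq_square mult_ac)
          qed
          also have "\<dots> \<le> 1" using True M' X by (simp add: power_le_one)
          finally show "C2 * X\<^sup>2 \<le> 1" .
        qed simp
        finally have Fv: "\<bar>F v - (Rs e x - y)\<bar> \<le> \<bar>y\<bar> / 12" using FvB by simp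
        define D where "D = ?W e x v - 1 / 2"
        have "\<bar>s * D - s * S\<bar> \<le> 4 * (K * Z)"
        proof -
          have "\<bar>s * D - s * S\<bar> = s * \<bar>D - S\<bar>" using s by (simp add: abs_mult right_diff_distrib[symmetric])
          also have "\<dots> \<le> 4 * (K * (e ^ k * L ^ N))" using WS s K e L by (intro mult_mono) (auto simp: D_def)
          also have "\<dots> \<le> 4 * (K * Z)" using Y K by (intro mult_left_mono) auto
          finally show ?thesis .
        qed
        moreover have "\<bar>Rs e x\<bar> \<le> K * Z" using hR Y K by (meson mult_left_mono order_trans zero_le_one)
        moreover have "C1 * X ^ 5 \<le> C1 * Z" using X5 C10 by (rule mult_left_mono)
        ultimately have sD: "\<bar>s * D + y\<bar> \<le> \<bar>y\<bar> / 12 + (5 * K + C1) * Z"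
        proof -
          have tri: "\<bar>s * D + y\<bar> \<le> \<bar>s * D - s * S\<bar> + \<bar>s * S - F v\<bar> + \<bar>F v - (Rs e x - y)\<bar> + \<bar>Rs e x\<bar>"
            by linarith
          assume "\<bar>s * D - s * S\<bar> \<le> 4 * (K * Z)" "\<bar>Rs e x\<bar> \<le> K * Z" "C1 * X ^ 5 \<le> C1 * Z"
          with SF Fv have "\<bar>s * D - s * S\<bar> + \<bar>s * S - F v\<bar> + \<bar>F v - (Rs e x - y)\<bar> + \<bar>Rs e x\<bar>
              \<le> 4 * (K * Z) + C1 * Z + \<bar>y\<bar> / 12 + K * Z"
            by (intro add_mono) auto
          also have "\<dots> = \<bar>y\<bar> / 12 + (5 * K + C1) * Z" by (simp add: algebra_simps)
          finally show ?thesis using tri by (rule order_trans[rotated])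
        qed
        have "2 * ((5 * K + C1) * Z) \<le> C * e ^ k * L ^ N'"
        proof -
          have "2 * ((5 * K + C1) * Z) = (2 * (5 * K + C1)) * e ^ k * L ^ (5 * N)" by (simp add: Z_def)
          also have "\<dots> \<le> (2 * (5 * K + C1)) * e ^ k * L ^ N'"
            using Cb e L unfolding N'_def by (intro mult_left_mono power_increasing) auto
          also have "\<dots> \<le> C * e ^ k * L ^ N'"
            using Ca e L unfolding C_def by (intro mult_right_mono) auto
          finally show ?thesis .
        qed
        then have y2: "2 * ((5 * K + C1) * Z) < \<bar>y\<bar>" using big by (simp add: y_def L_def)
        \<comment> \<open>The errors add up to less than \<open>|y|/12 + |y|/2\<close>, so
          \<open>s * D\<close> has the sign of \<open>- y\<close>.\<close>
        have "0 < s * D" if "y < 0" using sD y2 that by linarith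
        moreover have "s * D < 0" if "0 < y" using sD y2 that by linarith
        ultimately show ?thesis using s unfolding y_def D_def by (auto simp: zero_less_mult_iff mult_less_0_iff)
      qed
    qed
  qed
  moreover have "0 \<le> C" using Ca Cb unfolding C_def by linarith
  ultimately show ?thesis by blast
qed

section \<open>The crossing of the axis\<close>

text \<open>\<open>|x - y|^2 <= 2 |x' - y|^2 + 2\<close>: the kernel of twice the time dominates all
  translates by at most 1. It serves as integrable majorant, both for dominated convergence and for
  derivatives in the translation.\<close>

lemma gauss_kernel_dominated:
  assumes t: "t > 0"
  shows "\<exists>C\<ge>0. \<forall>x x' y::'a::euclidean_space. norm (x' - x) \<le> 1 \<longrightarrow> gauss_kernel t (x' - y) \<le> C * gauss_kernel (2 * t) (x - y)"
proof -
  let ?n = "\<lambda>s. (4 * pi * s) powr (real DIM('a) / 2)"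
  define C where "C = ?n (2 * t) / ?n t * exp (1 / (4 * t))"
  have pos: "?n s > 0" if "s > 0" for s using that by simp
  have "gauss_kernel t (x' - y) \<le> C * gauss_kernel (2 * t) (x - y)" if "norm (x' - x) \<le> 1" for x x' y :: 'a
  proof -
    have "norm (x - y) \<le> norm (x' - y) + norm (x' - x)"
      using norm_triangle_ineq4[of "x' - y" "x' - x"] by (simp add: norm_minus_commute)
    then have "norm (x - y) \<le> norm (x' - y) + 1" using that by linarith
    then have "(norm (x - y))\<^sup>2 \<le> (norm (x' - y) + 1)\<^sup>2" by (intro power_mono) auto
    also have "\<dots> \<le> 2 * (norm (x' - y))\<^sup>2 + 2"
    proof -
      have "2 * (norm (x' - y))\<^sup>2 + 2 - (norm (x' - y) + 1)\<^sup>2 = (norm (x' - y) - 1)\<^sup>2"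
        by (simp add: power2_eq_square algebra_simps)
      then show ?thesis using zero_le_power2[of "norm (x' - y) - 1"] by linarith
    qed
    finally have "- (norm (x' - y))\<^sup>2 / (4 * t) \<le> 1 / (4 * t) + - (norm (x - y))\<^sup>2 / (4 * (2 * t))"
      using t by (simp add: field_simps)
    then have e: "exp (- (norm (x' - y))\<^sup>2 / (4 * t)) \<le> exp (1 / (4 * t)) * exp (- (norm (x - y))\<^sup>2 / (4 * (2 * t)))"
      unfolding exp_add[symmetric] by simp
    have "C * gauss_kernel (2 * t) (x - y) = 1 / ?n t * (exp (1 / (4 * t)) * exp (- (norm (x - y))\<^sup>2 / (4 * (2 * t))))"
      using pos[of "2 * t"] t by (simp add: C_def gauss_kernel_def)
    then show ?thesis unfolding gauss_kernel_def[of t]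
      using mult_left_mono[OF e, of "1 / ?n t"] pos[OF t] by simp
  qed
  moreover have "0 \<le> C" using pos[OF t] pos[of "2 * t"] t by (simp add: C_def)
  ultimately show ?thesis by blast
qed

text \<open>Continuity of the thresholded function is needed twice: for the intermediate value
  theorem on the axis, and to place the frontier of a superlevel set inside the level set.\<close>

lemma continuous_conv_gauss_kernel:
  fixes f :: "'a::euclidean_space \<Rightarrow> real"
  assumes t: "t > 0" and [measurable]: "f \<in> borel_measurable borel" and f: "\<And>y. \<bar>f y\<bar> \<le> B"
  shows "continuous_on UNIV (conv (gauss_kernel t) f)"
proof -
  obtain C where C: "C \<ge> 0" "\<And>x x' y::'a. norm (x' - x) \<le> 1 \<Longrightarrow> gauss_kernel t (x' - y) \<le> C * gauss_kernel (2 * t) (x - y)"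
    using gauss_kernel_dominated[OF t] by blast
  have B: "0 \<le> B" using f[of undefined] by simp
  have "(conv (gauss_kernel t) f \<circ> u) \<longlonglongrightarrow> conv (gauss_kernel t) f x" if lim: "u \<longlonglongrightarrow> x" for u x
  proof -
    obtain N where N: "\<And>n. n \<ge> N \<Longrightarrow> norm (u n - x) < 1"
      using LIMSEQ_D[OF lim, of 1] by auto
    have "(\<lambda>n. \<integral>y. gauss_kernel t (u (n + N) - y) * f y \<partial>lborel) \<longlonglongrightarrow> (\<integral>y. gauss_kernel t (x - y) * f y \<partial>lborel)"
    proof (rule integral_dominated_convergence)
      have "integrable lborel (\<lambda>y. gauss_kernel (2 * t) (x - y))"
        using integrable_gauss_kernel_shift[of "2 * t" x] t by (simp add: gauss_kernel_commute[of _ x])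
      then show "integrable lborel (\<lambda>y. C * gauss_kernel (2 * t) (x - y) * B)" by simp
      show "AE y in lborel. (\<lambda>n. gauss_kernel t (u (n + N) - y) * f y) \<longlonglongrightarrow> gauss_kernel t (x - y) * f y"
      proof (rule AE_I2)
        fix y
        have "isCont (gauss_kernel t) (x - y)" unfolding gauss_kernel_def[abs_def] using t by (intro continuous_intros) simp
        moreover have "(\<lambda>n. u (n + N) - y) \<longlonglongrightarrow> x - y" using LIMSEQ_ignore_initial_segment[OF lim, of N] by (intro tendsto_diff tendsto_const)
        ultimately show "(\<lambda>n. gauss_kernel t (u (n + N) - y) * f y) \<longlonglongrightarrow> gauss_kernel t (x - y) * f y"
          by (intro tendsto_mult tendsto_const isCont_tendsto_compose[of _ "gauss_kernel t"])
      qed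
      show "AE y in lborel. norm (gauss_kernel t (u (n + N) - y) * f y) \<le> C * gauss_kernel (2 * t) (x - y) * B" for n
      proof (rule AE_I2)
        fix y
        have "gauss_kernel t (u (n + N) - y) \<le> C * gauss_kernel (2 * t) (x - y)"
          using N[of "n + N"] by (intro C(2)) simp
        then show "norm (gauss_kernel t (u (n + N) - y) * f y) \<le> C * gauss_kernel (2 * t) (x - y) * B"
          using f[of y] C(1) by (simp add: abs_mult mult_mono)
      qed
    qed measurable
    then have "(\<lambda>n. conv (gauss_kernel t) f (u (n + N))) \<longlonglongrightarrow> conv (gauss_kernel t) f x"
      by (simp add: conv_lborel)
    then show ?thesis unfolding comp_def by (rule LIMSEQ_offset)
  qed
  then show ?thesis
    by (simp add: continuous_at_imp_continuous_on continuous_at_sequentially)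
qed

text \<open>\<open>h = C (1 + |u|) G_2(u)\<close> dominates the derivative of
  \<open>G_1(u - v)\<close> in \<open>v\<close> for \<open>|v| <= 1\<close>. Its bound
  \<open>H\<close> is used on a short interval around 0 and its first moment on the heights outside
  the window.\<close>

lemma gauss_kernel_1_difference:
  "\<exists>h. (\<forall>u. 0 \<le> h u) \<and> (\<exists>H. \<forall>u. h u \<le> H) \<and> integrable lborel h \<and> integrable lborel (\<lambda>u. \<bar>u\<bar> * h u) \<and>
     (\<forall>a b u. \<bar>a\<bar> \<le> 1 \<longrightarrow> \<bar>b\<bar> \<le> 1 \<longrightarrow> \<bar>gauss_kernel 1 (u - b) - gauss_kernel 1 (u - a)\<bar> \<le> \<bar>b - a\<bar> * h (u::real))"
proof -
  obtain C where C: "C \<ge> 0" "\<And>x x' y::real. norm (x' - x) \<le> 1 \<Longrightarrow> gauss_kernel 1 (x' - y) \<le> C * gauss_kernel 2 (x - y)"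
    using gauss_kernel_dominated[of 1, where 'a=real] by auto
  define h where "h u = C * ((1 + \<bar>u\<bar>) * gauss_kernel 2 u)" for u :: real
  have g2: "gauss_kernel 2 = normal_density 0 2" by (subst gauss_kernel_real) auto
  have h0: "0 \<le> h u" for u unfolding h_def using C by simp
  have m: "integrable lborel (\<lambda>u. gauss_kernel 2 u * \<bar>u\<bar> ^ k)" for k
    unfolding g2 using integrable_normal_moment_abs[of 2 0 k] by simp
  have i1: "integrable lborel h"
    using m[of 0] m[of 1] unfolding h_def by (simp add: distrib_right mult.commute)
  have "(\<lambda>u. \<bar>u\<bar> * h u) = (\<lambda>u. C * (gauss_kernel 2 u * \<bar>u\<bar> ^ 1) + C * (gauss_kernel 2 u * \<bar>u\<bar> ^ 2))"
    unfolding h_def by (auto simp: algebra_simps power2_eq_square)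
  then have i2: "integrable lborel (\<lambda>u. \<bar>u\<bar> * h u)" using m[of 1] m[of 2] by simp
  have "h u \<le> C * 8" for u
  proof -
    have "1 + \<bar>u\<bar> \<le> 8 * (1 + u\<^sup>2 / 8)"
    proof -
      have "0 \<le> (\<bar>u\<bar> - 1/2)\<^sup>2" by simp
      then show ?thesis unfolding power2_diff by (simp add: field_simps)
    qed
    also have "\<dots> \<le> 8 * exp (u\<^sup>2 / 8)" by (intro mult_left_mono exp_ge_add_one_self) simp
    finally have "(1 + \<bar>u\<bar>) * exp (- u\<^sup>2 / 8) \<le> 8 * exp (u\<^sup>2 / 8) * exp (- u\<^sup>2 / 8)" by (rule mult_right_mono) simp
    also have "\<dots> = 8" by (simp add: exp_minus)
    finally have 1: "(1 + \<bar>u\<bar>) * exp (- u\<^sup>2 / 8) \<le> 8" .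
    have "1 \<le> sqrt (8 * pi)" using pi_gt3 by (intro real_le_rsqrt) simp
    then have "(1 + \<bar>u\<bar>) * gauss_kernel 2 u \<le> (1 + \<bar>u\<bar>) * exp (- u\<^sup>2 / 8)"
      by (intro mult_left_mono) (auto simp: gauss_kernel_def powr_half_sqrt divide_le_eq mult_le_cancel_left1)
    with 1 show ?thesis unfolding h_def using C by (intro mult_left_mono) auto
  qed
  moreover have "\<bar>gauss_kernel 1 (u - b) - gauss_kernel 1 (u - a)\<bar> \<le> \<bar>b - a\<bar> * h u" if ab: "\<bar>a\<bar> \<le> 1" "\<bar>b\<bar> \<le> 1" for a b u
  proof -
    have d: "((\<lambda>v. gauss_kernel 1 (u - v)) has_real_derivative (u - v) / 2 * gauss_kernel 1 (u - v)) (at v)" for v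
    proof -
      have "((\<lambda>v. exp (- (u - v)\<^sup>2 / 4) / s) has_real_derivative (u - v) / 2 * (exp (- (u - v)\<^sup>2 / 4) / s)) (at v)"
        if "s > 0" for s
        using that by (auto intro!: derivative_eq_intros simp: field_simps)
      then show ?thesis unfolding gauss_kernel_1_real by simp
    qed
    have "\<bar>(u - v) / 2 * gauss_kernel 1 (u - v)\<bar> \<le> h u" if "\<bar>v\<bar> \<le> 1" for v
    proof -
      have "\<bar>(u - v) / 2\<bar> \<le> 1 + \<bar>u\<bar>" using that abs_triangle_ineq4[of u v] by simp
      moreover have "gauss_kernel 1 (u - v) \<le> C * gauss_kernel 2 u"
        using C(2)[of "-v" 0 "-u"] that by simp
      ultimately have "\<bar>(u - v) / 2\<bar> * gauss_kernel 1 (u - v) \<le> (1 + \<bar>u\<bar>) * (C * gauss_kernel 2 u)"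
        by (intro mult_mono) auto
      then show ?thesis by (simp add: h_def abs_mult mult_ac)
    qed
    note hb0 = this
    have hb: "norm ((u - v) / 2 * gauss_kernel 1 (u - v)) \<le> h u" if "v \<in> {-1..1}" for v
      unfolding real_norm_def by (rule hb0) (use that in \<open>simp add: abs_le_iff\<close>)
    have "norm (gauss_kernel 1 (u - b) - gauss_kernel 1 (u - a)) \<le> h u * norm (b - a)"
    proof (rule field_differentiable_bound[where S="{-1..1}"])
      show "((\<lambda>v. gauss_kernel 1 (u - v)) has_real_derivative (u - v) / 2 * gauss_kernel 1 (u - v)) (at v within {-1..1})" for v
        by (rule has_field_derivative_at_within[OF d])
    next
      show "a \<in> {-1..1}" "b \<in> {-1..1}" using ab by (auto simp: abs_le_iff)
    qed (use hb in \<open>auto simp only: convex_real_interval\<close>)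
    then show ?thesis by (simp add: mult.commute)
  qed
  ultimately show ?thesis using h0 i1 i2 by blast
qed

text \<open>Vertical slices of \<open>A e\<close> are not known to be half-lines, so monotonicity
  along the axis cannot be read off the set. Instead the shift is moved into the kernel, whose
  increment is at most \<open>|b - a| * h u\<close>, and the slice is compared with
  \<open>{..0}\<close>, whose mean is \<open>1/2 + gphi (- v)\<close>. They differ only where
  \<open>|u|\<close> is \<open>O(e)\<close> or exceeds \<open>\<rho> / e\<close>, which gives the
  factor \<open>e\<close>. An error proportional to \<open>|b - a|\<close> is what uniqueness needs;
  \<open>sandwich_mean\<close> only provides an absolute one.\<close>

lemma axis_difference:
  fixes A :: "real \<Rightarrow> ('a::euclidean_space \<times> real) set"
  assumes sand: "sandwich k \<rho> A q" and \<rho>: "\<rho> > 0" and k: "1 \<le> k" and Oq: "BO 1 q"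
    and mA: "\<And>e. 0 < e \<Longrightarrow> e < 1 \<Longrightarrow> A e \<in> sets borel"
  shows "\<exists>C\<ge>0. \<forall>e a b. 0 < e \<longrightarrow> e < 1 \<longrightarrow> \<bar>a\<bar> \<le> 1 \<longrightarrow> \<bar>b\<bar> \<le> 1 \<longrightarrow>
    \<bar>((\<integral>p. indicator (A e) ((0, b) + p) \<partial>gm) - (\<integral>p. indicator (A e) ((0, a) + p) \<partial>gm)) - (gphi (- b) - gphi (- a))\<bar>
      \<le> C * e * \<bar>b - a\<bar>"
proof -
  obtain C N where C: "C \<ge> 0" and s: "\<And>e x v. 0 < e \<Longrightarrow> e < 1 \<Longrightarrow> \<bar>v\<bar> \<le> \<rho> / e \<Longrightarrow>
     C * e ^ k * (1 + norm x) ^ N < \<bar>v - q e x\<bar> \<Longrightarrow> ((x, v) \<in> A e \<longleftrightarrow> v < q e x)"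
    using sand unfolding sandwich_def by blast
  obtain K M where K: "K \<ge> 0" and q: "\<And>e x. 0 < e \<Longrightarrow> e < 1 \<Longrightarrow> \<bar>q e x\<bar> \<le> K * e ^ 1 * (1 + norm x) ^ M"
    using Oq by (rule BOE) (rule that)
  obtain h H where h0: "\<And>u. 0 \<le> h u" and hH: "\<And>u. h u \<le> H" and ih: "integrable lborel h"
    and ih1: "integrable lborel (\<lambda>u. \<bar>u\<bar> * h u)"
    and hd: "\<And>a b u. \<bar>a\<bar> \<le> 1 \<Longrightarrow> \<bar>b\<bar> \<le> 1 \<Longrightarrow> \<bar>gauss_kernel 1 (u - b) - gauss_kernel 1 (u - a)\<bar> \<le> \<bar>b - a\<bar> * h (u::real)"
    using gauss_kernel_1_difference by blast
  have [measurable]: "h \<in> borel_measurable borel" using ih by auto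
  have H0: "0 \<le> H" using h0[of 0] hH[of 0] by linarith
  define R where "R y = K * (1 + norm y) ^ M + C * (1 + norm y) ^ N" for y :: 'a
  have R0: "0 \<le> R y" for y unfolding R_def using K C by simp
  have pR: "polyb R" unfolding R_def by simp
  define H1 where "H1 = (\<integral>u. \<bar>u\<bar> * h u \<partial>lborel)"
  have H10: "0 \<le> H1" unfolding H1_def using h0 by (intro integral_nonneg_AE) simp
  define D where "D = 2 * H * (\<integral>y. R y \<partial>gm) + H1 / \<rho>"
  have D0: "0 \<le> D" unfolding D_def using H0 R0 H10 \<rho> by (simp add: integral_nonneg_AE)
  have "\<bar>((\<integral>p. indicator (A e) ((0, b) + p) \<partial>gm) - (\<integral>p. indicator (A e) ((0, a) + p) \<partial>gm)) - (gphi (- b) - gphi (- a))\<bar>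
      \<le> D * e * \<bar>b - a\<bar>" if e: "0 < e" "e < 1" and ab: "\<bar>a\<bar> \<le> 1" "\<bar>b\<bar> \<le> 1" for e a b
  proof -
    have [measurable]: "A e \<in> sets (borel \<Otimes>\<^sub>M borel)" using mA[OF e] unfolding borel_prod .
    define I where "I v y = (\<integral>u. gauss_kernel 1 (u - v) * indicator (A e) (y, u) \<partial>lborel)" for v y
    have W: "(\<integral>p. indicator (A e) ((0, v) + p) \<partial>gm) = (\<integral>y. I v y \<partial>gm)" and iI: "integrable gm (I v)" for v
    proof -
      have "(\<lambda>p. (0, v) + p) \<in> borel_measurable (borel :: ('a \<times> real) measure)"
        by (intro borel_measurable_continuous_onI continuous_intros)
      then have mi: "(\<lambda>p. indicator (A e) ((0, v) + p) :: real) \<in> borel_measurable borel"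
        using mA[OF e] by measurable
      have p: "polyb (\<lambda>p. indicator (A e) ((0, v) + p) :: real)"
        by (rule polyb_bounded[OF mi, of 1]) simp
      have eq: "(\<integral>w. indicator (A e) ((0, v) + (y, w)) \<partial>gm) = I v y" for y
      proof -
        have "(\<integral>w. indicator (A e) ((0, v) + (y, w)) \<partial>gm) = (\<integral>w. gauss_kernel 1 w * indicator (A e) (y, v + w) \<partial>lborel)"
          by (subst integral_gm) simp_all
        also have "\<dots> = (\<integral>w. gauss_kernel 1 ((v + w) - v) * indicator (A e) (y, v + w) \<partial>lborel)" by simp
        also have "\<dots> = I v y"
          unfolding I_def by (rule integral_lborel_shift[where f="\<lambda>u. gauss_kernel 1 (u - v) * indicator (A e) (y, u)"]) measurable
        finally show ?thesis .
      qed
      show "(\<integral>p. indicator (A e) ((0, v) + p) \<partial>gm) = (\<integral>y. I v y \<partial>gm)"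
        unfolding gm_Fubini[OF polyb_integrable[OF p]] eq ..
      show "integrable gm (I v)"
        using polyb_integrable[OF polyb_integral[OF p]] unfolding eq by simp
    qed
    have J: "1 / 2 + gphi (- v) = (\<integral>u. gauss_kernel 1 (u - v) * indicator {..0} u \<partial>lborel)" for v
    proof -
      have "(\<integral>u. gauss_kernel 1 (u - v) * indicator {..0} u \<partial>lborel) = (\<integral>w. gauss_kernel 1 ((v + w) - v) * indicator {..0} (v + w) \<partial>lborel)"
        by (rule integral_lborel_shift[where f="\<lambda>u. gauss_kernel 1 (u - v) * indicator {..0} u", symmetric]) measurable
      also have "\<dots> = (\<integral>w. gauss_kernel 1 w * indicator {..- v} w \<partial>lborel)"
        by (intro Bochner_Integration.integral_cong) (auto simp: indicator_def)
      also have "\<dots> = measure gm {..- v}" by (rule measure_gm_eq_integral[symmetric]) simp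
      finally show ?thesis by (simp add: gphi_def)
    qed
    have iG: "integrable lborel (\<lambda>u. gauss_kernel 1 (u - v) * indicator S u)" if "S \<in> sets borel" for v and S :: "real set"
      using integrable_mult_indicator[OF _ integrable_gauss_kernel_shift[of 1 v], of S] that by (simp add: mult.commute)
    have sl: "{u. (y, u) \<in> A e} \<in> sets borel" for y
    proof -
      have "Measurable.pred borel (\<lambda>u. (y, u) \<in> A e)" by measurable
      then show ?thesis by (simp add: pred_def)
    qed
    have ind: "indicator (A e) (y, u) = indicator {u. (y, u) \<in> A e} u" for y u by (simp add: indicator_def)
    have bound: "\<bar>(I b y - I a y) - (gphi (- b) - gphi (- a))\<bar> \<le> \<bar>b - a\<bar> * (e * (2 * H * R y + H1 / \<rho>))" for y
    proof -
      let ?S = "{u. (y, u) \<in> A e}"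
      let ?f = "\<lambda>u. (gauss_kernel 1 (u - b) - gauss_kernel 1 (u - a)) * (indicator ?S u - indicator {..0} u)"
      have "(I b y - I a y) - (gphi (- b) - gphi (- a)) = (I b y - I a y) - ((1 / 2 + gphi (- b)) - (1 / 2 + gphi (- a)))"
        by simp
      also have "\<dots> = (\<integral>u. (gauss_kernel 1 (u - b) * indicator ?S u - gauss_kernel 1 (u - a) * indicator ?S u)
           - (gauss_kernel 1 (u - b) * indicator {..0} u - gauss_kernel 1 (u - a) * indicator {..0} u) \<partial>lborel)"
        unfolding J I_def ind by (simp add: iG sl)
      also have "\<dots> = (\<integral>u. ?f u \<partial>lborel)" by (intro Bochner_Integration.integral_cong) (auto simp: algebra_simps)
      finally have eq: "(I b y - I a y) - (gphi (- b) - gphi (- a)) = (\<integral>u. ?f u \<partial>lborel)" .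
      have "\<bar>\<integral>u. ?f u \<partial>lborel\<bar> \<le> (\<integral>u. \<bar>?f u\<bar> \<partial>lborel)" by (rule integral_abs_bound)
      also have "\<dots> \<le> (\<integral>u. \<bar>b - a\<bar> * (H * indicator {- (e * R y)..e * R y} u + e / \<rho> * (\<bar>u\<bar> * h u)) \<partial>lborel)"
      proof (rule integral_mono')
        show "integrable lborel (\<lambda>u. \<bar>b - a\<bar> * (H * indicator {- (e * R y)..e * R y} u + e / \<rho> * (\<bar>u\<bar> * h u)))"
          using ih1 by (intro integrable_mult_right Bochner_Integration.integrable_add integrable_real_indicator) (simp_all add: emeasure_lborel_Icc_eq)
        fix u
        have pos: "0 \<le> e / \<rho> * (\<bar>u\<bar> * h u)" using e \<rho> h0 by simp
        show "0 \<le> \<bar>b - a\<bar> * (H * indicator {- (e * R y)..e * R y} u + e / \<rho> * (\<bar>u\<bar> * h u))"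
          using pos H0 by (simp add: indicator_def)
        have "\<bar>?f u\<bar> \<le> (\<bar>b - a\<bar> * h u) * \<bar>indicator ?S u - indicator {..0} u\<bar>"
          unfolding abs_mult by (intro mult_right_mono hd ab) simp
        also have "\<dots> = \<bar>b - a\<bar> * (h u * \<bar>indicator ?S u - indicator {..0} u\<bar>)" by simp
        also have "\<dots> \<le> \<bar>b - a\<bar> * (H * indicator {- (e * R y)..e * R y} u + e / \<rho> * (\<bar>u\<bar> * h u))"
        proof (rule mult_left_mono)
          have i1: "\<bar>indicator ?S u - indicator {..0} u\<bar> \<le> (1::real)" by (auto simp: indicator_def)
          \<comment> \<open>Three ranges of the height: near 0, where \<open>h\<close> is at most
            \<open>H\<close> and the interval has length \<open>O(e)\<close>; the middle, where
            \<open>|q e y| < |u|\<close> makes the slice agree with \<open>{..0}\<close>; and beyond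
            the window, where \<open>1 <= e * |u| / \<rho>\<close> brings in the first moment of
            \<open>h\<close>.\<close>
          show "h u * \<bar>indicator ?S u - indicator {..0} u\<bar> \<le> H * indicator {- (e * R y)..e * R y} u + e / \<rho> * (\<bar>u\<bar> * h u)"
          proof (cases "\<bar>u\<bar> \<le> e * R y")
            case True
            then have "indicator {- (e * R y)..e * R y} u = (1::real)" by (auto simp: indicator_def)
            moreover have "h u * \<bar>indicator ?S u - indicator {..0} u\<bar> \<le> h u" using i1 h0 by (intro mult_left_le) auto
            ultimately show ?thesis using hH[of u] pos by simp
          next
            case out: False
            show ?thesis
            proof (cases "\<bar>u\<bar> \<le> \<rho> / e")
              case True
              have "C * e ^ k \<le> C * e ^ 1" using C e k by (intro mult_left_mono power_decreasing) auto
              then have "C * e ^ k * (1 + norm y) ^ N \<le> C * e * (1 + norm y) ^ N" by (intro mult_right_mono) auto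
              moreover have "e * R y = K * e ^ 1 * (1 + norm y) ^ M + C * e * (1 + norm y) ^ N"
                by (simp add: R_def algebra_simps)
              ultimately have "C * e ^ k * (1 + norm y) ^ N < \<bar>u\<bar> - \<bar>q e y\<bar>" using out q[OF e, of y] by linarith
              moreover have "0 \<le> C * e ^ k * (1 + norm y) ^ N" using C e by simp
              ultimately have "((y, u) \<in> A e \<longleftrightarrow> u < q e y)" "\<bar>q e y\<bar> < \<bar>u\<bar>" using s[OF e True, of y] by linarith+
              then have "(y, u) \<in> A e \<longleftrightarrow> u \<le> 0" by auto
              then have "indicator ?S u = (indicator {..0} u :: real)" by (auto simp: indicator_def)
              then show ?thesis using pos H0 by (simp add: indicator_def)
            next
              case False
              then have "1 \<le> e / \<rho> * \<bar>u\<bar>" using e \<rho> by (simp add: field_simps)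
              then have "h u * 1 \<le> h u * (e / \<rho> * \<bar>u\<bar>)" using h0 by (intro mult_left_mono) auto
              moreover have "h u * \<bar>indicator ?S u - indicator {..0} u\<bar> \<le> h u * 1" using i1 h0 by (intro mult_left_mono) auto
              moreover have "0 \<le> H * indicator {- (e * R y)..e * R y} u" using H0 by simp
              ultimately show ?thesis by (simp add: mult_ac)
            qed
          qed
        qed simp
        finally show "\<bar>?f u\<bar> \<le> \<bar>b - a\<bar> * (H * indicator {- (e * R y)..e * R y} u + e / \<rho> * (\<bar>u\<bar> * h u))" .
      qed
      also have "\<dots> = \<bar>b - a\<bar> * (H * (2 * (e * R y)) + e / \<rho> * H1)"
        using ih1 e R0[of y] by (simp add: H1_def integrable_real_indicator emeasure_lborel_Icc_eq)
      also have "\<dots> = \<bar>b - a\<bar> * (e * (2 * H * R y + H1 / \<rho>))" by (simp add: algebra_simps)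
      finally show ?thesis unfolding eq .
    qed
    have iR: "integrable gm (\<lambda>y. \<bar>b - a\<bar> * (e * (2 * H * R y + H1 / \<rho>)))"
      using pR by (intro polyb_integrable) simp
    have "((\<integral>y. I b y \<partial>gm) - (\<integral>y. I a y \<partial>gm)) - (gphi (- b) - gphi (- a)) = (\<integral>y. (I b y - I a y) - (gphi (- b) - gphi (- a)) \<partial>gm)"
      using iI by simp
    then have "\<bar>((\<integral>y. I b y \<partial>gm) - (\<integral>y. I a y \<partial>gm)) - (gphi (- b) - gphi (- a))\<bar>
       \<le> (\<integral>y. \<bar>(I b y - I a y) - (gphi (- b) - gphi (- a))\<bar> \<partial>gm)"
      using integral_abs_bound[of gm "\<lambda>y. (I b y - I a y) - (gphi (- b) - gphi (- a))"] by simp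
    also have "\<dots> \<le> (\<integral>y. \<bar>b - a\<bar> * (e * (2 * H * R y + H1 / \<rho>)) \<partial>gm)"
      by (rule integral_mono'[OF iR bound]) (use e H0 R0 H10 \<rho> in simp)
    also have "\<dots> = D * e * \<bar>b - a\<bar>"
      using polyb_integrable[OF pR] by (simp add: D_def)
    finally show ?thesis unfolding W .
  qed
  with D0 show ?thesis by blast
qed

lemma gphi_diff_lower:
  assumes "- 1 \<le> a" "a \<le> b" "b \<le> 1"
  shows "(b - a) / 8 \<le> gphi b - gphi a"
proof -
  have "(\<integral>w. (1/8) * indicator {a..b} w \<partial>lborel) \<le> measure gm {a..b}"
    unfolding measure_gm_eq_integral[OF atLeastAtMost_borel]
  proof (rule integral_mono)
    show "integrable lborel (\<lambda>w. (1/8) * indicator {a..b} w :: real)"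
      by (intro integrable_mult_right integrable_real_indicator) (simp_all add: emeasure_lborel_Icc_eq)
    show "(1/8) * indicator {a..b} w \<le> gauss_kernel 1 w * indicator {a..b} w" for w :: real
      using gauss_kernel_1_real_ge[of w] assms by (auto split: split_indicator)
  qed (simp add: integrable_gauss_kernel_indicator)
  also have "measure gm {a..b} = measure gm ({a} \<union> {a<..b})" using assms by (intro arg_cong[where f="measure gm"]) auto
  also have "\<dots> = measure gm {a} + measure gm {a<..b}" by (intro gm.finite_measure_Union) auto
  finally show ?thesis using assms gphi_diff[of a b] by simp
qed

text \<open>The sign change across the strip, from \<open>stage_expansion\<close>, and continuity
  give a crossing, and any crossing in the window lies within \<open>C * e ^ k\<close> of the
  profile. For uniqueness the increments of \<open>W e\<close> are compared with those of
  \<open>gphi (- v)\<close>, which decreases on \<open>[-1, 1]\<close> at rate at least 1/8; the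
  relative error \<open>E * e\<close> is smaller once \<open>e\<close> is small. The inequality
  above \<open>v\<close> serves to identify the crossing as a frontier point.\<close>

lemma stage_crossing:
  fixes A :: "'i \<Rightarrow> real \<Rightarrow> ('a::euclidean_space \<times> real) set"
  assumes fin: "finite I" and c1: "(\<Sum>i\<in>I. c i) = 1" and \<rho>: "\<rho> > 0" and k: "1 \<le> k" "k \<le> 5"
    and sand: "\<And>i. i \<in> I \<Longrightarrow> sandwich k \<rho> (A i) (q i)"
    and mA: "\<And>i e. i \<in> I \<Longrightarrow> 0 < e \<Longrightarrow> e < 1 \<Longrightarrow> A i e \<in> sets borel"
    and mq: "\<And>i e. i \<in> I \<Longrightarrow> 0 < e \<Longrightarrow> e < 1 \<Longrightarrow> q i e \<in> borel_measurable borel"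
    and Oq: "\<And>i. i \<in> I \<Longrightarrow> BO 1 (q i)" and Oq': "BO 1 q'"
    and res: "BO k (\<lambda>e x. \<Sum>i\<in>I. c i * (\<integral>y. (q i e (x + y) - q' e x) - (q i e (x + y) - q' e x) ^ 3 / 12 \<partial>gm))"
    and W: "\<And>e v. W e v = (\<Sum>i\<in>I. c i * (\<integral>p. indicator (A i e) ((0, v) + p) \<partial>gm))"
    and cont: "\<And>e. 0 < e \<Longrightarrow> e < 1 \<Longrightarrow> continuous_on UNIV (W e)"
  shows "\<exists>e1>0. \<exists>C. \<forall>e. 0 < e \<longrightarrow> e < e1 \<longrightarrow>
    (\<exists>v. \<bar>v - q' e 0\<bar> \<le> C * e ^ k \<and> \<bar>v\<bar> < min 1 (\<rho> / 2 / e) \<and> W e v = 1 / 2 \<and>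
      (\<forall>u. \<bar>u\<bar> \<le> \<rho> / 2 / e \<longrightarrow> W e u = 1 / 2 \<longrightarrow> u = v) \<and> (\<forall>u. v < u \<longrightarrow> u \<le> 1 \<longrightarrow> W e u < 1 / 2))"
proof -
  obtain C N where C: "C \<ge> 0" and sg: "\<And>e x v. 0 < e \<Longrightarrow> e < 1 \<Longrightarrow> \<bar>v\<bar> \<le> \<rho> / 2 / e \<Longrightarrow>
     C * e ^ k * (1 + norm x) ^ N < \<bar>v - q' e x\<bar> \<Longrightarrow>
     (v < q' e x \<longrightarrow> 1 / 2 < (\<Sum>i\<in>I. c i * (\<integral>p. indicator (A i e) ((x, v) + p) \<partial>gm))) \<and>
     (q' e x < v \<longrightarrow> (\<Sum>i\<in>I. c i * (\<integral>p. indicator (A i e) ((x, v) + p) \<partial>gm)) < 1 / 2)"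
    using stage_expansion[OF fin c1 \<rho> k sand mA mq Oq Oq' res] by blast
  have sgn: "(v < q' e 0 \<longrightarrow> 1 / 2 < W e v) \<and> (q' e 0 < v \<longrightarrow> W e v < 1 / 2)"
    if "0 < e" "e < 1" "\<bar>v\<bar> \<le> \<rho> / 2 / e" "C * e ^ k < \<bar>v - q' e 0\<bar>" for e v
    unfolding W using sg[of e v 0] that by simp
  have "\<forall>i\<in>I. \<exists>D\<ge>0. \<forall>e a b. 0 < e \<longrightarrow> e < 1 \<longrightarrow> \<bar>a\<bar> \<le> 1 \<longrightarrow> \<bar>b\<bar> \<le> 1 \<longrightarrow>
    \<bar>((\<integral>p. indicator (A i e) ((0, b) + p) \<partial>gm) - (\<integral>p. indicator (A i e) ((0, a) + p) \<partial>gm)) - (gphi (- b) - gphi (- a))\<bar>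
      \<le> D * e * \<bar>b - a\<bar>"
    using axis_difference[OF sand \<rho> k(1) Oq mA] by blast
  then obtain D where D0: "\<And>i. i \<in> I \<Longrightarrow> 0 \<le> D i" and D: "\<And>i e a b. i \<in> I \<Longrightarrow> 0 < e \<Longrightarrow> e < 1 \<Longrightarrow> \<bar>a\<bar> \<le> 1 \<Longrightarrow> \<bar>b\<bar> \<le> 1 \<Longrightarrow>
    \<bar>((\<integral>p. indicator (A i e) ((0, b) + p) \<partial>gm) - (\<integral>p. indicator (A i e) ((0, a) + p) \<partial>gm)) - (gphi (- b) - gphi (- a))\<bar>
      \<le> D i * e * \<bar>b - a\<bar>"
    by metis
  define E where "E = (\<Sum>i\<in>I. \<bar>c i\<bar> * D i)"
  have E0: "0 \<le> E" unfolding E_def using D0 by (intro sum_nonneg) simp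
  have mono: "W e b < W e a" if e: "0 < e" "e < 1" "e * (8 * (E + 1)) \<le> 1" and ab: "- 1 \<le> a" "a < b" "b \<le> 1" for e a b
  proof -
    have ab': "\<bar>a\<bar> \<le> 1" "\<bar>b\<bar> \<le> 1" using ab by auto
    have "\<bar>(\<Sum>i\<in>I. c i * ((\<integral>p. indicator (A i e) ((0, b) + p) \<partial>gm) - (\<integral>p. indicator (A i e) ((0, a) + p) \<partial>gm)))
       - (\<Sum>i\<in>I. c i * (gphi (- b) - gphi (- a)))\<bar> \<le> (\<Sum>i\<in>I. \<bar>c i\<bar> * (D i * e * \<bar>b - a\<bar>))"
      by (intro sum_mult_diff_bound D e ab')
    also have "\<dots> = E * e * (b - a)" unfolding E_def using ab by (simp add: sum_distrib_right mult.assoc)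
    also have "(\<Sum>i\<in>I. c i * (gphi (- b) - gphi (- a))) = gphi (- b) - gphi (- a)"
      by (simp add: sum_distrib_right[symmetric] c1)
    also have "(\<Sum>i\<in>I. c i * ((\<integral>p. indicator (A i e) ((0, b) + p) \<partial>gm) - (\<integral>p. indicator (A i e) ((0, a) + p) \<partial>gm))) = W e b - W e a"
      by (simp add: W right_diff_distrib sum_subtractf)
    finally have 1: "\<bar>(W e b - W e a) - (gphi (- b) - gphi (- a))\<bar> \<le> E * e * (b - a)" .
    have 2: "(b - a) / 8 \<le> gphi (- a) - gphi (- b)" using gphi_diff_lower[of "- b" "- a"] ab by simp
    have "8 * (E * e) < 1" using e E0 by (simp add: algebra_simps)
    then have "(8 * (E * e)) * (b - a) < 1 * (b - a)" using ab by (intro mult_strict_right_mono) auto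
    then have "E * e * (b - a) < (b - a) / 8" by simp
    with 1 2 show ?thesis by linarith
  qed
  obtain K M where K: "K \<ge> 0" "\<And>e x. 0 < e \<Longrightarrow> e < 1 \<Longrightarrow> \<bar>q' e x\<bar> \<le> K * e ^ 1 * (1 + norm x) ^ M"
    using Oq' by (rule BOE) (rule that)
  \<comment> \<open>\<open>T\<close> exceeds the constant of the monotonicity condition and those
    that keep the endpoints \<open>a\<close>, \<open>b\<close> below 1 and below
    \<open>\<rho> / 2 / e\<close>, so that \<open>e < 1 / (2 * T)\<close> serves all of
    them.\<close>
  define T where "T = 1 + 8 * (E + 1) + (K + C + 2) + (K + C + 2) * 2 / \<rho>"
  have T: "1 \<le> T" "8 * (E + 1) \<le> T" "K + C + 2 \<le> T" "(K + C + 2) * 2 / \<rho> \<le> T"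
    using E0 K C \<rho> unfolding T_def by (simp_all add: divide_nonneg_pos)
  have "\<exists>v. \<bar>v - q' e 0\<bar> \<le> C * e ^ k \<and> \<bar>v\<bar> < min 1 (\<rho> / 2 / e) \<and> W e v = 1 / 2 \<and>
      (\<forall>u. \<bar>u\<bar> \<le> \<rho> / 2 / e \<longrightarrow> W e u = 1 / 2 \<longrightarrow> u = v) \<and> (\<forall>u. v < u \<longrightarrow> u \<le> 1 \<longrightarrow> W e u < 1 / 2)"
    if e: "0 < e" "e < 1 / (2 * T)" for e
  proof -
    have eT: "e * T < 1 / 2" using e T by (simp add: field_simps)
    have e1: "e < 1" proof -
      have "e * 1 \<le> e * T" using T e by (intro mult_left_mono) auto
      then show ?thesis using eT by linarith
    qed
    have eX: "e * X \<le> 1 / 2" if "X \<le> T" for X using mult_left_mono[OF that, of e] e eT by linarith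
    have e8: "e * (8 * (E + 1)) \<le> 1" using eX[OF T(2)] by linarith
    have ek: "e ^ k \<le> e" using power_decreasing[of 1 k e] k e e1 by simp
    define a b where "a = q' e 0 - (C + 1) * e ^ k" and "b = q' e 0 + (C + 1) * e ^ k"
    have q0: "\<bar>q' e 0\<bar> \<le> K * e" using K(2)[OF e(1) e1, of 0] by simp
    have Ce: "(C + 1) * e ^ k \<le> (C + 1) * e" using ek C by (intro mult_left_mono) auto
    have Ce0: "C * e ^ k < (C + 1) * e ^ k" "0 \<le> C * e ^ k" using e C by simp_all
    have small: "\<bar>w\<bar> < min 1 (\<rho> / 2 / e)" if "\<bar>w\<bar> \<le> (K + C + 1) * e" for w
    proof -
      have 1: "(K + C + 1) * e < (K + C + 2) * e" using e by simp
      have 2: "(K + C + 2) * e \<le> 1 / 2" using eX[OF T(3)] by (simp add: mult.commute)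
      have "e * ((K + C + 2) * 2 / \<rho>) \<le> 1" using eX[OF T(4)] by linarith
      then have "(K + C + 2) * e \<le> \<rho> / 2" using \<rho> by (simp add: field_simps)
      also have "\<rho> / 2 \<le> \<rho> / 2 / e" using e e1 \<rho> by (simp add: field_simps)
      finally show ?thesis using that 1 2 by linarith
    qed
    have ab: "\<bar>a\<bar> \<le> (K + C + 1) * e" "\<bar>b\<bar> \<le> (K + C + 1) * e"
      using q0 Ce Ce0 unfolding a_def b_def distrib_right by linarith+
    have le: "a \<le> b" unfolding a_def b_def using Ce0 by linarith
    have "C * e ^ k < \<bar>a - q' e 0\<bar>" "C * e ^ k < \<bar>b - q' e 0\<bar>" "a < q' e 0" "q' e 0 < b"
      unfolding a_def b_def using Ce0 by linarith+
    then have Wab: "1 / 2 < W e a" "W e b < 1 / 2"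
      using sgn[OF e(1) e1, of a] sgn[OF e(1) e1, of b] small[OF ab(1)] small[OF ab(2)] by auto
    have "\<exists>v\<ge>a. v \<le> b \<and> W e v = 1 / 2"
      using Wab le by (intro IVT2'[of "W e"] continuous_on_subset[OF cont[OF e(1) e1]]) auto
    then obtain v where v: "a \<le> v" "v \<le> b" "W e v = 1 / 2" by blast
    have vs: "\<bar>v\<bar> < min 1 (\<rho> / 2 / e)" using v ab by (intro small) linarith
    have near: "\<bar>u - q' e 0\<bar> \<le> C * e ^ k" if "\<bar>u\<bar> \<le> \<rho> / 2 / e" "W e u = 1 / 2" for u
    proof (rule ccontr)
      assume "\<not> ?thesis"
      with sgn[OF e(1) e1 that(1)] that(2) Ce0 show False by (cases "u < q' e 0") auto
    qed
    have uniq: "u = v" if "\<bar>u\<bar> \<le> \<rho> / 2 / e" "W e u = 1 / 2" for u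
    proof -
      have "\<bar>u\<bar> \<le> (K + C + 1) * e"
        using near[OF that] q0 Ce Ce0 unfolding distrib_right by linarith
      then have "\<bar>u\<bar> < 1" using small by auto
      then show ?thesis using mono[OF e(1) e1 e8, of u v] mono[OF e(1) e1 e8, of v u] vs that(2) v(3)
        by (cases u v rule: linorder_cases) (auto simp: abs_less_iff)
    qed
    have "W e u < 1 / 2" if "v < u" "u \<le> 1" for u
    proof -
      have "- 1 \<le> v" using vs by (simp add: abs_less_iff)
      then show ?thesis using mono[OF e(1) e1 e8 _ that] v(3) by simp
    qed
    moreover have "\<bar>v - q' e 0\<bar> \<le> C * e ^ k" using vs by (intro near v(3)) simp
    ultimately show ?thesis using vs v(3) uniq by blast
  qed
  then show ?thesis using T by (intro exI[of _ "1 / (2 * T)"] conjI exI[of _ C]) auto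
qed

text \<open>Continuity puts the frontier inside the level set, but a level point may be interior to
  the superlevel set when \<open>U\<close> only touches the level from above. Values below 1/2
  immediately above \<open>z\<close> exclude this.\<close>

lemma frontier_superlevel_axis:
  fixes U :: "'a::real_normed_vector \<times> real \<Rightarrow> real"
  assumes cont: "continuous_on UNIV U"
    and z: "\<bar>z\<bar> < r" "U (0, z) = 1 / 2"
    and uniq: "\<And>s. \<bar>s\<bar> < r \<Longrightarrow> U (0, s) = 1 / 2 \<Longrightarrow> s = z"
    and above: "z < d" "\<And>s. z < s \<Longrightarrow> s < d \<Longrightarrow> U (0, s) < 1 / 2"
  shows "{s. \<bar>s\<bar> < r \<and> (0, s) \<in> frontier {p. 1 / 2 \<le> U p}} = {z}"
proof -
  have cl: "closed {p. 1 / 2 \<le> U p}"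
    using closed_Collect_le[OF continuous_on_const cont] .
  have op: "open {p. 1 / 2 < U p}"
    using open_Collect_less[OF continuous_on_const cont] .
  have sub: "p \<in> frontier {p. 1 / 2 \<le> U p} \<Longrightarrow> U p = 1 / 2" for p
  proof -
    assume p: "p \<in> frontier {p. 1 / 2 \<le> U p}"
    have "1 / 2 \<le> U p" using p cl by (auto simp: frontier_def closure_closed)
    moreover have "{p. 1 / 2 < U p} \<subseteq> interior {p. 1 / 2 \<le> U p}"
      by (rule interior_maximal[OF _ op]) auto
    moreover have "p \<notin> interior {p. 1 / 2 \<le> U p}" using p by (simp add: frontier_def)
    ultimately show "U p = 1 / 2" by force
  qed
  have "(0, z) \<notin> interior {p. 1 / 2 \<le> U p}"
  proof
    assume "(0, z) \<in> interior {p. 1 / 2 \<le> U p}"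
    then obtain \<epsilon> where \<epsilon>: "\<epsilon> > 0" "ball (0, z) \<epsilon> \<subseteq> {p. 1 / 2 \<le> U p}"
      by (auto simp: mem_interior)
    define s where "s = z + min \<epsilon> (d - z) / 2"
    have s: "z < s" "s < d" "\<bar>s - z\<bar> < \<epsilon>" using \<epsilon>(1) above(1) unfolding s_def by (auto simp: field_simps)
    have "(0, s) \<in> ball (0, z) \<epsilon>" using s(3) by (simp add: dist_Pair_Pair dist_real_def abs_minus_commute)
    then show False using \<epsilon>(2) above(2)[OF s(1,2)] by fastforce
  qed
  moreover have "(0, z) \<in> closure {p. 1 / 2 \<le> U p}" using z by (intro closure_subset[THEN subsetD]) simp
  ultimately have "(0, z) \<in> frontier {p. 1 / 2 \<le> U p}" by (simp add: frontier_def)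
  then show ?thesis using z(1) sub uniq by blast
qed

section \<open>Smooth functions on the closed half-space\<close>

definition halfspace :: "((real^'n) \<times> real) set" where
  "halfspace = UNIV \<times> {0..}"

text \<open>Directional derivatives within the closed half-space, one-sided in time at
  \<open>t = 0\<close>. A single operator for space and time directions lets one symmetry lemma
  exchange them.\<close>

definition Dv :: "(real^'n) \<times> real \<Rightarrow> ((real^'n) \<times> real \<Rightarrow> real) \<Rightarrow> (real^'n) \<times> real \<Rightarrow> real" where
  "Dv v f p = frechet_derivative f (at p within halfspace) v"

abbreviation Dx :: "'n::finite \<Rightarrow> ((real^'n) \<times> real \<Rightarrow> real) \<Rightarrow> (real^'n) \<times> real \<Rightarrow> real" where
  "Dx i \<equiv> Dv (axis i 1, 0)"

abbreviation Dt :: "((real^'n::finite) \<times> real \<Rightarrow> real) \<Rightarrow> (real^'n) \<times> real \<Rightarrow> real" where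
  "Dt \<equiv> Dv (0, 1)"

lemma halfspace_iff [simp]: "(x, t) \<in> halfspace \<longleftrightarrow> 0 \<le> t"
  by (simp add: halfspace_def)

text \<open>Every basis vector has a nonnegative time component, so short steps along it stay in the
  half-space even from a boundary point; this determines the derivative.\<close>

lemma has_derivative_unique_halfspace:
  assumes "(f has_derivative f') (at p within halfspace)" "(f has_derivative f'') (at p within halfspace)"
    and p: "p \<in> halfspace"
  shows "f' = f''"
proof (rule frechet_derivative_unique_within[OF assms(1,2)])
  fix i :: "(real^'a) \<times> real" and e :: real
  assume i: "i \<in> Basis" and e: "0 < e"
  have "0 \<le> snd i" using i by (auto simp: Basis_prod_def)
  then have "p + (e / 2) *\<^sub>R i \<in> halfspace" using p e by (cases p; cases i) (auto simp: halfspace_def)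
  then show "\<exists>d. 0 < \<bar>d\<bar> \<and> \<bar>d\<bar> < e \<and> p + d *\<^sub>R i \<in> halfspace"
    using e by (intro exI[of _ "e / 2"]) auto
qed

lemma Ck_on_cong:
  assumes "Ck_on k S f" "\<And>x. x \<in> S \<Longrightarrow> g x = f x"
  shows "Ck_on k S g"
proof (cases k)
  case 0
  then show ?thesis using assms continuous_on_cong[of S S g f] by simp
next
  case (Suc l)
  then show ?thesis using assms has_derivative_transform[of _ S g f] unfolding Suc Ck_on.simps by blast
qed

lemma smooth_has_derivative:
  assumes "smooth_on halfspace f" "p \<in> halfspace"
  shows "(f has_derivative (\<lambda>v. Dv v f p)) (at p within halfspace)"
proof -
  have "Ck_on (Suc 0) halfspace f" using assms(1) unfolding smooth_on_def by blast
  then have "f differentiable (at p within halfspace)" using assms(2) unfolding differentiable_def by auto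
  then show ?thesis unfolding Dv_def by (simp add: frechet_derivative_works)
qed

lemma smooth_Dv: 
  assumes f: "smooth_on halfspace f"
  shows "smooth_on halfspace (Dv v f)"
  unfolding smooth_on_def
proof
  fix k
  have "Ck_on (Suc k) halfspace f" using f unfolding smooth_on_def by blast
  then obtain f' where f': "\<And>x. x \<in> halfspace \<Longrightarrow> (f has_derivative f' x) (at x within halfspace)"
    and k: "\<And>v. Ck_on k halfspace (\<lambda>x. f' x v)" by auto
  show "Ck_on k halfspace (Dv v f)"
  proof (rule Ck_on_cong[OF k])
    fix x assume x: "x \<in> (halfspace :: ((real^'a) \<times> real) set)"
    show "Dv v f x = f' x v"
      using has_derivative_unique_halfspace[OF smooth_has_derivative[OF f x] f'[OF x] x] by metis
  qed
qed

lemma smooth_continuous: "smooth_on halfspace f \<Longrightarrow> continuous_on halfspace f"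
  unfolding smooth_on_def using Ck_on.simps(1) by blast

lemma Dv_cong:
  assumes "\<And>x. x \<in> halfspace \<Longrightarrow> f x = g x" "p \<in> halfspace"
  shows "Dv v f p = Dv v g p"
proof -
  have "(f has_derivative D) (at p within halfspace) \<longleftrightarrow> (g has_derivative D) (at p within halfspace)" for D
    using has_derivative_transform[of p halfspace g f D] has_derivative_transform[of p halfspace f g D] assms by auto
  then show ?thesis unfolding Dv_def frechet_derivative_def by simp
qed

lemma Dv_line:
  assumes f: "smooth_on halfspace f" and s: "s \<in> S" and S: "\<And>s. s \<in> S \<Longrightarrow> p + s *\<^sub>R v \<in> halfspace"
  shows "((\<lambda>s. f (p + s *\<^sub>R v)) has_real_derivative Dv v f (p + s *\<^sub>R v)) (at s within S)"
proof -
  let ?g = "\<lambda>s::real. p + s *\<^sub>R v"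
  have d: "(f has_derivative (\<lambda>u. Dv u f (?g s))) (at (?g s) within halfspace)"
    by (rule smooth_has_derivative[OF f S[OF s]])
  have g: "(?g has_derivative (\<lambda>r. r *\<^sub>R v)) (at s within S)"
    by (auto intro!: derivative_eq_intros)
  have "((\<lambda>s. f (?g s)) has_derivative (\<lambda>r. Dv (r *\<^sub>R v) f (?g s))) (at s within S)"
    by (rule has_derivative_in_compose[OF g]) (rule has_derivative_subset[OF d], use S in auto)
  moreover have "Dv (r *\<^sub>R v) f (?g s) = r *\<^sub>R Dv v f (?g s)" for r
    using linear_cmul[OF has_derivative_linear[OF d]] by blast
  ultimately show ?thesis unfolding has_field_derivative_def by (simp add: mult_commute_abs)
qed

text \<open>Two mean value representations of the second difference; this also covers boundary points.\<close>

lemma Dv_commute: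
  assumes f: "smooth_on halfspace f" and p: "p \<in> halfspace"
    and cone: "\<And>s r. 0 \<le> s \<Longrightarrow> 0 \<le> r \<Longrightarrow> p + s *\<^sub>R v + r *\<^sub>R w \<in> halfspace"
  shows "Dv w (Dv v f) p = Dv v (Dv w f) p"
proof -
  have rep: "\<exists>s r. 0 \<le> s \<and> s \<le> h \<and> 0 \<le> r \<and> r \<le> h \<and>
      f (p + h *\<^sub>R v + h *\<^sub>R w) - f (p + h *\<^sub>R v) - f (p + h *\<^sub>R w) + f p = h * h * Dv w (Dv v f) (p + s *\<^sub>R v + r *\<^sub>R w)"
    if h: "0 < h" and cone: "\<And>s r. 0 \<le> s \<Longrightarrow> 0 \<le> r \<Longrightarrow> p + s *\<^sub>R v + r *\<^sub>R w \<in> halfspace" for h v w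
  proof -
    have c1: "p + s *\<^sub>R v \<in> halfspace" if "0 \<le> s" for s using cone[OF that, of 0] by simp
    have c2: "(p + h *\<^sub>R w) + s *\<^sub>R v \<in> halfspace" if "0 \<le> s" for s using cone[OF that, of h] h by (simp add: ac_simps)
    define \<phi> where "\<phi> s = f ((p + h *\<^sub>R w) + s *\<^sub>R v) - f (p + s *\<^sub>R v)" for s
    have "\<exists>s\<in>{0..h}. \<phi> h - \<phi> 0 = (h - 0) * (Dv v f ((p + h *\<^sub>R w) + s *\<^sub>R v) - Dv v f (p + s *\<^sub>R v))"
    proof (rule mvt_very_simple[of 0 h \<phi> "\<lambda>s u. u * (Dv v f ((p + h *\<^sub>R w) + s *\<^sub>R v) - Dv v f (p + s *\<^sub>R v))"])
      show "0 \<le> h" using h by simp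
      fix s assume s: "0 \<le> s" "s \<le> h"
      have "(\<phi> has_real_derivative (Dv v f ((p + h *\<^sub>R w) + s *\<^sub>R v) - Dv v f (p + s *\<^sub>R v))) (at s within {0..h})"
        unfolding \<phi>_def using s c1 c2 by (intro DERIV_diff Dv_line f) auto
      then show "(\<phi> has_derivative (\<lambda>u. u * (Dv v f ((p + h *\<^sub>R w) + s *\<^sub>R v) - Dv v f (p + s *\<^sub>R v)))) (at s within {0..h})"
        by (simp add: has_field_derivative_def mult_commute_abs)
    qed
    then obtain s where s: "0 \<le> s" "s \<le> h" and
      e1: "\<phi> h - \<phi> 0 = h * (Dv v f ((p + h *\<^sub>R w) + s *\<^sub>R v) - Dv v f (p + s *\<^sub>R v))" by auto
    define \<psi> where "\<psi> r = Dv v f ((p + s *\<^sub>R v) + r *\<^sub>R w)" for r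
    have "\<exists>r\<in>{0..h}. \<psi> h - \<psi> 0 = (h - 0) * Dv w (Dv v f) ((p + s *\<^sub>R v) + r *\<^sub>R w)"
    proof (rule mvt_very_simple[of 0 h \<psi> "\<lambda>r u. u * Dv w (Dv v f) ((p + s *\<^sub>R v) + r *\<^sub>R w)"])
      show "0 \<le> h" using h by simp
      fix r assume r: "0 \<le> r" "r \<le> h"
      have "(\<psi> has_real_derivative Dv w (Dv v f) ((p + s *\<^sub>R v) + r *\<^sub>R w)) (at r within {0..h})"
        unfolding \<psi>_def using r s cone by (intro Dv_line smooth_Dv f) auto
      then show "(\<psi> has_derivative (\<lambda>u. u * Dv w (Dv v f) ((p + s *\<^sub>R v) + r *\<^sub>R w))) (at r within {0..h})"
        by (simp add: has_field_derivative_def mult_commute_abs)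
    qed
    then obtain r where r: "0 \<le> r" "r \<le> h" and e2: "\<psi> h - \<psi> 0 = h * Dv w (Dv v f) ((p + s *\<^sub>R v) + r *\<^sub>R w)" by auto
    have eqp: "(p + h *\<^sub>R w) + s *\<^sub>R v = (p + s *\<^sub>R v) + h *\<^sub>R w" by (simp add: ac_simps)
    have "\<phi> h - \<phi> 0 = h * (\<psi> h - \<psi> 0)" using e1 unfolding \<psi>_def eqp by simp
    moreover have "\<phi> h - \<phi> 0 = f (p + h *\<^sub>R v + h *\<^sub>R w) - f (p + h *\<^sub>R v) - f (p + h *\<^sub>R w) + f p"
      by (simp add: \<phi>_def ac_simps)
    ultimately show ?thesis using s r e2 by (intro exI[of _ s] exI[of _ r]) simp
  qed
  have cone': "p + s *\<^sub>R w + r *\<^sub>R v \<in> halfspace" if "0 \<le> s" "0 \<le> r" for s r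
    using cone[OF that(2,1)] by (simp add: ac_simps)
  let ?F = "Dv w (Dv v f)" and ?G = "Dv v (Dv w f)"
  have cF: "continuous_on halfspace ?F" and cG: "continuous_on halfspace ?G"
    by (intro smooth_continuous smooth_Dv f)+
  have "\<bar>?F p - ?G p\<bar> \<le> \<epsilon>" if \<epsilon>: "0 < \<epsilon>" for \<epsilon>
  proof -
    obtain d1 where d1: "d1 > 0" "\<And>x. x \<in> halfspace \<Longrightarrow> dist x p < d1 \<Longrightarrow> dist (?F x) (?F p) < \<epsilon> / 2"
      using cF p \<epsilon> unfolding continuous_on_iff by (meson half_gt_zero)
    obtain d2 where d2: "d2 > 0" "\<And>x. x \<in> halfspace \<Longrightarrow> dist x p < d2 \<Longrightarrow> dist (?G x) (?G p) < \<epsilon> / 2"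
      using cG p \<epsilon> unfolding continuous_on_iff by (meson half_gt_zero)
    define h where "h = min d1 d2 / (2 * (norm v + norm w + 1))"
    have n: "0 < 2 * (norm v + norm w + 1)" by (simp add: add_nonneg_pos)
    have h: "0 < h" using d1 d2 n by (simp add: h_def)
    have hn: "h * (norm v + norm w) < min d1 d2"
    proof -
      have "h * (norm v + norm w) < h * (2 * (norm v + norm w + 1))" using h
        by (intro mult_strict_left_mono) (simp_all add: add_nonneg_pos)
      also have "\<dots> = min d1 d2" using n by (simp add: h_def)
      finally show ?thesis .
    qed
    have close: "dist (p + s *\<^sub>R v + r *\<^sub>R w) p < min d1 d2" if "0 \<le> s" "s \<le> h" "0 \<le> r" "r \<le> h" for s r
    proof -
      have "dist (p + s *\<^sub>R v + r *\<^sub>R w) p = norm (s *\<^sub>R v + r *\<^sub>R w)" by (simp add: dist_norm add.assoc)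
      also have "\<dots> \<le> s * norm v + r * norm w" using norm_triangle_ineq[of "s *\<^sub>R v" "r *\<^sub>R w"] that by simp
      also have "\<dots> \<le> h * norm v + h * norm w" using that by (intro add_mono mult_right_mono) auto
      finally show ?thesis using hn by (simp add: distrib_left)
    qed
    obtain s r where sr: "0 \<le> s" "s \<le> h" "0 \<le> r" "r \<le> h"
      and 1: "f (p + h *\<^sub>R v + h *\<^sub>R w) - f (p + h *\<^sub>R v) - f (p + h *\<^sub>R w) + f p = h * h * ?F (p + s *\<^sub>R v + r *\<^sub>R w)"
      using rep[OF h cone] by blast
    obtain s' r' where sr': "0 \<le> s'" "s' \<le> h" "0 \<le> r'" "r' \<le> h"
      and 2: "f (p + h *\<^sub>R w + h *\<^sub>R v) - f (p + h *\<^sub>R w) - f (p + h *\<^sub>R v) + f p = h * h * ?G (p + s' *\<^sub>R w + r' *\<^sub>R v)"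
      using rep[OF h cone'] by blast
    have "h * h * ?F (p + s *\<^sub>R v + r *\<^sub>R w) = h * h * ?G (p + s' *\<^sub>R w + r' *\<^sub>R v)"
    proof -
      have c: "p + h *\<^sub>R w + h *\<^sub>R v = p + h *\<^sub>R v + h *\<^sub>R w" by (simp add: ac_simps)
      show ?thesis using 1 2[unfolded c] by linarith
    qed
    then have eq: "?F (p + s *\<^sub>R v + r *\<^sub>R w) = ?G (p + s' *\<^sub>R w + r' *\<^sub>R v)" using h by simp
    have "dist (?F (p + s *\<^sub>R v + r *\<^sub>R w)) (?F p) < \<epsilon> / 2"
      using close[OF sr] by (intro d1(2) cone sr) simp
    moreover have "dist (?G (p + s' *\<^sub>R w + r' *\<^sub>R v)) (?G p) < \<epsilon> / 2"
      using close[of r' s'] sr' by (intro d2(2) cone') (simp_all add: ac_simps)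
    ultimately show ?thesis unfolding dist_real_def eq by linarith
  qed
  then have "\<bar>?F p - ?G p\<bar> \<le> 0" by (rule field_le_epsilon) simp
  then show ?thesis by simp
qed

section \<open>The flow equation in terms of one-sided derivatives\<close>

lemma partial_slice:
  assumes f: "smooth_on halfspace f" and t: "0 \<le> t"
  shows "partial i (\<lambda>x. f (x, t)) x = Dx i f (x, t)"
proof -
  have d: "(f has_derivative (\<lambda>v. Dv v f (x, t))) (at (x, t) within halfspace)"
    by (rule smooth_has_derivative[OF f]) (simp add: t)
  have g: "((\<lambda>x. (x, t)) has_derivative (\<lambda>v. (v, 0))) (at x)" by (auto intro!: derivative_eq_intros)
  have "((\<lambda>x. f (x, t)) has_derivative (\<lambda>v. Dv (v, 0) f (x, t))) (at x)"
    by (rule has_derivative_in_compose[OF g]) (rule has_derivative_subset[OF d], use t in auto)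
  from frechet_derivative_at[OF this] show ?thesis unfolding partial_def by metis
qed

lemma Dv_time:
  assumes "smooth_on halfspace f" "0 \<le> t"
  shows "((\<lambda>s. f (x, s)) has_real_derivative Dt f (x, t)) (at t within {0..})"
  using Dv_line[OF assms(1), of t "{0..}" "(x, 0)" "(0, 1)"] assms(2) by simp

lemma Dv_space:
  assumes "smooth_on halfspace f" "0 \<le> t"
  shows "((\<lambda>s. f (x + s *\<^sub>R v, t)) has_real_derivative Dv (v, 0) f (x + s *\<^sub>R v, t)) (at s within S)"
proof -
  have "((\<lambda>s. f (x + s *\<^sub>R v, t)) has_real_derivative Dv (v, 0) f (x + s *\<^sub>R v, t)) (at s)"
    using Dv_line[OF assms(1), of s UNIV "(x, t)" "(v, 0)"] assms(2) by simp
  then show ?thesis by (rule has_field_derivative_at_within)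
qed

lemma DERIV_unique_Ici:
  assumes "(f has_real_derivative a) (at t within {0..})" "(f has_real_derivative b) (at t within {0..})" "0 \<le> t"
  shows "a = b"
proof -
  have "(*) a = (*) b"
  proof (rule frechet_derivative_unique_within)
    show "(f has_derivative (*) a) (at t within {0..})" "(f has_derivative (*) b) (at t within {0..})"
      using assms unfolding has_field_derivative_def by blast+
    show "\<exists>d. 0 < \<bar>d\<bar> \<and> \<bar>d\<bar> < e \<and> t + d *\<^sub>R i \<in> {0..}" if "i \<in> Basis" "0 < e" for i e :: real
      using that assms(3) by (intro exI[of _ "e / 2"]) auto
  qed
  then show ?thesis by (metis mult.right_neutral)
qed

lemma graph_mcf_Dt:
  assumes f: "smooth_on halfspace f" and mcf: "graph_mcf f" and t: "0 \<le> t"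
  shows "Dt f (x, t) = (\<Sum>i\<in>UNIV. Dx i (Dx i f) (x, t))
     - (\<Sum>i\<in>UNIV. \<Sum>j\<in>UNIV. Dx i f (x, t) * Dx j f (x, t) * Dx j (Dx i f) (x, t))
       / (1 + (\<Sum>i\<in>UNIV. (Dx i f (x, t))\<^sup>2))"
proof -
  have p1: "partial i (\<lambda>y. f (y, t)) = (\<lambda>y. Dx i f (y, t))" for i
    using partial_slice[OF f t] by blast
  have p2: "partial j (\<lambda>y. Dx i f (y, t)) x = Dx j (Dx i f) (x, t)" for i j
    by (rule partial_slice[OF smooth_Dv[OF f] t])
  have "Dt f (x, t) = graph_mcf_rhs (\<lambda>y. f (y, t)) x"
    using mcf t unfolding graph_mcf_def by (intro DERIV_unique_Ici[OF Dv_time[OF f t] _ t]) blast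
  then show ?thesis unfolding graph_mcf_rhs_def p1 p2 .
qed

section \<open>Taylor expansions in time and along rays\<close>

lemma time_Taylor:
  assumes f: "smooth_on halfspace f"
  shows "\<exists>B. \<forall>t. 0 \<le> t \<longrightarrow> t \<le> 1 \<longrightarrow> \<bar>f (x, t) - (\<Sum>i\<le>n. (Dt ^^ i) f (x, 0) * t ^ i / fact i)\<bar> \<le> B * t ^ Suc n"
proof -
  have sm: "smooth_on halfspace ((Dt ^^ i) f)" for i by (induction i) (auto intro: smooth_Dv f)
  have "compact ((\<lambda>t. (Dt ^^ Suc n) f (x, t)) ` {0..1})"
    by (intro compact_continuous_image continuous_on_compose2[OF smooth_continuous[OF sm]] continuous_intros) auto
  then obtain B where B: "\<And>t. t \<in> {0..1} \<Longrightarrow> norm ((Dt ^^ Suc n) f (x, t)) \<le> B"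
    using compact_imp_bounded bounded_iff by (metis imageI)
  have "norm ((Dt ^^ 0) f (x, t) - (\<Sum>i\<le>n. (Dt ^^ i) f (x, 0) * (t - 0) ^ i / fact i)) \<le> B * norm (t - 0) ^ Suc n / fact n"
    if t: "0 \<le> t" "t \<le> 1" for t
  proof (rule field_Taylor[where S="{0..1}" and f="\<lambda>i t. (Dt ^^ i) f (x, t)"])
    show "((\<lambda>t. (Dt ^^ i) f (x, t)) has_real_derivative (Dt ^^ Suc i) f (x, s)) (at s within {0..1})" if "s \<in> {0..1}" for i s
      using Dv_time[OF sm[of i], where t=s and x=x] that by (auto intro: DERIV_subset)
  qed (use t B in auto)
  then have "\<bar>f (x, t) - (\<Sum>i\<le>n. (Dt ^^ i) f (x, 0) * t ^ i / fact i)\<bar> \<le> (B / fact n) * t ^ Suc n" if "0 \<le> t" "t \<le> 1" for t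
    using that by simp
  then show ?thesis by blast
qed

text \<open>\<open>ray_deriv k f x (s x, 0)\<close> is the \<open>k\<close>-th derivative of \<open>s \<mapsto> f (s x, 0)\<close>.\<close>

primrec ray_deriv :: "nat \<Rightarrow> ((real^'n::finite) \<times> real \<Rightarrow> real) \<Rightarrow> real^'n \<Rightarrow> (real^'n) \<times> real \<Rightarrow> real" where
  "ray_deriv 0 f x p = f p"
| "ray_deriv (Suc k) f x p = (\<Sum>i\<in>UNIV. x $ i * ray_deriv k (Dx i f) x p)"

lemma ray_deriv_scale: "ray_deriv k f (c *\<^sub>R x) p = c ^ k * ray_deriv k f x p"
  by (induction k arbitrary: f) (simp_all add: sum_distrib_left mult_ac)

lemma Dv_direction:
  assumes f: "smooth_on halfspace f" and p: "p \<in> halfspace"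
  shows "Dv (x, 0) f p = (\<Sum>i\<in>UNIV. x $ i * Dx i f p)"
proof -
  have lin: "linear (\<lambda>v. Dv v f p)" by (rule has_derivative_linear[OF smooth_has_derivative[OF f p]])
  have "x = (\<Sum>i\<in>UNIV. x $ i *\<^sub>R axis i 1)" using basis_expansion[of x] by (simp add: scalar_mult_eq_scaleR)
  then have "(x, 0) = (\<Sum>i\<in>UNIV. x $ i *\<^sub>R (axis i 1, 0::real))" 
    by (simp add: prod_eq_iff fst_sum snd_sum)
  then have "Dv (x, 0) f p = Dv (\<Sum>i\<in>UNIV. x $ i *\<^sub>R (axis i 1, 0)) f p" by simp
  also have "\<dots> = (\<Sum>i\<in>UNIV. Dv (x $ i *\<^sub>R (axis i 1, 0)) f p)" by (rule linear_sum[OF lin])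
  also have "\<dots> = (\<Sum>i\<in>UNIV. x $ i * Dx i f p)"
    by (simp only: linear_cmul[OF lin] real_scaleR_def)
  finally show ?thesis .
qed

lemma ray_deriv_derivative:
  assumes "smooth_on halfspace f"
  shows "((\<lambda>s. ray_deriv k f x (s *\<^sub>R x, 0)) has_real_derivative ray_deriv (Suc k) f x (s *\<^sub>R x, 0)) (at s within S)"
  using assms
proof (induction k arbitrary: f)
  case 0
  then show ?case using Dv_space[OF 0, of 0 0 x s S] Dv_direction[OF 0, of "(s *\<^sub>R x, 0)" x] by simp
next
  case (Suc k)
  show ?case
    unfolding ray_deriv.simps(2)[of "Suc k"] ray_deriv.simps(2)[of k, abs_def] 
    using Suc.IH[OF smooth_Dv[OF Suc.prems]] unfolding ray_deriv.simps(2)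
    by (intro DERIV_sum DERIV_cmult)
qed

lemma ray_deriv_bound:
  assumes "smooth_on halfspace f"
  shows "\<exists>C\<ge>0. \<forall>x y. norm y \<le> 1 \<longrightarrow> \<bar>ray_deriv k f x (y, 0)\<bar> \<le> C * norm x ^ k"
  using assms
proof (induction k arbitrary: f)
  case 0
  have "compact ((\<lambda>y. f (y, 0)) ` cball 0 1)"
    by (intro compact_continuous_image continuous_on_compose2[OF smooth_continuous[OF 0]] continuous_intros) auto
  then obtain B where B: "\<And>y. y \<in> cball 0 1 \<Longrightarrow> norm (f (y, 0)) \<le> B"
    using compact_imp_bounded bounded_iff by (metis imageI)
  have "0 \<le> B" using B[of 0] norm_ge_zero[of "f (0, 0)"] by simp
  then show ?case using B by (intro exI[of _ B]) auto
next
  case (Suc k)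
  have "\<forall>i. \<exists>C\<ge>0. \<forall>x y. norm y \<le> 1 \<longrightarrow> \<bar>ray_deriv k (Dx i f) x (y, 0)\<bar> \<le> C * norm x ^ k"
    using Suc.IH[OF smooth_Dv[OF Suc.prems]] by blast
  then obtain C where C0: "\<And>i. 0 \<le> C i" and C: "\<And>i x y. norm y \<le> 1 \<Longrightarrow> \<bar>ray_deriv k (Dx i f) x (y, 0)\<bar> \<le> C i * norm x ^ k"
    by metis
  have "\<bar>ray_deriv (Suc k) f x (y, 0)\<bar> \<le> (\<Sum>i\<in>UNIV. C i) * norm x ^ Suc k" if "norm y \<le> 1" for x y
  proof -
    have "\<bar>ray_deriv (Suc k) f x (y, 0)\<bar> \<le> (\<Sum>i\<in>UNIV. \<bar>x $ i * ray_deriv k (Dx i f) x (y, 0)\<bar>)"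
      unfolding ray_deriv.simps by (rule sum_abs)
    also have "\<dots> \<le> (\<Sum>i\<in>UNIV. norm x * (C i * norm x ^ k))"
      unfolding abs_mult using C[OF that] by (intro sum_mono mult_mono component_le_norm_cart) auto
    finally show ?thesis by (simp add: sum_distrib_left sum_distrib_right mult_ac)
  qed
  then show ?case using C0 by (intro exI[of _ "\<Sum>i\<in>UNIV. C i"]) (auto intro: sum_nonneg)
qed

lemma polyb_component [simp]: "polyb (\<lambda>x::real^'n. x $ i)"
  using polyb_inner[of "axis i 1 :: real^'n"] by (simp add: inner_axis)

lemma polyb_ray_deriv [simp]: "polyb (\<lambda>x. ray_deriv k f x p)"
  by (induction k arbitrary: f) auto

lemma space_Taylor:
  assumes f: "smooth_on halfspace f"
  shows "\<exists>C\<ge>0. \<forall>x. norm x \<le> 1 \<longrightarrow> \<bar>f (x, 0) - (\<Sum>i\<le>n. ray_deriv i f x 0 / fact i)\<bar> \<le> C * norm x ^ Suc n"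
proof -
  obtain C where C: "C \<ge> 0" "\<And>x y. norm y \<le> 1 \<Longrightarrow> \<bar>ray_deriv (Suc n) f x (y, 0)\<bar> \<le> C * norm x ^ Suc n"
    using ray_deriv_bound[OF f, of "Suc n"] by blast
  have "\<bar>f (x, 0) - (\<Sum>i\<le>n. ray_deriv i f x 0 / fact i)\<bar> \<le> C / fact n * norm x ^ Suc n" if x: "norm x \<le> 1" for x
  proof -
    have "norm (ray_deriv 0 f x (1 *\<^sub>R x, 0) - (\<Sum>i\<le>n. ray_deriv i f x (0 *\<^sub>R x, 0) * (1 - 0) ^ i / fact i))
        \<le> (C * norm x ^ Suc n) * norm (1 - 0 :: real) ^ Suc n / fact n"
    proof (rule field_Taylor[where S="{0..1}" and f="\<lambda>i s. ray_deriv i f x (s *\<^sub>R x, 0)"])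
      show "((\<lambda>s. ray_deriv i f x (s *\<^sub>R x, 0)) has_real_derivative ray_deriv (Suc i) f x (s *\<^sub>R x, 0)) (at s within {0..1})" for i s
        by (rule ray_deriv_derivative[OF f])
      show "norm (ray_deriv (Suc n) f x (s *\<^sub>R x, 0)) \<le> C * norm x ^ Suc n" if "s \<in> {0..1}" for s
      proof -
        have "norm (s *\<^sub>R x) \<le> 1" using that x mult_mono[of "\<bar>s\<bar>" 1 "norm x" 1] by simp
        then show ?thesis using C(2) by simp
      qed
    qed auto
    then show ?thesis by (simp add: zero_prod_def)
  qed
  then show ?thesis using C(1) by (intro exI[of _ "C / fact n"]) auto
qed

lemma ray_deriv_one_dim:
  fixes f :: "(real^'n::finite) \<times> real \<Rightarrow> real"
  assumes "(UNIV :: 'n set) = {k}"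
  shows "ray_deriv j f x p = (x $ k) ^ j * (Dx k ^^ j) f p"
  by (induction j arbitrary: f) (simp_all add: assms funpow_swap1)

section \<open>Time derivatives of the flow at the origin\<close>

lemma mcf_first_derivative:
  assumes f: "smooth_on halfspace f" and mcf: "graph_mcf f" and g0: "\<And>i. Dx i f 0 = 0"
  shows "Dt f 0 = (\<Sum>i\<in>UNIV. Dx i (Dx i f) 0)"
  using graph_mcf_Dt[OF f mcf, of 0 0] g0 by (simp add: zero_prod_def)

text \<open>With \<open>rhs u m = m - u^2 m / (1 + u^2)\<close> the equation reads
  \<open>f_t = rhs f_x f_xx\<close>. Where \<open>f_x = 0\<close> the first derivative of the
  quotient vanishes, so \<open>f_tt = (f_xx)_t = (f_t)_xx\<close>; the second spatial derivative of
  the quotient leaves \<open>2 f_xx^2 f_xx\<close>. This is the origin of the curvature cube in the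
  second order condition.\<close>

lemma mcf_second_derivative:
  fixes f :: "(real^'n::finite) \<times> real \<Rightarrow> real"
  assumes f: "smooth_on halfspace f" and mcf: "graph_mcf f" and k: "(UNIV :: 'n set) = {k}" and g0: "Dx k f 0 = 0"
  shows "Dt (Dt f) 0 = (Dx k ^^ 4) f 0 - 2 * (Dx k (Dx k f) 0) ^ 3"
proof -
  note sm = smooth_Dv[OF f] smooth_Dv[OF smooth_Dv[OF f]] smooth_Dv[OF smooth_Dv[OF smooth_Dv[OF f]]]
  define rhs where "rhs u m = m - u\<^sup>2 * m / (1 + u\<^sup>2)" for u m :: real
  have pde: "Dt f (x, t) = rhs (Dx k f (x, t)) (Dx k (Dx k f) (x, t))" if "0 \<le> t" for x t
    using graph_mcf_Dt[OF f mcf that, of x] by (simp add: k rhs_def power2_eq_square)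
  have pos: "1 + u\<^sup>2 \<noteq> 0" for u :: real using zero_le_power2[of u] by linarith
  have rhs_deriv: "((\<lambda>s. rhs (u s) (m s)) has_real_derivative m' - ((2 * u s * u' * m s + (u s)\<^sup>2 * m') * (1 + (u s)\<^sup>2)
         - (u s)\<^sup>2 * m s * (2 * u s * u')) / (1 + (u s)\<^sup>2)\<^sup>2) (at s within S)"
    if "(u has_real_derivative u') (at s within S)" "(m has_real_derivative m') (at s within S)" for u m u' m' s S
    unfolding rhs_def using pos[of "u s"] by (auto intro!: derivative_eq_intros that simp: power2_eq_square)
  have comm: "Dt (Dx k g) p = Dx k (Dt g) p" if "smooth_on halfspace g" "p \<in> halfspace" for g p
    using that by (intro Dv_commute) (auto simp: halfspace_def)
  have "Dt (Dt f) 0 = Dt (Dx k (Dx k f)) 0"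
  proof -
    have "((\<lambda>t. Dt f (0, t)) has_real_derivative Dt (Dt f) (0, 0)) (at 0 within {0..})"
      by (rule Dv_time) (simp_all add: sm)
    moreover have "((\<lambda>t. Dt f (0, t)) has_real_derivative Dt (Dx k (Dx k f)) (0, 0)) (at 0 within {0..})"
    proof (rule has_field_derivative_transform_within[where f="\<lambda>t. rhs (Dx k f (0, t)) (Dx k (Dx k f) (0, t))" and d=1])
      show "((\<lambda>t. rhs (Dx k f (0, t)) (Dx k (Dx k f) (0, t))) has_real_derivative Dt (Dx k (Dx k f)) (0, 0)) (at 0 within {0..})"
        using rhs_deriv[OF Dv_time[OF sm(1), of 0 "(axis k 1, 0)" 0] Dv_time[OF sm(2), of 0 "(axis k 1, 0)" "(axis k 1, 0)" 0]] g0
        by (simp add: zero_prod_def)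
    qed (auto simp: pde)
    ultimately show ?thesis using DERIV_unique_Ici by (fastforce simp: zero_prod_def)
  qed
  also have "\<dots> = Dx k (Dt (Dx k f)) 0"
    by (rule comm) (auto simp: sm zero_prod_def)
  also have "\<dots> = Dx k (Dx k (Dt f)) 0"
    by (rule Dv_cong) (auto simp: comm f zero_prod_def)
  also have "\<dots> = (Dx k ^^ 4) f 0 - 2 * (Dx k (Dx k f) 0) ^ 3"
  proof -
    define e where "e = (axis k 1 :: real^'n)"
    define g where "g j s = (Dx k ^^ j) f (s *\<^sub>R e, 0)" for j s
    have smj: "smooth_on halfspace ((Dx k ^^ j) f)" for j by (induction j) (auto intro: smooth_Dv f)
    have gd: "(g j has_real_derivative g (Suc j) s) (at s)" for j s
      using Dv_space[OF smj, of 0 j 0 e s UNIV] unfolding g_def e_def by simp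
    define G where "G s = Dt f (s *\<^sub>R e, 0)" for s
    have G: "G s = rhs (g 1 s) (g 2 s)" for s
      unfolding G_def g_def using pde[of 0 "s *\<^sub>R e"] by (simp add: numeral_2_eq_2)
    define G1 where "G1 s = Dx k (Dt f) (s *\<^sub>R e, 0)" for s
    have dG: "(G has_real_derivative G1 s) (at s)" for s
      using Dv_space[OF sm(1), of 0 "(0, 1)" 0 e s UNIV] unfolding G_def G1_def e_def by simp
    have dG1: "(G1 has_real_derivative Dx k (Dx k (Dt f)) (s *\<^sub>R e, 0)) (at s)" for s
      using Dv_space[OF sm(2), of 0 "(axis k 1, 0)" "(0, 1)" 0 e s UNIV] unfolding G1_def e_def by simp
    have G1: "G1 s = g 3 s - ((2 * g 1 s * g 2 s * g 2 s + (g 1 s)\<^sup>2 * g 3 s) * (1 + (g 1 s)\<^sup>2)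
         - (g 1 s)\<^sup>2 * g 2 s * (2 * g 1 s * g 2 s)) / (1 + (g 1 s)\<^sup>2)\<^sup>2" for s
    proof -
      have d1: "(g 1 has_real_derivative g 2 s) (at s)" and d2: "(g 2 has_real_derivative g 3 s) (at s)"
        using gd[of 1 s] gd[of 2 s] by (simp_all add: numeral_2_eq_2 numeral_3_eq_3)
      have "(G has_real_derivative g 3 s - ((2 * g 1 s * g 2 s * g 2 s + (g 1 s)\<^sup>2 * g 3 s) * (1 + (g 1 s)\<^sup>2)
         - (g 1 s)\<^sup>2 * g 2 s * (2 * g 1 s * g 2 s)) / (1 + (g 1 s)\<^sup>2)\<^sup>2) (at s)"
        unfolding G[abs_def] by (rule rhs_deriv[OF d1 d2])
      then show ?thesis by (rule DERIV_unique[OF dG])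
    qed
    have g10: "g 1 0 = 0" using g0 by (simp add: g_def zero_prod_def)
    have "(G1 has_real_derivative g 4 0 - 2 * g 2 0 * g 2 0 * g 2 0) (at 0)"
    proof -
      have d1: "(g 1 has_real_derivative g 2 0) (at 0)" and d2: "(g 2 has_real_derivative g 3 0) (at 0)"
        and d3: "(g 3 has_real_derivative g 4 0) (at 0)"
        using gd[of 1 0] gd[of 2 0] gd[of 3 0] by (simp_all add: numeral_2_eq_2 numeral_3_eq_3 eval_nat_numeral)
      show ?thesis
        unfolding G1[abs_def] using g10
        by (auto intro!: derivative_eq_intros d1 d2 d3 simp: algebra_simps simp del: One_nat_def)
    qed
    then have "Dx k (Dx k (Dt f)) (0 *\<^sub>R e, 0) = g 4 0 - 2 * g 2 0 * g 2 0 * g 2 0"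
      by (rule DERIV_unique[OF dG1])
    then show ?thesis by (simp add: g_def zero_prod_def power3_eq_cube numeral_2_eq_2)
  qed
  finally show ?thesis .
qed

section \<open>Expansion of all stages\<close>

text \<open>One recursion serves all orders: \<open>p\<close> is the Taylor term of the initial
  graph, and \<open>s\<close> is the source that lower orders produce through the cubic term of
  \<open>gphi\<close>.\<close>

fun profile ::
  "(nat \<Rightarrow> nat \<Rightarrow> real) \<Rightarrow> ('a::euclidean_space \<Rightarrow> real) \<Rightarrow> (nat \<Rightarrow> nat \<Rightarrow> 'a \<Rightarrow> 'a \<Rightarrow> real) \<Rightarrow> nat \<Rightarrow> 'a \<Rightarrow> real" where
  "profile \<gamma> p s m = (if m = 0 then p else (\<lambda>x. \<Sum>i<m. \<gamma> m i * (\<integral>y. profile \<gamma> p s i (x + y) + s m i x y \<partial>gm)))"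

declare profile.simps [simp del]

lemma profile_0 [simp]: "profile \<gamma> p s 0 = p"
  by (subst profile.simps) simp

lemma profile_pos:
  "m > 0 \<Longrightarrow> profile \<gamma> p s m x = (\<Sum>i<m. \<gamma> m i * (\<integral>y. profile \<gamma> p s i (x + y) + s m i x y \<partial>gm))"
  by (subst profile.simps) simp

lemma polyb_profile:
  assumes "polyb p" "\<And>m i. polyb (\<lambda>z. s m i (fst z) (snd z))"
  shows "polyb (profile \<gamma> p s m)"
proof (induction m rule: less_induct)
  case (less m)
  show ?case
  proof (cases "m = 0")
    case False
    have "polyb (\<lambda>x. \<Sum>i<m. \<gamma> m i * (\<integral>y. profile \<gamma> p s i (x + y) + s m i x y \<partial>gm))"
    proof (intro polyb_sum polyb_mult polyb_const)
      fix i assume "i \<in> {..<m}"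
      then have "polyb (\<lambda>z. profile \<gamma> p s i (fst z + snd z) + s m i (fst z) (snd z))"
        using less assms by (intro polyb_add polyb_shift) auto
      from polyb_integral[OF this] show "polyb (\<lambda>x. \<integral>y. profile \<gamma> p s i (x + y) + s m i x y \<partial>gm)" by simp
    qed
    then show ?thesis using False by (simp add: profile.simps[of _ _ _ m])
  qed (simp add: assms)
qed

text \<open>\<open>gm\<close> is invariant under reflection, so the common parity of initial datum
  and source passes through the recursion; \<sigma> is 1 for \<open>P1\<close> and -1 for
  \<open>P2\<close> and \<open>P4\<close>.\<close>

lemma profile_parity:
  assumes p: "polyb p" and s: "\<And>m i. polyb (\<lambda>z. s m i (fst z) (snd z))"
    and pp: "\<And>x. p (- x) = \<sigma> * p x" and ss: "\<And>m i x y. s m i (- x) (- y) = \<sigma> * s m i x y"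
  shows "profile \<gamma> p s m (- x) = \<sigma> * profile \<gamma> p s m x"
proof (induction m arbitrary: x rule: less_induct)
  case (less m)
  show ?case
  proof (cases "m = 0")
    case False
    have "(\<integral>y. profile \<gamma> p s i (- x + y) + s m i (- x) y \<partial>gm) = \<sigma> * (\<integral>y. profile \<gamma> p s i (x + y) + s m i x y \<partial>gm)"
      if "i < m" for i
    proof -
      have "polyb (\<lambda>z. profile \<gamma> p s i (fst z + snd z) + s m i (fst z) (snd z))"
        by (intro polyb_add polyb_shift polyb_profile p s)
      from polyb_slice[OF this, of "- x"]
      have m: "(\<lambda>y. profile \<gamma> p s i (- x + y) + s m i (- x) y) \<in> borel_measurable borel" by (simp add: polyb_def)
      have "(\<integral>y. profile \<gamma> p s i (- x + y) + s m i (- x) y \<partial>gm) = (\<integral>y. profile \<gamma> p s i (- (x + y)) + s m i (- x) (- y) \<partial>gm)"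
        using integral_gm_reflect[OF m] by simp
      also have "\<dots> = (\<integral>y. \<sigma> * (profile \<gamma> p s i (x + y) + s m i x y) \<partial>gm)"
        unfolding less.IH[OF that] ss by (simp add: distrib_left)
      finally show ?thesis by simp
    qed
    then show ?thesis using False by (simp add: profile_pos sum_distrib_left mult.left_commute)
  qed (simp add: pp)
qed

lemma sandwich_mono:
  assumes "sandwich k \<rho> A q" "\<rho>' \<le> \<rho>"
  shows "sandwich k \<rho>' A q"
proof -
  obtain C N where "C \<ge> 0" and s: "\<And>e x v. 0 < e \<Longrightarrow> e < 1 \<Longrightarrow> \<bar>v\<bar> \<le> \<rho> / e \<Longrightarrow>
     C * e ^ k * (1 + norm x) ^ N < \<bar>v - q e x\<bar> \<Longrightarrow> ((x, v) \<in> A e \<longleftrightarrow> v < q e x)"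
    using assms(1) unfolding sandwich_def by blast
  moreover have "\<bar>v\<bar> \<le> \<rho> / e" if "0 < e" "\<bar>v\<bar> \<le> \<rho>' / e" for e v :: real
    using divide_right_mono[OF assms(2), of e] that by linarith
  ultimately show ?thesis unfolding sandwich_def by blast
qed

text \<open>Up to order \<open>e^4\<close> the cube contributes only \<open>a^3\<close> at order
  \<open>e^3\<close> and \<open>3 a^2 b\<close> at order \<open>e^4\<close>; divided by 12 they
  become the sources of \<open>P3\<close> and \<open>P4\<close>. The bound is polynomial in the
  absolute values of the coefficients, so it keeps polynomial growth when profiles are
  inserted.\<close>

lemma cubic_remainder_bound:
  fixes a b c d e :: real
  assumes "0 < e" "e < 1"
  defines "z \<equiv> e * a + e ^ 2 * b + e ^ 3 * c + e ^ 4 * d"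
  shows "\<bar>(z - z ^ 3 / 12) - (e * a + e ^ 2 * b + e ^ 3 * (c - a ^ 3 / 12) + e ^ 4 * (d - a\<^sup>2 * b / 4))\<bar>
    \<le> e ^ 5 * (3 * a\<^sup>2 * (\<bar>c\<bar> + \<bar>d\<bar>) + 3 * \<bar>a\<bar> * (\<bar>b\<bar> + \<bar>c\<bar> + \<bar>d\<bar>)\<^sup>2 + (\<bar>b\<bar> + \<bar>c\<bar> + \<bar>d\<bar>) ^ 3)"
proof -
  define B where "B = b + e * c + e\<^sup>2 * d"
  define R where "R = 3 * a\<^sup>2 * (c + e * d) + 3 * a * B\<^sup>2 + e * B ^ 3"
  define g where "g = c + e * d"
  have b: "b = B - e * g" and z: "z = e * (a + e * B)"
    unfolding z_def B_def g_def by (simp_all add: eval_nat_numeral algebra_simps)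
  have "z ^ 3 = e ^ 3 * a ^ 3 + 3 * (e ^ 4 * (a\<^sup>2 * b)) + e ^ 5 * R"
    unfolding z R_def g_def[symmetric] b by (simp add: eval_nat_numeral algebra_simps)
  moreover have "e ^ 3 * (c - a ^ 3 / 12) = e ^ 3 * c - e ^ 3 * a ^ 3 / 12"
    "e ^ 4 * (d - a\<^sup>2 * b / 4) = e ^ 4 * d - e ^ 4 * (a\<^sup>2 * b) / 4"
    by (simp_all add: right_diff_distrib)
  ultimately have eq: "(z - z ^ 3 / 12) - (e * a + e ^ 2 * b + e ^ 3 * (c - a ^ 3 / 12) + e ^ 4 * (d - a\<^sup>2 * b / 4)) = - (e ^ 5 * R / 12)"
    unfolding z_def by linarith
  have ec: "\<bar>e * u\<bar> \<le> \<bar>u\<bar>" "\<bar>e\<^sup>2 * u\<bar> \<le> \<bar>u\<bar>" for u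
    using assms mult_right_mono[of e 1 "\<bar>u\<bar>"] mult_right_mono[of "e\<^sup>2" 1 "\<bar>u\<bar>"] by (auto simp: abs_mult power_le_one)
  have B: "\<bar>B\<bar> \<le> \<bar>b\<bar> + \<bar>c\<bar> + \<bar>d\<bar>" using ec(1)[of c] ec(2)[of d] unfolding B_def by linarith
  have "\<bar>3 * a\<^sup>2 * (c + e * d)\<bar> \<le> 3 * a\<^sup>2 * (\<bar>c\<bar> + \<bar>d\<bar>)"
    unfolding abs_mult using ec(1)[of d] by (intro mult_mono) auto
  moreover have "\<bar>3 * a * B\<^sup>2\<bar> \<le> 3 * \<bar>a\<bar> * (\<bar>b\<bar> + \<bar>c\<bar> + \<bar>d\<bar>)\<^sup>2"
    unfolding abs_mult power_abs using B by (intro mult_mono power_mono) auto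
  moreover have "\<bar>e * B ^ 3\<bar> \<le> (\<bar>b\<bar> + \<bar>c\<bar> + \<bar>d\<bar>) ^ 3"
  proof (rule order_trans[OF ec(1)])
    show "\<bar>B ^ 3\<bar> \<le> (\<bar>b\<bar> + \<bar>c\<bar> + \<bar>d\<bar>) ^ 3"
      unfolding power_abs by (rule power_mono[OF B abs_ge_zero])
  qed
  ultimately have "\<bar>R\<bar> \<le> 3 * a\<^sup>2 * (\<bar>c\<bar> + \<bar>d\<bar>) + 3 * \<bar>a\<bar> * (\<bar>b\<bar> + \<bar>c\<bar> + \<bar>d\<bar>)\<^sup>2 + (\<bar>b\<bar> + \<bar>c\<bar> + \<bar>d\<bar>) ^ 3"
    unfolding R_def by linarith
  then have "\<bar>R\<bar> / 12 \<le> 3 * a\<^sup>2 * (\<bar>c\<bar> + \<bar>d\<bar>) + 3 * \<bar>a\<bar> * (\<bar>b\<bar> + \<bar>c\<bar> + \<bar>d\<bar>)\<^sup>2 + (\<bar>b\<bar> + \<bar>c\<bar> + \<bar>d\<bar>) ^ 3"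
    by linarith
  then show ?thesis unfolding eq using assms mult_left_mono[of "\<bar>R\<bar> / 12" _ "e ^ 5"] by (simp add: abs_mult)
qed

locale stage_profiles =
  fixes \<gamma> :: "nat \<Rightarrow> nat \<Rightarrow> real" and f :: "(real^'n::finite) \<times> real \<Rightarrow> real" and M :: nat
  assumes smooth: "smooth_on halfspace f" and f0: "f 0 = 0" and grad0: "\<And>i. Dx i f 0 = 0"
    and sum_gamma: "\<And>m. 1 \<le> m \<Longrightarrow> m \<le> M \<Longrightarrow> (\<Sum>i<m. \<gamma> m i) = 1"
    and M: "1 \<le> M"
begin

text \<open>\<open>P1\<close> to \<open>P4\<close> are the coefficients of \<open>e\<close> to
  \<open>e^4\<close> in the profile. Scaling sends the initial graph to
  \<open>f (e x, 0) / e\<close>, so order \<open>e^j\<close> starts from the Taylor term of degree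
  \<open>j + 1\<close>; degrees 0 and 1 vanish by assumption. The sources involve stage
  \<open>m\<close> itself, but only at lower order, so the recursion is explicit.\<close>

definition P1 where "P1 = profile \<gamma> (\<lambda>x. ray_deriv 2 f x 0 / 2) (\<lambda>m i x y. 0)"
definition P2 where "P2 = profile \<gamma> (\<lambda>x. ray_deriv 3 f x 0 / 6) (\<lambda>m i x y. 0)"
definition P3 where "P3 = profile \<gamma> (\<lambda>x. ray_deriv 4 f x 0 / 24)
  (\<lambda>m i x y. - ((P1 i (x + y) - P1 m x) ^ 3) / 12)"
definition P4 where "P4 = profile \<gamma> (\<lambda>x. ray_deriv 5 f x 0 / 120)
  (\<lambda>m i x y. - (P1 i (x + y) - P1 m x)\<^sup>2 * (P2 i (x + y) - P2 m x) / 4)"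

lemma polyb_P1 [simp]: "polyb (P1 m)"
  unfolding P1_def by (rule polyb_profile) simp_all

lemma polyb_P2 [simp]: "polyb (P2 m)"
  unfolding P2_def by (rule polyb_profile) simp_all

lemma polyb_P3_source: "polyb (\<lambda>z. - ((P1 i (fst z + snd z) - P1 m (fst z)) ^ 3) / 12)"
  by (intro polyb_divide polyb_uminus polyb_power polyb_diff polyb_shift polyb_fst polyb_P1)

lemma polyb_P4_source: "polyb (\<lambda>z. - (P1 i (fst z + snd z) - P1 m (fst z))\<^sup>2 * (P2 i (fst z + snd z) - P2 m (fst z)) / 4)"
  by (intro polyb_divide polyb_uminus polyb_power polyb_mult polyb_diff polyb_shift polyb_fst polyb_P1 polyb_P2)

lemma polyb_P3 [simp]: "polyb (P3 m)"
  unfolding P3_def by (rule polyb_profile) (simp_all add: polyb_P3_source)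

lemma polyb_P4 [simp]: "polyb (P4 m)"
  unfolding P4_def by (rule polyb_profile) (simp_all add: polyb_P4_source)

lemma P1_even: "P1 m (- x) = P1 m x"
  using profile_parity[of "\<lambda>x. ray_deriv 2 f x 0 / 2" "\<lambda>m i x y. 0" 1 \<gamma> m x] ray_deriv_scale[of 2 f "-1"]
  by (simp add: P1_def)

lemma P2_odd: "P2 m (- x) = - P2 m x"
  using profile_parity[of "\<lambda>x. ray_deriv 3 f x 0 / 6" "\<lambda>m i x y. 0" "-1" \<gamma> m x] ray_deriv_scale[of 3 f "-1"]
  by (simp add: P2_def)

lemma P4_odd: "P4 m (- x) = - P4 m x"
proof -
  have neg: "P1 i (- x - y) = P1 i (x + y)" "P2 i (- x - y) = - P2 i (x + y)" for i x y
    using P1_even[of i "x + y"] P2_odd[of i "x + y"] by simp_all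
  have "P4 m (- x) = (-1) * P4 m x"
    unfolding P4_def
  proof (rule profile_parity)
    show "polyb (\<lambda>z. - (P1 i (fst z + snd z) - P1 m (fst z))\<^sup>2 * (P2 i (fst z + snd z) - P2 m (fst z)) / 4)" for m i
      by (rule polyb_P4_source)
    show "ray_deriv 5 f (- x) 0 / 120 = - 1 * (ray_deriv 5 f x 0 / 120)" for x
      using ray_deriv_scale[of 5 f "-1" x] by simp
    show "- (P1 i (- x + - y) - P1 m (- x))\<^sup>2 * (P2 i (- x + - y) - P2 m (- x)) / 4
       = - 1 * (- (P1 i (x + y) - P1 m x)\<^sup>2 * (P2 i (x + y) - P2 m x) / 4)" for m i x y
      by (simp add: neg P1_even P2_odd algebra_simps)
  qed simp
  then show ?thesis by simp
qed

lemma P2_0: "P2 m 0 = 0" and P4_0: "P4 m 0 = 0"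
  using P2_odd[of m 0] P4_odd[of m 0] by simp_all

definition q where "q m e x = e * P1 m x + e ^ 2 * P2 m x + e ^ 3 * P3 m x + e ^ 4 * P4 m x"

lemma BO_q: "BO 1 (q m)"
proof -
  have "BO 1 (\<lambda>e x. e ^ 1 * P1 m x)" "BO 1 (\<lambda>e x. e ^ 2 * P2 m x)" "BO 1 (\<lambda>e x. e ^ 3 * P3 m x)" "BO 1 (\<lambda>e x. e ^ 4 * P4 m x)"
    by (intro BO_mono[OF BO_polyb]; simp)+
  from BO_add[OF BO_add[OF BO_add[OF this(1,2)] this(3)] this(4)] show ?thesis
    unfolding q_def[abs_def] by simp
qed

lemma q_measurable: "q m e \<in> borel_measurable borel"
  unfolding q_def[abs_def] by (intro polyb_measurable polyb_add polyb_mult polyb_const polyb_P1 polyb_P2 polyb_P3 polyb_P4)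

text \<open>The recursions say exactly that the mean of \<open>main\<close>, the part of orders
  \<open>e\<close> to \<open>e^4\<close>, vanishes; row sums equal to 1 allow the profile of stage
  \<open>m\<close>, constant in \<open>y\<close>, to be pulled out. The rest is controlled by
  \<open>cubic_remainder_bound\<close>.\<close>

lemma q_residual:
  assumes m: "1 \<le> m" "m \<le> M"
  shows "BO 5 (\<lambda>e x. \<Sum>i<m. \<gamma> m i * (\<integral>y. (q i e (x + y) - q m e x) - (q i e (x + y) - q m e x) ^ 3 / 12 \<partial>gm))"
proof -
  define a where "a i z = P1 i (fst z + snd z) - P1 m (fst z)" for i and z :: "(real^'n) \<times> (real^'n)"
  define b where "b i z = P2 i (fst z + snd z) - P2 m (fst z)" for i and z :: "(real^'n) \<times> (real^'n)"
  define c where "c i z = P3 i (fst z + snd z) - P3 m (fst z)" for i and z :: "(real^'n) \<times> (real^'n)"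
  define d where "d i z = P4 i (fst z + snd z) - P4 m (fst z)" for i and z :: "(real^'n) \<times> (real^'n)"
  have pa [simp]: "polyb (a i)" and pb [simp]: "polyb (b i)" and pc [simp]: "polyb (c i)" and pd [simp]: "polyb (d i)" for i
    unfolding a_def b_def c_def d_def by (intro polyb_diff polyb_shift polyb_fst polyb_P1 polyb_P2 polyb_P3 polyb_P4)+
  define R where "R i z = 3 * (a i z)\<^sup>2 * (\<bar>c i z\<bar> + \<bar>d i z\<bar>) + 3 * \<bar>a i z\<bar> * (\<bar>b i z\<bar> + \<bar>c i z\<bar> + \<bar>d i z\<bar>)\<^sup>2 + (\<bar>b i z\<bar> + \<bar>c i z\<bar> + \<bar>d i z\<bar>) ^ 3" for i z
  have pR [simp]: "polyb (R i)" for i unfolding R_def by simp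
  have sl: "integrable gm (\<lambda>y. F (x, y))" if "polyb F" for F :: "(real^'n) \<times> (real^'n) \<Rightarrow> real" and x
    using polyb_integrable[OF polyb_slice[OF that]] .
  define main where "main i e z = e * a i z + e ^ 2 * b i z + e ^ 3 * (c i z - (a i z) ^ 3 / 12) + e ^ 4 * (d i z - (a i z)\<^sup>2 * b i z / 4)" for i e z
  have zero: "(\<Sum>i<m. \<gamma> m i * (\<integral>y. main i e (x, y) \<partial>gm)) = 0" for e x
  proof -
    have split: "(\<integral>y. P i (x + y) + s y - P m x \<partial>gm) = (\<integral>y. P i (x + y) + s y \<partial>gm) - P m x"
      if "polyb (P i)" "polyb s" for P :: "nat \<Rightarrow> real^'n \<Rightarrow> real" and s i
      using polyb_integrable[OF polyb_add[OF polyb_translate[OF that(1)] that(2)]] by simp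
    have tot: "(\<Sum>i<m. \<gamma> m i * (\<integral>y. P i (x + y) + s i y - P m x \<partial>gm)) = 0"
      if "\<And>i. polyb (P i)" "\<And>i. polyb (s i)" "P m x = (\<Sum>i<m. \<gamma> m i * (\<integral>y. P i (x + y) + s i y \<partial>gm))" for P :: "nat \<Rightarrow> real^'n \<Rightarrow> real" and s
    proof -
      have "(\<integral>y. P i (x + y) + s i y - P m x \<partial>gm) = (\<integral>y. P i (x + y) + s i y \<partial>gm) - P m x" for i
        by (rule split[OF that(1,2)])
      then show ?thesis
        using sum_gamma[OF m] that(3) by (simp add: right_diff_distrib sum_subtractf flip: sum_distrib_right)
    qed
    have m0: "m > 0" using m by simp
    have ta: "(\<Sum>i<m. \<gamma> m i * (\<integral>y. a i (x, y) \<partial>gm)) = 0"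
    proof -
      have "P1 m x = (\<Sum>i<m. \<gamma> m i * (\<integral>y. P1 i (x + y) + 0 \<partial>gm))"
        unfolding P1_def by (rule profile_pos[OF m0])
      from tot[OF _ _ this] show ?thesis by (simp add: a_def)
    qed
    have tb: "(\<Sum>i<m. \<gamma> m i * (\<integral>y. b i (x, y) \<partial>gm)) = 0"
    proof -
      have "P2 m x = (\<Sum>i<m. \<gamma> m i * (\<integral>y. P2 i (x + y) + 0 \<partial>gm))"
        unfolding P2_def by (rule profile_pos[OF m0])
      from tot[OF _ _ this] show ?thesis by (simp add: b_def)
    qed
    have tc: "(\<Sum>i<m. \<gamma> m i * (\<integral>y. c i (x, y) - (a i (x, y)) ^ 3 / 12 \<partial>gm)) = 0"
    proof -
      have "(\<Sum>i<m. \<gamma> m i * (\<integral>y. P3 i (x + y) + (- ((P1 i (x + y) - P1 m x) ^ 3) / 12) - P3 m x \<partial>gm)) = 0"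
      proof (rule tot)
        show "polyb (\<lambda>y. - ((P1 i (x + y) - P1 m x) ^ 3) / 12)" for i
          using polyb_slice[OF polyb_P3_source[of i m], of x] by simp
        show "P3 m x = (\<Sum>i<m. \<gamma> m i * (\<integral>y. P3 i (x + y) + (- ((P1 i (x + y) - P1 m x) ^ 3) / 12) \<partial>gm))"
          unfolding P3_def by (rule profile_pos[OF m0])
      qed simp
      then show ?thesis by (simp add: c_def a_def algebra_simps)
    qed
    have td: "(\<Sum>i<m. \<gamma> m i * (\<integral>y. d i (x, y) - (a i (x, y))\<^sup>2 * b i (x, y) / 4 \<partial>gm)) = 0"
    proof -
      have "(\<Sum>i<m. \<gamma> m i * (\<integral>y. P4 i (x + y) + (- (P1 i (x + y) - P1 m x)\<^sup>2 * (P2 i (x + y) - P2 m x) / 4) - P4 m x \<partial>gm)) = 0"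
      proof (rule tot)
        show "polyb (\<lambda>y. - (P1 i (x + y) - P1 m x)\<^sup>2 * (P2 i (x + y) - P2 m x) / 4)" for i
          using polyb_slice[OF polyb_P4_source[of i m], of x] by simp
        show "P4 m x = (\<Sum>i<m. \<gamma> m i * (\<integral>y. P4 i (x + y) + (- (P1 i (x + y) - P1 m x)\<^sup>2 * (P2 i (x + y) - P2 m x) / 4) \<partial>gm))"
          unfolding P4_def by (rule profile_pos[OF m0])
      qed simp
      moreover have "P4 i (x + y) + (- (P1 i (x + y) - P1 m x)\<^sup>2 * (P2 i (x + y) - P2 m x) / 4) - P4 m x
          = d i (x, y) - (a i (x, y))\<^sup>2 * b i (x, y) / 4" for i y
        by (simp add: d_def a_def b_def)
      ultimately show ?thesis by simp
    qed
    have I: "(\<integral>y. main i e (x, y) \<partial>gm) = e * (\<integral>y. a i (x, y) \<partial>gm) + e ^ 2 * (\<integral>y. b i (x, y) \<partial>gm)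
        + e ^ 3 * (\<integral>y. c i (x, y) - (a i (x, y)) ^ 3 / 12 \<partial>gm) + e ^ 4 * (\<integral>y. d i (x, y) - (a i (x, y))\<^sup>2 * b i (x, y) / 4 \<partial>gm)" for i
    proof -
      have "integrable gm (\<lambda>y. a i (x, y))" "integrable gm (\<lambda>y. b i (x, y))"
        "integrable gm (\<lambda>y. c i (x, y) - (a i (x, y)) ^ 3 / 12)" "integrable gm (\<lambda>y. d i (x, y) - (a i (x, y))\<^sup>2 * b i (x, y) / 4)"
        using sl[of "a i" x] sl[of "b i" x] sl[of "\<lambda>z. c i z - (a i z) ^ 3 / 12" x] sl[of "\<lambda>z. d i z - (a i z)\<^sup>2 * b i z / 4" x]
        by simp_all
      then show ?thesis unfolding main_def by simp
    qed
    have "(\<Sum>i<m. \<gamma> m i * (\<integral>y. main i e (x, y) \<partial>gm))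
       = e * (\<Sum>i<m. \<gamma> m i * (\<integral>y. a i (x, y) \<partial>gm)) + e ^ 2 * (\<Sum>i<m. \<gamma> m i * (\<integral>y. b i (x, y) \<partial>gm))
        + e ^ 3 * (\<Sum>i<m. \<gamma> m i * (\<integral>y. c i (x, y) - (a i (x, y)) ^ 3 / 12 \<partial>gm))
        + e ^ 4 * (\<Sum>i<m. \<gamma> m i * (\<integral>y. d i (x, y) - (a i (x, y))\<^sup>2 * b i (x, y) / 4 \<partial>gm))"
      unfolding I by (simp only: distrib_left sum.distrib sum_distrib_left mult.left_commute)
    then show ?thesis unfolding ta tb tc td by simp
  qed
  have "BO 5 (\<lambda>e x. e ^ 5 * (\<Sum>i<m. \<bar>\<gamma> m i\<bar> * (\<integral>y. R i (x, y) \<partial>gm)))"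
    by (intro BO_polyb polyb_sum polyb_mult polyb_const polyb_integral pR)
  then show ?thesis
  proof (rule BO_le)
    fix e and x :: "real^'n" assume e: "0 < (e::real)" "e < 1"
    have "\<bar>(\<Sum>i<m. \<gamma> m i * (\<integral>y. (q i e (x + y) - q m e x) - (q i e (x + y) - q m e x) ^ 3 / 12 \<partial>gm))
        - (\<Sum>i<m. \<gamma> m i * (\<integral>y. main i e (x, y) \<partial>gm))\<bar> \<le> (\<Sum>i<m. \<bar>\<gamma> m i\<bar> * (e ^ 5 * (\<integral>y. R i (x, y) \<partial>gm)))"
    proof (rule sum_mult_diff_bound)
      fix i
      define z where "z w = e * a i w + e ^ 2 * b i w + e ^ 3 * c i w + e ^ 4 * d i w" for w
      have pz: "polyb z" unfolding z_def by simp
      have qz: "q i e (x + y) - q m e x = z (x, y)" for y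
        unfolding q_def z_def a_def b_def c_def d_def by (simp add: algebra_simps)
      have i1: "integrable gm (\<lambda>y. z (x, y) - z (x, y) ^ 3 / 12)"
        using sl[of "\<lambda>w. z w - z w ^ 3 / 12" x] pz by simp
      have i2: "integrable gm (\<lambda>y. main i e (x, y))"
        using sl[of "main i e" x] unfolding main_def by simp
      have "\<bar>(\<integral>y. z (x, y) - z (x, y) ^ 3 / 12 \<partial>gm) - (\<integral>y. main i e (x, y) \<partial>gm)\<bar>
          = \<bar>\<integral>y. (z (x, y) - z (x, y) ^ 3 / 12) - main i e (x, y) \<partial>gm\<bar>"
        unfolding Bochner_Integration.integral_diff[OF i1 i2] ..
      also have "\<dots> \<le> (\<integral>y. \<bar>(z (x, y) - z (x, y) ^ 3 / 12) - main i e (x, y)\<bar> \<partial>gm)"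
        by (rule integral_abs_bound)
      also have "\<dots> \<le> (\<integral>y. e ^ 5 * R i (x, y) \<partial>gm)"
      proof (rule integral_mono)
        show "integrable gm (\<lambda>y. \<bar>(z (x, y) - z (x, y) ^ 3 / 12) - main i e (x, y)\<bar>)"
          by (intro integrable_abs Bochner_Integration.integrable_diff i1 i2)
        show "integrable gm (\<lambda>y. e ^ 5 * R i (x, y))" using sl[OF pR[of i], of x] by simp
        show "\<bar>(z (x, y) - z (x, y) ^ 3 / 12) - main i e (x, y)\<bar> \<le> e ^ 5 * R i (x, y)" for y
          unfolding z_def main_def R_def by (rule cubic_remainder_bound[OF e])
      qed
      finally show "\<bar>(\<integral>y. (q i e (x + y) - q m e x) - (q i e (x + y) - q m e x) ^ 3 / 12 \<partial>gm) - (\<integral>y. main i e (x, y) \<partial>gm)\<bar>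
          \<le> e ^ 5 * (\<integral>y. R i (x, y) \<partial>gm)" unfolding qz by simp
    qed
    then show "\<bar>\<Sum>i<m. \<gamma> m i * (\<integral>y. (q i e (x + y) - q m e x) - (q i e (x + y) - q m e x) ^ 3 / 12 \<partial>gm)\<bar>
        \<le> e ^ 5 * (\<Sum>i<m. \<bar>\<gamma> m i\<bar> * (\<integral>y. R i (x, y) \<partial>gm))"
      unfolding zero by (simp add: sum_distrib_left mult.left_commute)
  qed
qed

section \<open>The scaled stage sets\<close>

definition S0 where "S0 = subgraph (\<lambda>x. f (x, 0))"
definition A where "A m e = {p. e *\<^sub>R p \<in> stage_set \<gamma> (e\<^sup>2) S0 m}"

lemma S0_borel: "S0 \<in> sets borel"
proof -
  have c: "continuous_on UNIV (\<lambda>x. f (x, 0))"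
    by (intro continuous_on_compose2[OF smooth_continuous[OF smooth]] continuous_intros) auto
  have "closed {p::(real^'n) \<times> real. snd p \<le> f (fst p, 0)}"
    by (intro closed_Collect_le continuous_intros continuous_on_compose2[OF c]) auto
  moreover have "S0 = {p. snd p \<le> f (fst p, 0)}" by (auto simp: S0_def subgraph_def)
  ultimately show ?thesis by (simp add: borel_closed)
qed

lemma A_borel: "A m e \<in> sets borel"
proof -
  have "(\<lambda>p. e *\<^sub>R p) -` stage_set \<gamma> (e\<^sup>2) S0 m \<inter> space borel \<in> sets (borel :: ((real^'n) \<times> real) measure)"
    by (rule measurable_sets[OF _ stage_set_borel[OF S0_borel]]) simp
  then show ?thesis by (simp add: A_def vimage_def)
qed

lemma conv_stage:
  assumes e: "0 < e"
  shows "conv (gauss_kernel (e\<^sup>2)) (\<lambda>y. \<Sum>i<m. \<gamma> m i * indicator (stage_set \<gamma> (e\<^sup>2) S0 i) y) (e *\<^sub>R p)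
    = (\<Sum>i<m. \<gamma> m i * (\<integral>z. indicator (A i e) (p + z) \<partial>gm))"
proof -
  have mS: "(\<lambda>y. \<Sum>i<m. \<gamma> m i * indicator (stage_set \<gamma> (e\<^sup>2) S0 i) y :: real) \<in> borel_measurable borel"
    using stage_set_borel[OF S0_borel] by (intro borel_measurable_sum borel_measurable_times) auto
  have "conv (gauss_kernel (e\<^sup>2)) (\<lambda>y. \<Sum>i<m. \<gamma> m i * indicator (stage_set \<gamma> (e\<^sup>2) S0 i) y) (e *\<^sub>R p)
    = (\<integral>z. (\<Sum>i<m. \<gamma> m i * indicator (stage_set \<gamma> (e\<^sup>2) S0 i) (e *\<^sub>R p + e *\<^sub>R z)) \<partial>gm)"
    by (rule conv_gauss_kernel[OF mS e])
  also have "\<dots> = (\<integral>z. (\<Sum>i<m. \<gamma> m i * indicator (A i e) (p + z)) \<partial>gm)"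
    by (simp add: A_def indicator_def scaleR_add_right[symmetric])
  also have "\<dots> = (\<Sum>i<m. \<gamma> m i * (\<integral>z. indicator (A i e) (p + z) \<partial>gm))"
  proof (subst Bochner_Integration.integral_sum)
    fix i
    have "polyb (\<lambda>z. indicator (A i e) (p + z) :: real)"
      by (rule polyb_translate) (simp add: A_borel)
    then show "integrable gm (\<lambda>z. \<gamma> m i * indicator (A i e) (p + z))" by (intro polyb_integrable) simp
  qed simp
  finally show ?thesis .
qed

text \<open>Taylor's formula of degree 5 is used only on \<open>|e x| <= 1\<close>, where division
  by \<open>e\<close> leaves an error \<open>C e^5 |x|^6\<close>. Beyond,
  \<open>1 <= (e |x|)^6\<close> makes the strip wider than the whole window, so the claim is vacuous
  and the growth of \<open>f\<close> is irrelevant.\<close>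

lemma sandwich_0: "sandwich 5 1 (A 0) (q 0)"
proof -
  obtain C where C: "C \<ge> 0" "\<And>x. norm x \<le> 1 \<Longrightarrow> \<bar>f (x, 0) - (\<Sum>i\<le>5. ray_deriv i f x 0 / fact i)\<bar> \<le> C * norm x ^ Suc 5"
    using space_Taylor[OF smooth, of 5] by blast
  obtain K N where K: "K \<ge> 0" "\<And>e x. 0 < e \<Longrightarrow> e < 1 \<Longrightarrow> \<bar>q 0 e x\<bar> \<le> K * e ^ 1 * (1 + norm x) ^ N"
    using BO_q by (rule BOE) (rule that)
  have q0: "e * q 0 e x = (\<Sum>i\<le>5. ray_deriv i f (e *\<^sub>R x) 0 / fact i)" for e x
  proof -
    have s: "{..5} = {0, 1, 2, 3, 4, 5::nat}" by auto
    have "ray_deriv 0 f (e *\<^sub>R x) 0 = 0" "ray_deriv 1 f (e *\<^sub>R x) 0 = 0" using f0 grad0 by simp_all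
    then have "(\<Sum>i\<le>5. ray_deriv i f (e *\<^sub>R x) 0 / fact i)
        = e ^ 2 * ray_deriv 2 f x 0 / 2 + e ^ 3 * ray_deriv 3 f x 0 / 6 + e ^ 4 * ray_deriv 4 f x 0 / 24 + e ^ 5 * ray_deriv 5 f x 0 / 120"
      unfolding s by (simp add: ray_deriv_scale fact_numeral del: ray_deriv.simps One_nat_def)
    then show ?thesis
      by (simp add: q_def P1_def P2_def P3_def P4_def power2_eq_square eval_nat_numeral algebra_simps del: ray_deriv.simps)
  qed
  have "(x, v) \<in> A 0 e \<longleftrightarrow> v < q 0 e x"
    if e: "0 < e" "e < 1" and v: "\<bar>v\<bar> \<le> 1 / e" and big: "(C + 1 + K) * e ^ 5 * (1 + norm x) ^ (N + 6) < \<bar>v - q 0 e x\<bar>" for e x v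
  proof (cases "norm (e *\<^sub>R x) \<le> 1")
    case True
    have "\<bar>f (e *\<^sub>R x, 0) - e * q 0 e x\<bar> \<le> C * norm (e *\<^sub>R x) ^ 6"
      using C(2)[OF True] by (simp add: q0)
    also have "\<dots> = e * (C * e ^ 5 * norm x ^ 6)" using e by (simp add: power_mult_distrib eval_nat_numeral)
    also have "\<dots> \<le> e * ((C + 1 + K) * e ^ 5 * (1 + norm x) ^ (N + 6))"
    proof -
      have "norm x ^ 6 \<le> (1 + norm x) ^ 6" by (intro power_mono) auto
      also have "\<dots> \<le> (1 + norm x) ^ (N + 6)" by (intro power_increasing) auto
      finally show ?thesis using e C K by (intro mult_left_mono mult_mono) auto
    qed
    also have "\<dots> < e * \<bar>v - q 0 e x\<bar>" using big e by (intro mult_strict_left_mono) auto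
    finally have 1: "\<bar>f (e *\<^sub>R x, 0) - e * q 0 e x\<bar> < \<bar>e * v - e * q 0 e x\<bar>" using e by (simp add: abs_mult right_diff_distrib[symmetric])
    have "(x, v) \<in> A 0 e \<longleftrightarrow> e * v \<le> f (e *\<^sub>R x, 0)" by (simp add: A_def S0_def subgraph_def)
    also have "\<dots> \<longleftrightarrow> e * v < e * q 0 e x" using 1 by linarith
    also have "\<dots> \<longleftrightarrow> v < q 0 e x" using e by simp
    finally show ?thesis .
  next
    case False
    then have 1: "1 \<le> e * norm x" using e by simp
    define L where "L = 1 + norm x"
    have L: "1 \<le> L" "norm x \<le> L" by (simp_all add: L_def)
    have "1 \<le> (e * norm x) ^ 6" using 1 by (rule one_le_power)
    also have "\<dots> \<le> (e * L) ^ 6" using e L by (intro power_mono mult_left_mono) auto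
    finally have "1 / e \<le> e ^ 5 * L ^ 6" using e by (simp add: power_mult_distrib eval_nat_numeral field_simps)
    also have "\<dots> \<le> e ^ 5 * L ^ (N + 6)" using e L by (intro mult_left_mono power_increasing) auto
    finally have v': "\<bar>v\<bar> \<le> 1 * e ^ 5 * L ^ (N + 6)" using v by simp
    have "\<bar>q 0 e x\<bar> \<le> K * e * L ^ N" using K(2)[OF e, of x] by (simp add: L_def)
    also have "\<dots> \<le> K * 1 * L ^ N" using e K L by (intro mult_left_mono mult_right_mono) auto
    also have "\<dots> \<le> K * (e * L) ^ 5 * L ^ N"
    proof -
      have "1 \<le> (e * norm x) ^ 5" using 1 by (rule one_le_power)
      also have "\<dots> \<le> (e * L) ^ 5" using e L by (intro power_mono mult_left_mono) auto
      finally show ?thesis using K L by (intro mult_right_mono mult_left_mono) auto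
    qed
    also have "\<dots> = K * e ^ 5 * L ^ (N + 5)" by (simp add: power_mult_distrib power_add)
    also have "\<dots> \<le> K * e ^ 5 * L ^ (N + 6)" using e K L by (intro mult_left_mono power_increasing) auto
    finally have "\<bar>v - q 0 e x\<bar> \<le> 1 * e ^ 5 * L ^ (N + 6) + K * e ^ 5 * L ^ (N + 6)" using v' by linarith
    also have "\<dots> = (1 + K) * e ^ 5 * L ^ (N + 6)" by (simp add: distrib_right)
    also have "\<dots> \<le> (C + 1 + K) * e ^ 5 * L ^ (N + 6)" using e C L by (intro mult_right_mono) auto
    finally show ?thesis using big by (simp add: L_def)
  qed
  then show ?thesis unfolding sandwich_def using C K by (intro exI[of _ "C + 1 + K"] conjI exI[of _ "N + 6"]) auto
qed

text \<open>The window is halved at every stage, because averaging needs a margin inside the windows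
  of all earlier stages. Finitely many stages leave a window whose unscaled size does not depend on
  the time step.\<close>

lemma sandwich_stage: "m \<le> M \<Longrightarrow> sandwich 5 ((1/2) ^ m) (A m) (q m)"
proof (induction m rule: less_induct)
  case (less m)
  show ?case
  proof (cases "m = 0")
    case True
    then show ?thesis using sandwich_0 by simp
  next
    case False
    then obtain n where n: "m = Suc n" by (cases m) auto
    have sand: "sandwich 5 ((1/2) ^ n) (A i) (q i)" if "i \<in> {..<m}" for i
      using that n less.prems by (intro sandwich_mono[OF less.IH] power_decreasing) auto
    have m: "1 \<le> m" using n by simp
    have "\<exists>C\<ge>0. \<exists>N. \<forall>e x v. 0 < e \<longrightarrow> e < 1 \<longrightarrow> \<bar>v\<bar> \<le> (1/2) ^ n / 2 / e \<longrightarrow>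
       C * e ^ 5 * (1 + norm x) ^ N < \<bar>v - q m e x\<bar> \<longrightarrow>
       (v < q m e x \<longrightarrow> 1 / 2 < (\<Sum>i<m. \<gamma> m i * (\<integral>p. indicator (A i e) ((x, v) + p) \<partial>gm))) \<and>
       (q m e x < v \<longrightarrow> (\<Sum>i<m. \<gamma> m i * (\<integral>p. indicator (A i e) ((x, v) + p) \<partial>gm)) < 1 / 2)"
      by (rule stage_expansion[OF finite_lessThan sum_gamma[OF m less.prems] _ _ _ sand A_borel q_measurable BO_q BO_q q_residual[OF m less.prems]])
        simp_all
    then obtain C N where C: "C \<ge> 0" and sg: "\<And>e x v. 0 < e \<Longrightarrow> e < 1 \<Longrightarrow> \<bar>v\<bar> \<le> (1/2) ^ n / 2 / e \<Longrightarrow>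
       C * e ^ 5 * (1 + norm x) ^ N < \<bar>v - q m e x\<bar> \<Longrightarrow>
       (v < q m e x \<longrightarrow> 1 / 2 < (\<Sum>i<m. \<gamma> m i * (\<integral>p. indicator (A i e) ((x, v) + p) \<partial>gm))) \<and>
       (q m e x < v \<longrightarrow> (\<Sum>i<m. \<gamma> m i * (\<integral>p. indicator (A i e) ((x, v) + p) \<partial>gm)) < 1 / 2)"
      by blast
    have "(x, v) \<in> A m e \<longleftrightarrow> v < q m e x"
      if e: "0 < e" "e < 1" and v: "\<bar>v\<bar> \<le> (1/2) ^ m / e" and big: "C * e ^ 5 * (1 + norm x) ^ N < \<bar>v - q m e x\<bar>" for e x v
    proof -
      have "(x, v) \<in> A m e \<longleftrightarrow> 1 / 2 \<le> (\<Sum>i<m. \<gamma> m i * (\<integral>p. indicator (A i e) ((x, v) + p) \<partial>gm))"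
        using m unfolding A_def[of m] conv_stage[OF e(1), symmetric] by (simp add: stage_set_pos)
      moreover have "0 \<le> C * e ^ 5 * (1 + norm x) ^ N" using C e by simp
      ultimately show ?thesis using sg[OF e _ big] v n big by (cases v "q m e x" rule: linorder_cases) auto
    qed
    then show ?thesis unfolding sandwich_def using C by blast
  qed
qed

end

section \<open>The coefficients\<close>

lemma R_const_cube:
  "R_const ^ 3 = 73547857887405865499600064 * sqrt 133495318877644714344377 - 23474745371243059566207357648855848671"
  unfolding R_const_def by (rule odd_real_root_pow) simp

text \<open>By monotonicity of the cube root the bounds reduce to an enclosure of the inner square
  root. The many digits there compensate for its factor of 26 digits and for the subtraction of a
  number of comparable size.\<close>

lemma R_const_bounds: "1503317651678 \<le> R_const" "R_const \<le> 1503317651679"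
proof -
  define D where "D = sqrt 133495318877644714344377"
  have "(365370112184.405026407)\<^sup>2 \<le> (133495318877644714344377::real)" by (simp add: power2_eq_square)
  then have 1: "365370112184.405026407 \<le> D" unfolding D_def by (rule real_le_rsqrt)
  have 2: "D \<le> 365370112184.405026427" unfolding D_def by (rule real_le_lsqrt) (simp_all add: power2_eq_square)
  have "root 3 (1503317651678 ^ 3) \<le> R_const"
    unfolding R_const_def D_def[symmetric] using 1 by (intro real_root_le_mono) simp_all
  also have "root 3 (1503317651678 ^ 3) = (1503317651678::real)" by (rule real_root_power_cancel) simp_all
  finally show "1503317651678 \<le> R_const" .
  have "R_const \<le> root 3 (1503317651679 ^ 3)"
    unfolding R_const_def D_def[symmetric] using 2 by (intro real_root_le_mono) simp_all
  also have "root 3 (1503317651679 ^ 3) = (1503317651679::real)" by (rule real_root_power_cancel) simp_all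
  finally show "R_const \<le> 1503317651679" .
qed

text \<open>
  Cardano: \<open>X = R - K/R\<close> solves \<open>X\<^sup>3 + 3 K X + 2 s = 0\<close>, where \<open>R\<^sup>3 = a \<surd>D - s\<close>
  and \<open>a\<^sup>2 D - s\<^sup>2 = K\<^sup>3\<close>. Both coefficients are polynomials in \<open>X\<close>.
\<close>

lemma gamma42_cubic:
  "3627134098848 * gamma42 ^ 3 + 1368327589725 * gamma42\<^sup>2 + 4763335146136 * gamma42 + 4153208362348 = 0"
  and gamma43_eq:
  "gamma43 = (7254268197696 * gamma42\<^sup>2 - 9349194548616 * gamma42 + 9228475485984) / 10138563378559"
proof -
  define K s where "K = (5551049511730043591353151::real)" and "s = (23474745371243059566207357648855848671::real)"
  define X where "X = R_const - K / R_const"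
  have R0: "R_const \<noteq> 0" using R_const_bounds by auto
  have "R_const ^ 3 * (R_const ^ 3 + 2 * s)
      = (73547857887405865499600064 * sqrt 133495318877644714344377)\<^sup>2 - s\<^sup>2"
    unfolding R_const_cube s_def by (simp add: power2_eq_square algebra_simps)
  also have "\<dots> = K ^ 3"
    unfolding power_mult_distrib K_def s_def by simp
  finally have K3: "R_const ^ 3 * (R_const ^ 3 + 2 * s) = K ^ 3" .
  have "X ^ 3 = R_const ^ 3 - K ^ 3 / R_const ^ 3 - 3 * K * X"
    using R0 unfolding X_def by (simp add: field_simps power2_eq_square power3_eq_cube)
  also have "K ^ 3 / R_const ^ 3 = R_const ^ 3 + 2 * s"
    using R0 unfolding K3[symmetric] by simp
  finally have X3: "X ^ 3 + 3 * K * X + 2 * s = 0" by simp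
  have g42: "X = 3627134098848 * gamma42 + 456109196575"
    unfolding gamma42_def X_def K_def by (simp add: field_simps)
  show "3627134098848 * gamma42 ^ 3 + 1368327589725 * gamma42\<^sup>2 + 4763335146136 * gamma42 + 4153208362348 = 0"
    using X3 unfolding g42 K_def s_def by (simp add: power2_eq_square power3_eq_cube algebra_simps)
  have "X\<^sup>2 = R_const\<^sup>2 - 2 * K + K\<^sup>2 / R_const\<^sup>2"
    using R0 unfolding X_def by (simp add: field_simps power2_eq_square)
  then have "gamma43 = 1 / 18386964471851466374900016 * (X\<^sup>2 + 2 * K - 5586815667458 * X + 7974522440634228925392639)"
    unfolding gamma43_def X_def K_def by (simp add: algebra_simps)
  then show "gamma43 = (7254268197696 * gamma42\<^sup>2 - 9349194548616 * gamma42 + 9228475485984) / 10138563378559"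
    unfolding g42 K_def by (simp add: power2_eq_square field_simps)
qed

text \<open>A few digits suffice for the energy inequality and for
  \<open>stage_beta gamma_coeffs 4 > 0\<close>, which are stable under small changes; the exact
  algebraic values enter only in the second order identity.\<close>

lemma gamma42_bounds: "- 0.7294 \<le> gamma42" "gamma42 \<le> - 0.7292"
proof -
  have "5551049511730043591353151 / R_const \<le> 5551049511730043591353151 / 1503317651678"
    "5551049511730043591353151 / 1503317651679 \<le> 5551049511730043591353151 / R_const"
    using R_const_bounds by (intro divide_left_mono; simp)+
  then show "- 0.7294 \<le> gamma42" "gamma42 \<le> - 0.7292"
    using R_const_bounds unfolding gamma42_def by simp_all
qed

lemma gamma43_bounds: "1.963 \<le> gamma43" "gamma43 \<le> 1.964"
proof -
  have "0.7292\<^sup>2 \<le> gamma42\<^sup>2" "gamma42\<^sup>2 \<le> 0.7294\<^sup>2"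
    using gamma42_bounds power_mono[of "0.7292" "- gamma42" 2] power_mono[of "- gamma42" "0.7294" 2] by simp_all
  then show "1.963 \<le> gamma43" "gamma43 \<le> 1.964"
    using gamma42_bounds unfolding gamma43_eq by (simp_all add: power2_eq_square field_simps)
qed

section \<open>Row sums, stage times and the energy form\<close>

lemma gamma_coeffs_simps [simp]:
  "gamma_coeffs (Suc 0) 0 = 1"
  "gamma_coeffs 2 0 = - 1/4" "gamma_coeffs 2 (Suc 0) = 5/4"
  "gamma_coeffs 3 0 = 5/6" "gamma_coeffs 3 (Suc 0) = - 2/3" "gamma_coeffs 3 2 = 5/6"
  "gamma_coeffs 4 0 = 1/2 - gamma42 - gamma43" "gamma_coeffs 4 (Suc 0) = 1/2"
  "gamma_coeffs 4 2 = gamma42" "gamma_coeffs 4 3 = gamma43"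
  by (simp_all add: gamma_coeffs_def numeral_eq_Suc)

lemma less4_cases:
  fixes m :: nat
  assumes "m < 4" "P 0" "P 1" "P 2" "P 3"
  shows "P m"
proof -
  have "m = 0 \<or> m = 1 \<or> m = 2 \<or> m = 3" using assms(1) by auto
  then show ?thesis using assms by auto
qed

lemma sum_less_4:
  fixes f :: "nat \<Rightarrow> 'a::comm_monoid_add"
  shows "sum f {..<1} = f 0" "sum f {..<2} = f 0 + f 1" "sum f {..<3} = f 0 + f 1 + f 2"
    "sum f {..<4} = f 0 + f 1 + f 2 + f 3"
  by (simp_all add: numeral_eq_Suc)

lemma gamma_coeffs_sum: 
  assumes "m < 4"
  shows "(\<Sum>i<Suc m. gamma_coeffs (Suc m) i) = 1"
  by (rule less4_cases[OF assms]) (simp_all add: gamma_coeffs_def numeral_eq_Suc)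

lemma stage_beta_gamma_coeffs [simp]:
  "stage_beta gamma_coeffs 0 = 0" "stage_beta gamma_coeffs (Suc 0) = 1" "stage_beta gamma_coeffs 2 = 9/4"
  "stage_beta gamma_coeffs 3 = 53/24"
  and stage_beta_4: "stage_beta gamma_coeffs 4 = 3/2 + 9/4 * gamma42 + 53/24 * gamma43"
proof -
  show 0: "stage_beta gamma_coeffs 0 = 0" by (subst stage_beta.simps) simp
  show 1: "stage_beta gamma_coeffs (Suc 0) = 1" by (subst stage_beta.simps) (simp add: 0)
  show 2: "stage_beta gamma_coeffs 2 = 9/4" by (subst stage_beta.simps) (simp add: sum_less_4 0 1)
  show 3: "stage_beta gamma_coeffs 3 = 53/24" by (subst stage_beta.simps) (simp add: sum_less_4 0 1 2)
  show "stage_beta gamma_coeffs 4 = 3/2 + 9/4 * gamma42 + 53/24 * gamma43"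
    by (subst stage_beta.simps) (simp add: sum_less_4 0 1 2 3)
qed

lemma stage_beta_4_pos: "stage_beta gamma_coeffs 4 > 0"
  unfolding stage_beta_4 using gamma42_bounds gamma43_bounds by simp

text \<open>
  The form is a rationally rounded \<open>L D L\<^sup>T\<close> decomposition at \<open>(-0.7293, 1.9633)\<close> plus a
  diagonally dominant remainder.
\<close>

lemma gamma_coeffs_form_nonneg:
  fixes t :: real and d :: "nat \<Rightarrow> 'a::euclidean_space \<Rightarrow> real"
  assumes t: "t > 0" and bd: "\<And>i. bdd_int (d i)" and d0: "d 0 = (\<lambda>_. 0)"
  shows "0 \<le> gauss_form t (d 4) (d 4)
         - 2 * (\<Sum>m<4. \<Sum>i<Suc m. gamma_coeffs (Suc m) i * gauss_form t (\<lambda>x. d (Suc m) x - d m x) (d i))"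
proof -
  define b where "b i j = gauss_form t (d i) (d j)" for i j
  have diff: "gauss_form t (\<lambda>x. d i x - d j x) (d k) = b i k - b j k" for i j k
    unfolding b_def by (rule gauss_form_diff_left[OF t bd bd bd])
  have sym: "b i j = b j i" for i j unfolding b_def by (rule gauss_form_commute[OF t bd bd])
  \<comment> \<open>Since \<open>d 0 = 0\<close>, the first column \<open>gamma_coeffs m 0\<close>
    drops out of the form.\<close>
  have z: "b 0 j = 0" "b i 0 = 0" for i j
    using sym[of i 0] sym[of 0 i] by (auto simp: b_def d0 gauss_form_def gauss_op_def)
  \<comment> \<open>Positive semidefiniteness of the Gram matrix \<open>b\<close>, tested on an
    arbitrary vector \<open>c1, ..., c4\<close>.\<close>
  have lin: "0 \<le> c1 * (c1 * b 1 1 + c2 * b 1 2 + c3 * b 1 3 + c4 * b 1 4)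
     + c2 * (c1 * b 1 2 + c2 * b 2 2 + c3 * b 2 3 + c4 * b 2 4)
     + c3 * (c1 * b 1 3 + c2 * b 2 3 + c3 * b 3 3 + c4 * b 3 4)
     + c4 * (c1 * b 1 4 + c2 * b 2 4 + c3 * b 3 4 + c4 * b 4 4)" for c1 c2 c3 c4
  proof -
    define e where "e x = c1 * d 1 x + c2 * d 2 x + c3 * d 3 x + c4 * d 4 x" for x
    have be: "bdd_int e" unfolding e_def by (intro bdd_int_add bdd_int_scale bd)
    have e: "gauss_form t e f = c1 * gauss_form t (d 1) f + c2 * gauss_form t (d 2) f + c3 * gauss_form t (d 3) f + c4 * gauss_form t (d 4) f"
      if "bdd_int f" for f
      unfolding e_def
      by (simp add: gauss_form_add_left[OF t] gauss_form_scale_left[OF t] bdd_int_add bdd_int_scale bd that)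
    have e': "gauss_form t (d i) e = c1 * b 1 i + c2 * b 2 i + c3 * b 3 i + c4 * b 4 i" for i
      using e[OF bd, of i] gauss_form_commute[OF t bd be, of i] by (simp add: b_def)
    have "0 \<le> gauss_form t e e" by (rule gauss_form_nonneg'[OF t be])
    then show ?thesis
      unfolding e[OF be] e'
      by (simp add: sym[of 2 1] sym[of 3 1] sym[of 4 1] sym[of 3 2] sym[of 4 2] sym[of 4 3] del: One_nat_def)
  qed
  \<comment> \<open>Deviations from the decimal coefficients at which the decomposition is made;
    they enter linearly and are absorbed by \<open>pert\<close>.\<close>
  define x y where "x = gamma42 + 0.7293" and "y = gamma43 - 1.9633"
  have xy: "\<bar>x\<bar> \<le> 0.001" "\<bar>y\<bar> \<le> 0.001"
    using gamma42_bounds gamma43_bounds unfolding x_def y_def abs_le_iff by simp_all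
  have off: "2 * \<bar>b i j\<bar> \<le> b i i + b j j" for i j
  proof -
    have "0 \<le> gauss_form t (\<lambda>x. d i x - d j x) (\<lambda>x. d i x - d j x)"
      by (intro gauss_form_nonneg'[OF t] bdd_int_diff bd)
    also have "\<dots> = b i i + b j j - 2 * b i j"
      using gauss_form_commute[OF t bd bdd_int_diff[OF bd bd], of _ i j]
      by (simp add: gauss_form_diff_left[OF t bd bd bdd_int_diff[OF bd bd]] diff sym[of j i])
    finally have 1: "0 \<le> b i i + b j j - 2 * b i j" .
    have "0 \<le> gauss_form t (\<lambda>x. d i x + d j x) (\<lambda>x. d i x + d j x)"
      by (intro gauss_form_nonneg'[OF t] bdd_int_add bd)
    also have "\<dots> = b i i + b j j + 2 * b i j"
      using gauss_form_commute[OF t bd bdd_int_add[OF bd bd], of _ i j]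
      by (simp add: gauss_form_add_left[OF t bd bd bdd_int_add[OF bd bd]] gauss_form_add_left[OF t bd bd bd] sym[of j i] flip: b_def)
    finally show ?thesis using 1 by linarith
  qed
  have pert: "2 * (c * b i j) \<le> 1/1000 * (b i i + b j j)" "- (2 * (c * b i j)) \<le> 1/1000 * (b i i + b j j)"
    if "\<bar>c\<bar> \<le> 0.001" for c i j
    using mult_mono[OF that off[of i j]] by (simp_all add: abs_mult[symmetric] abs_le_iff)
  have eq: "gauss_form t (d 4) (d 4)
         - 2 * (\<Sum>m<4. \<Sum>i<Suc m. gamma_coeffs (Suc m) i * gauss_form t (\<lambda>x. d (Suc m) x - d m x) (d i))
    = (b 4 4 - 2 * (5/4 * (b 1 2 - b 1 1) + (- 2/3 * (b 1 3 - b 1 2) + 5/6 * (b 2 3 - b 2 2))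
       + (1/2 * (b 1 4 - b 1 3) + (- 0.7293) * (b 2 4 - b 2 3) + 1.9633 * (b 3 4 - b 3 3))))
      - 2 * (x * b 2 4 - x * b 2 3 + y * b 3 4 - y * b 3 3)"
  proof -
    have s: "(\<Sum>i<Suc m. gamma_coeffs (Suc m) i * gauss_form t (\<lambda>x. d (Suc m) x - d m x) (d i))
       = (\<Sum>i<Suc m. gamma_coeffs (Suc m) i * (b (Suc m) i - b m i))" for m
      unfolding diff ..
    have n: "Suc 0 = 1" "Suc 1 = 2" "Suc 2 = 3" "Suc 3 = 4" by simp_all
    show ?thesis
      unfolding s sum_less_4(4) n sum_less_4
      by (simp add: gamma_coeffs_simps[unfolded One_nat_def[symmetric]] z b_def[symmetric] x_def y_def algebra_simps
            sym[of 2 1] sym[of 3 1] sym[of 4 1] sym[of 3 2] sym[of 4 2] sym[of 4 3] del: One_nat_def) (simp add: field_simps)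
  qed
  define F where "F c1 c2 c3 c4 = c1 * (c1 * b 1 1 + c2 * b 1 2 + c3 * b 1 3 + c4 * b 1 4)
     + c2 * (c1 * b 1 2 + c2 * b 2 2 + c3 * b 2 3 + c4 * b 2 4)
     + c3 * (c1 * b 1 3 + c2 * b 2 3 + c3 * b 3 3 + c4 * b 3 4)
     + c4 * (c1 * b 1 4 + c2 * b 2 4 + c3 * b 3 4 + c4 * b 4 4)" for c1 c2 c3 c4
  have F0: "0 \<le> F c1 c2 c3 c4" for c1 c2 c3 c4 unfolding F_def by (rule lin)
  \<comment> \<open>The arguments of each \<open>F\<close> are a column of \<open>L\<close>, its
    weight is a pivot, and elimination runs from index 4 down to 1. The pivots are chosen slightly
    too small, as in 99/100 for the coefficient 1 of \<open>b 4 4\<close>; this leaves positive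
    diagonal entries in the remainder.\<close>
  have dec: "b 4 4 - 2 * (5/4 * (b 1 2 - b 1 1) + (- 2/3 * (b 1 3 - b 1 2) + 5/6 * (b 2 3 - b 2 2))
       + (1/2 * (b 1 4 - b 1 3) + (- 0.7293) * (b 2 4 - b 2 3) + 1.9633 * (b 3 4 - b 3 3)))
    = 99/100 * F (- 101/200) (737/1000) (- 1983/1000) 1 + 23/1000 * F (3787/500) (- 629/125) 1 0
      + 267/500 * F (- 1249/1000) 1 0 0 + 39/500 * F 1 0 0 0
      + ((1067423/62500000) * b 1 1 + (18818707/1500000000) * b 2 2 + (1063389/100000000) * b 3 3 + (1/100) * b 4 4 + (- 6979579/750000000) * b 1 2 + (63829/30000000) * b 1 3 + (- 1/10000) * b 1 4 + (- 12313/150000000) * b 2 3 + (- 33/50000) * b 2 4 + (- 13/50000) * b 3 4)"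
    unfolding F_def by (simp add: field_simps)
  have tt: "- s * (b i i + b j j) \<le> r * b i j" if "\<bar>r\<bar> \<le> 2 * s" for r s i j
  proof -
    have "\<bar>r * b i j\<bar> \<le> (2 * s) * \<bar>b i j\<bar>" unfolding abs_mult using that by (rule mult_right_mono) simp
    also have "\<dots> = s * (2 * \<bar>b i j\<bar>)" by simp
    also have "\<dots> \<le> s * (b i i + b j j)" using that off by (intro mult_left_mono) auto
    finally show ?thesis by simp
  qed
  \<comment> \<open>Half of each off-diagonal coefficient, rounded up, is charged to each of its two
    diagonal entries.\<close>
  have t0: "- (233/50000) * (b 1 1 + b 2 2) \<le> (- 6979579/750000000) * b 1 2" by (rule tt) simp
  have t1: "- (107/100000) * (b 1 1 + b 3 3) \<le> (63829/30000000) * b 1 3" by (rule tt) simp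
  have t2: "- (1/20000) * (b 1 1 + b 4 4) \<le> (- 1/10000) * b 1 4" by (rule tt) simp
  have t3: "- (1/20000) * (b 2 2 + b 3 3) \<le> (- 12313/150000000) * b 2 3" by (rule tt) simp
  have t4: "- (33/100000) * (b 2 2 + b 4 4) \<le> (- 33/50000) * b 2 4" by (rule tt) simp
  have t5: "- (13/100000) * (b 3 3 + b 4 4) \<le> (- 13/50000) * b 3 4" by (rule tt) simp
  have bpos: "0 \<le> b i i" for i using off[of i i] by linarith
  have u0: "0 \<le> ((- 6979579/750000000) * b 1 2 + (233/50000) * (b 1 1 + b 2 2))" using t0 by linarith
  have u1: "0 \<le> ((63829/30000000) * b 1 3 + (107/100000) * (b 1 1 + b 3 3))" using t1 by linarith
  have u2: "0 \<le> ((- 1/10000) * b 1 4 + (1/20000) * (b 1 1 + b 4 4))" using t2 by linarith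
  have u3: "0 \<le> ((- 12313/150000000) * b 2 3 + (1/20000) * (b 2 2 + b 3 3))" using t3 by linarith
  have u4: "0 \<le> ((- 33/50000) * b 2 4 + (33/100000) * (b 2 2 + b 4 4))" using t4 by linarith
  have u5: "0 \<le> ((- 13/50000) * b 3 4 + (13/100000) * (b 3 3 + b 4 4))" using t5 by linarith
  have u6: "0 \<le> (1/1000 * (b 2 2 + b 4 4) - 2 * (x * b 2 4))" using pert(1)[OF xy(1), of 2 4] by linarith
  have u7: "0 \<le> (1/1000 * (b 2 2 + b 3 3) + 2 * (x * b 2 3))" using pert(2)[OF xy(1), of 2 3] by linarith
  have u8: "0 \<le> (1/1000 * (b 3 3 + b 4 4) - 2 * (y * b 3 4))" using pert(1)[OF xy(2), of 3 4] by linarith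
  have u9: "0 \<le> (1/1000 * (b 3 3 + b 3 3) + 2 * (y * b 3 3))" using pert(2)[OF xy(2), of 3 3] by linarith
  \<comment> \<open>What is left of each diagonal coefficient after these charges and those of
    1/1000 for \<open>x\<close> and \<open>y\<close>.\<close>
  have u10: "0 \<le> 706173/62500000 * b 1 1" using bpos[of 1] by simp
  have u11: "0 \<le> 8258707/1500000000 * b 2 2" using bpos[of 2] by simp
  have u12: "0 \<le> 538389/100000000 * b 3 3" using bpos[of 3] by simp
  have u13: "0 \<le> 749/100000 * b 4 4" using bpos[of 4] by simp
  have "0 \<le> ((- 6979579/750000000) * b 1 2 + (233/50000) * (b 1 1 + b 2 2)) + ((63829/30000000) * b 1 3 + (107/100000) * (b 1 1 + b 3 3)) + ((- 1/10000) * b 1 4 + (1/20000) * (b 1 1 + b 4 4)) + ((- 12313/150000000) * b 2 3 + (1/20000) * (b 2 2 + b 3 3)) + ((- 33/50000) * b 2 4 + (33/100000) * (b 2 2 + b 4 4)) + ((- 13/50000) * b 3 4 + (13/100000) * (b 3 3 + b 4 4)) + (1/1000 * (b 2 2 + b 4 4) - 2 * (x * b 2 4)) + (1/1000 * (b 2 2 + b 3 3) + 2 * (x * b 2 3)) + (1/1000 * (b 3 3 + b 4 4) - 2 * (y * b 3 4)) + (1/1000 * (b 3 3 + b 3 3) + 2 * (y * b 3 3)) + 706173/62500000 * b 1 1 + 8258707/1500000000 * b 2 2 + 538389/100000000 * b 3 3 + 749/100000 * b 4 4"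
    by (rule add_nonneg_nonneg[OF add_nonneg_nonneg[OF add_nonneg_nonneg[OF add_nonneg_nonneg[OF add_nonneg_nonneg[OF add_nonneg_nonneg[OF add_nonneg_nonneg[OF add_nonneg_nonneg[OF add_nonneg_nonneg[OF add_nonneg_nonneg[OF add_nonneg_nonneg[OF add_nonneg_nonneg[OF add_nonneg_nonneg[OF u0 u1] u2] u3] u4] u5] u6] u7] u8] u9] u10] u11] u12] u13])
  also have "\<dots> = ((1067423/62500000) * b 1 1 + (18818707/1500000000) * b 2 2 + (1063389/100000000) * b 3 3 + (1/100) * b 4 4 + (- 6979579/750000000) * b 1 2 + (63829/30000000) * b 1 3 + (- 1/10000) * b 1 4 + (- 12313/150000000) * b 2 3 + (- 33/50000) * b 2 4 + (- 13/50000) * b 3 4) - 2 * (x * b 2 4 - x * b 2 3 + y * b 3 4 - y * b 3 3)"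
    by (simp add: field_simps)
  finally have rest: "0 \<le> ((1067423/62500000) * b 1 1 + (18818707/1500000000) * b 2 2 + (1063389/100000000) * b 3 3 + (1/100) * b 4 4 + (- 6979579/750000000) * b 1 2 + (63829/30000000) * b 1 3 + (- 1/10000) * b 1 4 + (- 12313/150000000) * b 2 3 + (- 33/50000) * b 2 4 + (- 13/50000) * b 3 4) - 2 * (x * b 2 4 - x * b 2 3 + y * b 3 4 - y * b 3 3)" .
  have n: "0 \<le> k * F c1 c2 c3 c4" if "0 \<le> k" for k c1 c2 c3 c4
    using that F0 by (rule mult_nonneg_nonneg)
  have "0 \<le> (99/100 * F (- 101/200) (737/1000) (- 1983/1000) 1 + 23/1000 * F (3787/500) (- 629/125) 1 0
      + 267/500 * F (- 1249/1000) 1 0 0 + 39/500 * F 1 0 0 0)"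
    by (intro add_nonneg_nonneg n) simp_all
  from add_nonneg_nonneg[OF this rest] show ?thesis
    unfolding eq dec by (simp only: add_diff_eq)
qed

theorem gamma_coeffs_energy_stable: "energy_stable TYPE('a::euclidean_space) 4 gamma_coeffs"
  unfolding energy_stable_def
proof (intro allI impI)
  fix dt :: real and S :: "'a set"
  assume dt: "dt > 0" and S: "S \<in> sets lebesgue"
  define t where "t = kernel_time 4 gamma_coeffs dt"
  have t: "t > 0" using dt stage_beta_4_pos by (simp add: t_def kernel_time_def)
  obtain T where T: "T \<in> sets borel" "AE x in lborel. x \<in> S \<longleftrightarrow> x \<in> T"
    using lebesgue_sets_AE_borel[OF S] by blast
  have "energy t (stage_set gamma_coeffs t T 4) \<le> energy t T"
    by (rule stage_energy_le[OF t T(1) gamma_coeffs_sum gamma_coeffs_form_nonneg[OF t]])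
  then show "energy (kernel_time 4 gamma_coeffs dt) (threshold_step 4 gamma_coeffs dt S) \<le> energy (kernel_time 4 gamma_coeffs dt) S"
    using stage_set_cong_AE[OF S T, of 4 gamma_coeffs t] energy_cong_AE[OF S T, of t]
    by (simp add: threshold_step_def t_def)
qed

section \<open>Accuracy\<close>

context stage_profiles
begin

text \<open>On the axis parity leaves \<open>e * q = e^2 P1 + e^4 P3\<close>, that is
  \<open>\<tau> P1 + \<tau>^2 P3\<close>, and the error \<open>C * e ^ 5\<close> of the scaled
  crossing becomes \<open>C \<tau>^3\<close>. The radius comes from the window of the stages that
  the last threshold averages, so it does not depend on the time step.\<close>

lemma threshold_expansion:
  assumes \<beta>: "stage_beta \<gamma> M > 0"
  defines "\<tau> \<equiv> \<lambda>dt. dt / stage_beta \<gamma> M"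
  shows "\<exists>r>0. \<exists>z. (\<forall>\<^sub>F dt in at_right 0. {s. \<bar>s\<bar> < r \<and> (0, s) \<in> frontier (threshold_step M \<gamma> dt S0)} = {z dt}) \<and>
    (\<lambda>dt. z dt - (\<tau> dt * P1 M 0 + (\<tau> dt)\<^sup>2 * P3 M 0)) \<in> O[at_right 0](\<lambda>dt. dt ^ 3)"
proof -
  \<comment> \<open>The last threshold averages over the stages below \<open>M\<close>; their common
    window is that of stage \<open>M - 1\<close>.\<close>
  define \<rho> :: real where "\<rho> = (1/2) ^ (M - 1)"
  have \<rho>: "\<rho> > 0" by (simp add: \<rho>_def)
  have sand: "sandwich 5 \<rho> (A i) (q i)" if "i \<in> {..<M}" for i
    unfolding \<rho>_def using that by (intro sandwich_mono[OF sandwich_stage] power_decreasing) auto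
  define u where "u e = (\<lambda>y. \<Sum>i<M. \<gamma> M i * indicator (stage_set \<gamma> (e\<^sup>2) S0 i) y :: real)" for e
  define U where "U e = conv (gauss_kernel (e\<^sup>2)) (u e)" for e
  define W where "W e v = (\<Sum>i<M. \<gamma> M i * (\<integral>p. indicator (A i e) ((0, v) + p) \<partial>gm))" for e v
  have WU: "W e v = U e (0, e * v)" if "0 < e" for e v
    using conv_stage[OF that, of M "(0, v)"] by (simp add: W_def U_def u_def)
  have cU: "continuous_on UNIV (U e)" if "0 < e" for e
    unfolding U_def
  proof (rule continuous_conv_gauss_kernel)
    show "u e \<in> borel_measurable borel"
      unfolding u_def using stage_set_borel[OF S0_borel] by (intro borel_measurable_sum borel_measurable_times) auto
    have "\<bar>u e y\<bar> \<le> (\<Sum>i<M. \<bar>\<gamma> M i * indicator (stage_set \<gamma> (e\<^sup>2) S0 i) y\<bar>)" for y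
      unfolding u_def by (rule sum_abs)
    also have "\<dots> y \<le> (\<Sum>i<M. \<bar>\<gamma> M i\<bar>)" for y by (intro sum_mono) (auto simp: indicator_def)
    finally show "\<bar>u e y\<bar> \<le> (\<Sum>i<M. \<bar>\<gamma> M i\<bar>)" for y .
  qed (use that in simp)
  have cW: "continuous_on UNIV (W e)" if "0 < e" for e
    unfolding WU[OF that] by (intro continuous_on_compose2[OF cU[OF that]] continuous_intros) auto
  have "\<exists>e1>0. \<exists>C. \<forall>e. 0 < e \<longrightarrow> e < e1 \<longrightarrow>
    (\<exists>v. \<bar>v - q M e 0\<bar> \<le> C * e ^ 5 \<and> \<bar>v\<bar> < min 1 (\<rho> / 2 / e) \<and> W e v = 1 / 2 \<and>
      (\<forall>u. \<bar>u\<bar> \<le> \<rho> / 2 / e \<longrightarrow> W e u = 1 / 2 \<longrightarrow> u = v) \<and> (\<forall>u. v < u \<longrightarrow> u \<le> 1 \<longrightarrow> W e u < 1 / 2))"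
    by (rule stage_crossing[OF finite_lessThan sum_gamma[OF M order_refl] \<rho> _ _ sand A_borel q_measurable BO_q BO_q
          q_residual[OF M order_refl] W_def cW]) simp_all
  then obtain e1 C where e1: "e1 > 0" and "\<forall>e. 0 < e \<longrightarrow> e < e1 \<longrightarrow> (\<exists>v. \<bar>v - q M e 0\<bar> \<le> C * e ^ 5 \<and> \<bar>v\<bar> < min 1 (\<rho> / 2 / e) \<and> W e v = 1 / 2 \<and>
      (\<forall>u. \<bar>u\<bar> \<le> \<rho> / 2 / e \<longrightarrow> W e u = 1 / 2 \<longrightarrow> u = v) \<and> (\<forall>u. v < u \<longrightarrow> u \<le> 1 \<longrightarrow> W e u < 1 / 2))"
    by blast
  then have ex: "\<forall>e\<in>{0<..<e1}. \<exists>v. \<bar>v - q M e 0\<bar> \<le> C * e ^ 5 \<and> \<bar>v\<bar> < min 1 (\<rho> / 2 / e) \<and> W e v = 1 / 2 \<and>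
      (\<forall>u. \<bar>u\<bar> \<le> \<rho> / 2 / e \<longrightarrow> W e u = 1 / 2 \<longrightarrow> u = v) \<and> (\<forall>u. v < u \<longrightarrow> u \<le> 1 \<longrightarrow> W e u < 1 / 2)"
    by (simp only: greaterThanLessThan_iff Ball_def imp_conjL)
  obtain y where y': "\<forall>e\<in>{0<..<e1}. \<bar>y e - q M e 0\<bar> \<le> C * e ^ 5 \<and> \<bar>y e\<bar> < min 1 (\<rho> / 2 / e) \<and> W e (y e) = 1 / 2 \<and>
      (\<forall>u. \<bar>u\<bar> \<le> \<rho> / 2 / e \<longrightarrow> W e u = 1 / 2 \<longrightarrow> u = y e) \<and> (\<forall>u. y e < u \<longrightarrow> u \<le> 1 \<longrightarrow> W e u < 1 / 2)"
    using bchoice[OF ex] by blast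
  have y: "\<bar>y e - q M e 0\<bar> \<le> C * e ^ 5" "\<bar>y e\<bar> < min 1 (\<rho> / 2 / e)" "W e (y e) = 1 / 2"
    "\<And>u. \<bar>u\<bar> \<le> \<rho> / 2 / e \<Longrightarrow> W e u = 1 / 2 \<Longrightarrow> u = y e"
    "\<And>u. y e < u \<Longrightarrow> u \<le> 1 \<Longrightarrow> W e u < 1 / 2" if "0 < e" "e < e1" for e
  proof -
    have F: "\<bar>y e - q M e 0\<bar> \<le> C * e ^ 5 \<and> \<bar>y e\<bar> < min 1 (\<rho> / 2 / e) \<and> W e (y e) = 1 / 2 \<and>
      (\<forall>u. \<bar>u\<bar> \<le> \<rho> / 2 / e \<longrightarrow> W e u = 1 / 2 \<longrightarrow> u = y e) \<and> (\<forall>u. y e < u \<longrightarrow> u \<le> 1 \<longrightarrow> W e u < 1 / 2)"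
      by (rule bspec[OF y']) (use that in simp)
    show "\<bar>y e - q M e 0\<bar> \<le> C * e ^ 5" "\<bar>y e\<bar> < min 1 (\<rho> / 2 / e)" "W e (y e) = 1 / 2"
      "\<And>u. \<bar>u\<bar> \<le> \<rho> / 2 / e \<Longrightarrow> W e u = 1 / 2 \<Longrightarrow> u = y e"
      "\<And>u. y e < u \<Longrightarrow> u \<le> 1 \<Longrightarrow> W e u < 1 / 2"
      by (use F in blast)+
  qed
  define \<epsilon> where "\<epsilon> dt = sqrt (\<tau> dt)" for dt
  define z where "z dt = \<epsilon> dt * y (\<epsilon> dt)" for dt
  define \<delta> where "\<delta> = stage_beta \<gamma> M * e1\<^sup>2"
  have \<delta>: "0 < \<delta>" using \<beta> e1 by (simp add: \<delta>_def)
  have small: "0 < \<epsilon> dt \<and> \<epsilon> dt < e1 \<and> (\<epsilon> dt)\<^sup>2 = \<tau> dt" if "0 < dt" "dt < \<delta>" for dt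
  proof -
    have "\<tau> dt < e1\<^sup>2" using that \<beta> by (simp add: \<tau>_def \<delta>_def divide_less_eq mult.commute)
    then have "\<epsilon> dt < e1" unfolding \<epsilon>_def using e1 by (intro real_less_lsqrt) auto
    then show ?thesis using that \<beta> by (simp add: \<epsilon>_def \<tau>_def)
  qed
  have ev: "\<forall>\<^sub>F dt in at_right 0. 0 < dt \<and> dt < \<delta>"
    using eventually_at_right_real[OF \<delta>] by eventually_elim auto
  have "\<forall>\<^sub>F dt in at_right 0. {s. \<bar>s\<bar> < \<rho> / 2 \<and> (0, s) \<in> frontier (threshold_step M \<gamma> dt S0)} = {z dt}"
    using ev
  proof eventually_elim
    case (elim dt)
    define e where "e = \<epsilon> dt"
    have e: "0 < e" "e < e1" and e2: "e\<^sup>2 = \<tau> dt" using small elim by (auto simp: e_def)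
    have step: "threshold_step M \<gamma> dt S0 = {p. 1 / 2 \<le> U e p}"
    proof -
      have k: "kernel_time M \<gamma> dt = e\<^sup>2" by (simp add: e2 kernel_time_def \<tau>_def)
      show ?thesis unfolding threshold_step_def k U_def u_def by (rule stage_set_pos) (use M in simp)
    qed
    have UW: "U e (0, s) = W e (s / e)" for s using WU[OF e(1), of "s / e"] e by simp
    \<comment> \<open>\<open>stage_crossing\<close> keeps \<open>W e\<close> below 1/2 above the
      crossing up to scaled height 1, which is the true height \<open>e\<close>; hence
      \<open>d=e\<close>.\<close>
    have "{s. \<bar>s\<bar> < \<rho> / 2 \<and> (0, s) \<in> frontier {p. 1 / 2 \<le> U e p}} = {e * y e}"
    proof (rule frontier_superlevel_axis[OF cU[OF e(1)], where d=e])
      show "\<bar>e * y e\<bar> < \<rho> / 2" using y(2)[OF e] e by (simp add: abs_mult less_divide_eq mult_ac)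
      show "U e (0, e * y e) = 1 / 2" using y(3)[OF e] e by (simp add: UW)
      show "s = e * y e" if "\<bar>s\<bar> < \<rho> / 2" "U e (0, s) = 1 / 2" for s
      proof -
        have "s / e = y e" using that e by (intro y(4)[OF e]) (simp_all add: UW field_simps)
        then show ?thesis using e by (simp add: field_simps)
      qed
      show "e * y e < e" using y(2)[OF e] e by (simp add: abs_less_iff)
      show "U e (0, s) < 1 / 2" if "e * y e < s" "s < e" for s
        unfolding UW using that e by (intro y(5)[OF e]) (simp_all add: less_divide_eq mult.commute)
    qed
    then show ?case by (simp add: step z_def e_def)
  qed
  moreover have "(\<lambda>dt. z dt - (\<tau> dt * P1 M 0 + (\<tau> dt)\<^sup>2 * P3 M 0)) \<in> O[at_right 0](\<lambda>dt. dt ^ 3)"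
  proof (rule bigoI)
    show "\<forall>\<^sub>F dt in at_right 0. norm (z dt - (\<tau> dt * P1 M 0 + (\<tau> dt)\<^sup>2 * P3 M 0)) \<le> C / stage_beta \<gamma> M ^ 3 * norm (dt ^ 3)"
      using ev
    proof eventually_elim
      case (elim dt)
      define e where "e = \<epsilon> dt"
      have e: "0 < e" "e < e1" and e2: "\<tau> dt = e\<^sup>2" using small elim by (auto simp: e_def)
      have "z dt - (\<tau> dt * P1 M 0 + (\<tau> dt)\<^sup>2 * P3 M 0) = e * (y e - q M e 0)"
        by (simp add: z_def e_def[symmetric] e2 q_def P2_0 P4_0 eval_nat_numeral algebra_simps)
      then have "norm (z dt - (\<tau> dt * P1 M 0 + (\<tau> dt)\<^sup>2 * P3 M 0)) = e * \<bar>y e - q M e 0\<bar>" using e by (simp add: abs_mult)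
      also have "\<dots> \<le> e * (C * e ^ 5)" using y(1)[OF e] e by (intro mult_left_mono) auto
      also have "\<dots> = C * (\<tau> dt) ^ 3" by (simp add: e2 eval_nat_numeral)
      also have "\<dots> = C / stage_beta \<gamma> M ^ 3 * norm (dt ^ 3)" using elim by (simp add: \<tau>_def power_divide)
      finally show ?case .
    qed
  qed
  ultimately show ?thesis using \<rho> by (intro exI[of _ "\<rho> / 2"] conjI exI[of _ z]) auto
qed

text \<open>Averaging \<open>H (x + y, x + y) / 2\<close> adds half the contraction of the Hessian
  \<open>H\<close> with the covariance \<open>2 I\<close>, which is one full Laplacian. The
  recursion of \<open>stage_beta\<close> counts, with the weights \<gamma>, how many have been
  added.\<close>

lemma P1_eq:
  "m \<le> M \<Longrightarrow> P1 m x = ray_deriv 2 f x 0 / 2 + stage_beta \<gamma> m * (\<Sum>i\<in>UNIV. Dx i (Dx i f) 0)"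
proof (induction m arbitrary: x rule: less_induct)
  case (less m)
  let ?Lap = "\<Sum>i\<in>UNIV. Dx i (Dx i f) 0"
  show ?case
  proof (cases "m = 0")
    case True
    then show ?thesis by (simp add: P1_def stage_beta.simps[of _ 0])
  next
    case False
    have coord: "(x::real^'n) $ i = x \<bullet> axis i 1" for x i by (simp add: inner_axis)
    have i1: "integrable gm (\<lambda>y::real^'n. y $ i)" and i2: "integrable gm (\<lambda>y::real^'n. y $ i * y $ j)" for i j
      by (intro polyb_integrable polyb_mult polyb_component)+
    have E1: "(\<integral>y. (y::real^'n) $ i \<partial>gm) = 0" for i
      using integral_gm_coord[of "axis i 1 :: real^'n" "\<lambda>w. w"] polyb_inner[of "1::real"] gm_odd_moment[of 0]
      by (simp add: coord)
    have E2: "(\<integral>y. (y::real^'n) $ i * y $ j \<partial>gm) = (if i = j then 2 else 0)" for i j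
      using gm_covariance[of "axis i 1 :: real^'n" "axis j 1"] by (simp add: coord axis_eq_axis)
    have E: "(\<integral>y. (x + y) $ i * (x + y) $ j \<partial>gm) = x $ i * x $ j + (if i = j then 2 else 0)" for i j
    proof -
      have "(x + y) $ i * (x + y) $ j = x $ i * x $ j + x $ i * y $ j + x $ j * y $ i + y $ i * y $ j" for y
        by (simp add: algebra_simps)
      then show ?thesis using i1 i2 E1 E2 by simp
    qed
    have "(\<integral>y. ray_deriv 2 f (x + y) 0 / 2 \<partial>gm)
        = (\<integral>y. (\<Sum>i\<in>UNIV. \<Sum>j\<in>UNIV. ((x + y) $ i * (x + y) $ j) * (Dx j (Dx i f) 0 / 2)) \<partial>gm)"
      by (simp add: numeral_2_eq_2 sum_distrib_left sum_divide_distrib mult.assoc)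
    also have "\<dots> = (\<Sum>i\<in>UNIV. \<Sum>j\<in>UNIV. (\<integral>y. (x + y) $ i * (x + y) $ j \<partial>gm) * (Dx j (Dx i f) 0 / 2))"
    proof -
      have "integrable gm (\<lambda>y. ((x + y) $ i * (x + y) $ j) * c)" for i j c
        by (rule polyb_integrable, rule polyb_mult, rule polyb_translate[where f="\<lambda>y. y $ i * y $ j"]) simp_all
      then show ?thesis by simp
    qed
    also have "\<dots> = ray_deriv 2 f x 0 / 2 + ?Lap"
    proof -
      have "(x $ i * x $ j + (if i = j then 2 else 0)) * (Dx j (Dx i f) 0 / 2)
          = x $ i * (x $ j * Dx j (Dx i f) 0) / 2 + (if i = j then Dx i (Dx i f) 0 else 0)" for i j
        by (simp add: distrib_right)
      then show ?thesis
        unfolding E by (simp only: sum.distrib) (simp add: numeral_2_eq_2 sum_distrib_left sum_divide_distrib)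
    qed
    finally have mean: "(\<integral>y. ray_deriv 2 f (x + y) 0 / 2 \<partial>gm) = ray_deriv 2 f x 0 / 2 + ?Lap" .
    have "(\<integral>y. P1 i (x + y) \<partial>gm) = ray_deriv 2 f x 0 / 2 + ?Lap + stage_beta \<gamma> i * ?Lap" if "i < m" for i
    proof -
      have "integrable gm (\<lambda>y. ray_deriv 2 f (x + y) 0 / 2)"
        by (rule polyb_integrable, rule polyb_translate[where f="\<lambda>y. ray_deriv 2 f y 0 / 2"]) simp
      then show ?thesis using that less.prems mean by (simp add: less.IH)
    qed
    then have "P1 m x = (\<Sum>i<m. \<gamma> m i * (ray_deriv 2 f x 0 / 2 + ?Lap + stage_beta \<gamma> i * ?Lap))"
      using False unfolding P1_def by (simp add: profile_pos[of m])
    also have "\<dots> = (\<Sum>i<m. \<gamma> m i) * (ray_deriv 2 f x 0 / 2 + ?Lap) + (\<Sum>i<m. \<gamma> m i * stage_beta \<gamma> i) * ?Lap"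
      by (simp add: distrib_left sum.distrib sum_distrib_right mult.assoc)
    also have "\<dots> = ray_deriv 2 f x 0 / 2 + stage_beta \<gamma> m * ?Lap"
      using sum_gamma[of m] False less.prems stage_beta.simps[of \<gamma> m] by (simp add: algebra_simps)
    finally show ?thesis .
  qed
qed

end

text \<open>
  For curves \<open>P3 m x = d x\<^sup>4 / 24 + coeff2 m x\<^sup>2 + coeff0 m\<close>, where \<open>a, d\<close> are the second and
  fourth derivatives at the origin and \<open>a3 = a\<^sup>3\<close>.
\<close>

fun coeff2 :: "(nat \<Rightarrow> nat \<Rightarrow> real) \<Rightarrow> real \<Rightarrow> real \<Rightarrow> nat \<Rightarrow> real" where
  "coeff2 \<gamma> a3 d m = (if m = 0 then 0 else
     \<Sum>i<m. \<gamma> m i * (coeff2 \<gamma> a3 d i + d / 2 + a3 * ((stage_beta \<gamma> m - stage_beta \<gamma> i) / 2 - 3 / 2)))"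

fun coeff0 :: "(nat \<Rightarrow> nat \<Rightarrow> real) \<Rightarrow> real \<Rightarrow> real \<Rightarrow> nat \<Rightarrow> real" where
  "coeff0 \<gamma> a3 d m = (if m = 0 then 0 else
     \<Sum>i<m. \<gamma> m i * (coeff0 \<gamma> a3 d i + 2 * coeff2 \<gamma> a3 d i + d / 2
       + a3 / 12 * ((stage_beta \<gamma> m - stage_beta \<gamma> i) ^ 3 - 3 * (stage_beta \<gamma> m - stage_beta \<gamma> i)\<^sup>2
         + 9 * (stage_beta \<gamma> m - stage_beta \<gamma> i) - 15)))"

declare coeff2.simps [simp del] coeff0.simps [simp del]

text \<open>The factors are the even moments \<open>(2k)! / k!\<close> of a centred normal variable
  of variance 2.\<close>

lemma gm_mean_poly6:
  fixes b :: "'a::euclidean_space"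
  assumes "b \<in> Basis"
  shows "(\<integral>y. c0 + c1 * (y \<bullet> b) + c2 * (y \<bullet> b) ^ 2 + c3 * (y \<bullet> b) ^ 3 + c4 * (y \<bullet> b) ^ 4 + c5 * (y \<bullet> b) ^ 5 + c6 * (y \<bullet> b) ^ 6 \<partial>gm)
    = c0 + 2 * c2 + 12 * c4 + 120 * c6"
proof -
  have p: "polyb (\<lambda>w::real. w)" using polyb_inner[of "1::real"] by simp
  have i: "integrable gm (\<lambda>y::'a. (y \<bullet> b) ^ n)" for n by (intro polyb_integrable polyb_power polyb_inner)
  have i1: "integrable gm (\<lambda>y::'a. y \<bullet> b)" using i[of 1] by simp
  have m: "(\<integral>y. (y \<bullet> b) ^ n \<partial>gm) = (\<integral>w. w ^ n \<partial>(gm :: real measure))" for n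
    by (rule integral_gm_coord[OF assms polyb_power[OF p]])
  have "(\<integral>y. y \<bullet> b \<partial>gm) = 0" "(\<integral>y. (y \<bullet> b) ^ 2 \<partial>gm) = 2" "(\<integral>y. (y \<bullet> b) ^ 3 \<partial>gm) = 0"
    "(\<integral>y. (y \<bullet> b) ^ 4 \<partial>gm) = 12" "(\<integral>y. (y \<bullet> b) ^ 5 \<partial>gm) = 0" "(\<integral>y. (y \<bullet> b) ^ 6 \<partial>gm) = 120"
    using m[of 1] m[of 2] m[of 3] m[of 4] m[of 5] m[of 6] gm_odd_moment[of 0] gm_odd_moment[of 1] gm_odd_moment[of 2]
      gm_even_moment[of 1] gm_even_moment[of 2] gm_even_moment[of 3] by (simp_all add: fact_numeral)
  then show ?thesis using i i1 by simp
qed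

context stage_profiles
begin

text \<open>With \<open>w\<close> the displacement and \<open>\<Delta>\<close> the difference of the
  stage times, \<open>P1 i (x + y) - P1 m x = a (x w + w^2/2 - \<Delta>)\<close>. The mean of its
  cube keeps only even powers of \<open>w\<close>, so it contributes to \<open>x^2\<close> and to
  the constant; the quartic coefficient stays \<open>d / 24\<close> at every stage. This is how the
  recursions \<open>coeff2\<close> and \<open>coeff0\<close> arise.\<close>

lemma P3_eq:
  assumes k: "(UNIV :: 'n set) = {k}"
  defines "a \<equiv> Dx k (Dx k f) 0" and "d \<equiv> (Dx k ^^ 4) f 0"
  shows "m \<le> M \<Longrightarrow> P3 m x = d / 24 * (x $ k) ^ 4 + coeff2 \<gamma> (a ^ 3) d m * (x $ k)\<^sup>2 + coeff0 \<gamma> (a ^ 3) d m"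
proof (induction m arbitrary: x rule: less_induct)
  case (less m)
  show ?case
  proof (cases "m = 0")
    case True
    then show ?thesis
      by (simp add: P3_def ray_deriv_one_dim[OF k] d_def coeff2.simps[of _ _ _ 0] coeff0.simps[of _ _ _ 0])
  next
    case False
    let ?x = "x $ k" and ?\<beta> = "stage_beta \<gamma>"
    have P1: "P1 i y = a / 2 * (y $ k)\<^sup>2 + ?\<beta> i * a" if "i \<le> M" for i y
      using P1_eq[OF that, of y] by (simp add: ray_deriv_one_dim[OF k] k a_def numeral_2_eq_2)
    have I: "(\<integral>y. P3 i (x + y) + (- ((P1 i (x + y) - P1 m x) ^ 3) / 12) \<partial>gm)
       = d / 24 * ?x ^ 4 + (coeff2 \<gamma> (a ^ 3) d i + d / 2 + a ^ 3 * ((?\<beta> m - ?\<beta> i) / 2 - 3 / 2)) * ?x\<^sup>2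
         + (coeff0 \<gamma> (a ^ 3) d i + 2 * coeff2 \<gamma> (a ^ 3) d i + d / 2
           + a ^ 3 / 12 * ((?\<beta> m - ?\<beta> i) ^ 3 - 3 * (?\<beta> m - ?\<beta> i)\<^sup>2 + 9 * (?\<beta> m - ?\<beta> i) - 15))"
      if i: "i < m" for i
    proof -
      define \<Delta> A2 A0 where "\<Delta> = ?\<beta> m - ?\<beta> i" and "A2 = coeff2 \<gamma> (a ^ 3) d i" and "A0 = coeff0 \<gamma> (a ^ 3) d i"
      have "P3 i (x + y) + (- ((P1 i (x + y) - P1 m x) ^ 3) / 12)
        = (d / 24 * ?x ^ 4 + A2 * ?x\<^sup>2 + A0 + a ^ 3 / 12 * \<Delta> ^ 3)
          + (d / 6 * ?x ^ 3 + 2 * A2 * ?x - a ^ 3 / 4 * \<Delta>\<^sup>2 * ?x) * (y \<bullet> axis k 1)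
          + (d / 4 * ?x\<^sup>2 + A2 - a ^ 3 / 12 * (3 / 2 * \<Delta>\<^sup>2 - 3 * \<Delta> * ?x\<^sup>2)) * (y \<bullet> axis k 1) ^ 2
          + (d / 6 * ?x - a ^ 3 / 12 * (?x ^ 3 - 3 * \<Delta> * ?x)) * (y \<bullet> axis k 1) ^ 3
          + (d / 24 - a ^ 3 / 12 * (3 / 2 * ?x\<^sup>2 - 3 / 4 * \<Delta>)) * (y \<bullet> axis k 1) ^ 4
          + (- (a ^ 3 / 16 * ?x)) * (y \<bullet> axis k 1) ^ 5 + (- (a ^ 3 / 96)) * (y \<bullet> axis k 1) ^ 6" for y
      proof -
        define u w where "u = ?x" and "w = y $ k"
        have p3: "P3 i (x + y) = d / 24 * (u + w) ^ 4 + A2 * (u + w)\<^sup>2 + A0"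
          using less.IH[OF i, of "x + y"] i less.prems by (simp add: u_def w_def A2_def A0_def)
        have "P1 i (x + y) - P1 m x = a * (u * w + w\<^sup>2 / 2 - \<Delta>)"
          using P1[of i "x + y"] P1[of m x] i less.prems
          by (simp add: u_def w_def \<Delta>_def power2_eq_square field_simps)
        then have p1: "(P1 i (x + y) - P1 m x) ^ 3 = a ^ 3 * (u * w + w\<^sup>2 / 2 - \<Delta>) ^ 3" by (simp add: power_mult_distrib)
        show ?thesis unfolding p3 p1 inner_axis u_def[symmetric] w_def[symmetric]
          by (simp add: eval_nat_numeral field_simps)
      qed
      then have "(\<integral>y. P3 i (x + y) + (- ((P1 i (x + y) - P1 m x) ^ 3) / 12) \<partial>gm)
        = (d / 24 * ?x ^ 4 + A2 * ?x\<^sup>2 + A0 + a ^ 3 / 12 * \<Delta> ^ 3)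
          + 2 * (d / 4 * ?x\<^sup>2 + A2 - a ^ 3 / 12 * (3 / 2 * \<Delta>\<^sup>2 - 3 * \<Delta> * ?x\<^sup>2))
          + 12 * (d / 24 - a ^ 3 / 12 * (3 / 2 * ?x\<^sup>2 - 3 / 4 * \<Delta>)) + 120 * (- (a ^ 3 / 96))"
        using gm_mean_poly6[of "axis k 1 :: real^'n"] by (simp only: axis_in_Basis_iff Basis_real_def insert_iff simp_thms)
      also have "\<dots> = d / 24 * ?x ^ 4 + (A2 + d / 2 + a ^ 3 * (\<Delta> / 2 - 3 / 2)) * ?x\<^sup>2
         + (A0 + 2 * A2 + d / 2 + a ^ 3 / 12 * (\<Delta> ^ 3 - 3 * \<Delta>\<^sup>2 + 9 * \<Delta> - 15))"
        by (simp add: field_simps)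
      finally show ?thesis unfolding \<Delta>_def A2_def A0_def .
    qed
    have gen: "g * (A + B * X + C) = g * A + g * B * X + g * C" for g A B X C :: real
      by (simp add: distrib_left mult.assoc)
    have "P3 m x = (\<Sum>i<m. \<gamma> m i * (\<integral>y. P3 i (x + y) + (- ((P1 i (x + y) - P1 m x) ^ 3) / 12) \<partial>gm))"
      using False unfolding P3_def by (intro profile_pos) simp
    also have "\<dots> = (\<Sum>i<m. \<gamma> m i * (d / 24 * ?x ^ 4 + (coeff2 \<gamma> (a ^ 3) d i + d / 2 + a ^ 3 * ((?\<beta> m - ?\<beta> i) / 2 - 3 / 2)) * ?x\<^sup>2
         + (coeff0 \<gamma> (a ^ 3) d i + 2 * coeff2 \<gamma> (a ^ 3) d i + d / 2
           + a ^ 3 / 12 * ((?\<beta> m - ?\<beta> i) ^ 3 - 3 * (?\<beta> m - ?\<beta> i)\<^sup>2 + 9 * (?\<beta> m - ?\<beta> i) - 15))))"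
      by (intro sum.cong refl) (simp only: I lessThan_iff)
    also have "\<dots> = (\<Sum>i<m. \<gamma> m i) * (d / 24 * ?x ^ 4)
        + (\<Sum>i<m. \<gamma> m i * (coeff2 \<gamma> (a ^ 3) d i + d / 2 + a ^ 3 * ((?\<beta> m - ?\<beta> i) / 2 - 3 / 2))) * ?x\<^sup>2
        + (\<Sum>i<m. \<gamma> m i * (coeff0 \<gamma> (a ^ 3) d i + 2 * coeff2 \<gamma> (a ^ 3) d i + d / 2
           + a ^ 3 / 12 * ((?\<beta> m - ?\<beta> i) ^ 3 - 3 * (?\<beta> m - ?\<beta> i)\<^sup>2 + 9 * (?\<beta> m - ?\<beta> i) - 15)))"
      unfolding sum_distrib_right sum.distrib[symmetric] by (intro sum.cong refl) (rule gen)
    also have "\<dots> = d / 24 * ?x ^ 4 + coeff2 \<gamma> (a ^ 3) d m * ?x\<^sup>2 + coeff0 \<gamma> (a ^ 3) d m"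
      using False sum_gamma[of m] less.prems by (simp add: coeff2.simps[of _ _ _ m] coeff0.simps[of _ _ _ m])
    finally show ?thesis .
  qed
qed

end

text \<open>All values are \<open>stage_beta m * (d/2 - a3)\<close>: the weighted mean of
  \<open>stage_beta m - stage_beta i\<close> is 1, so every stage adds
  \<open>d/2 + a3 * (1/2 - 3/2)\<close>.\<close>

lemma coeff2_gamma_coeffs:
  "coeff2 gamma_coeffs a3 d 0 = 0" "coeff2 gamma_coeffs a3 d (Suc 0) = d / 2 - a3"
  "coeff2 gamma_coeffs a3 d 2 = 9/8 * d - 9/4 * a3" "coeff2 gamma_coeffs a3 d 3 = 53/48 * d - 53/24 * a3"
proof -
  show 0: "coeff2 gamma_coeffs a3 d 0 = 0" by (subst coeff2.simps) simp
  show 1: "coeff2 gamma_coeffs a3 d (Suc 0) = d / 2 - a3" by (subst coeff2.simps) (simp add: 0)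
  show 2: "coeff2 gamma_coeffs a3 d 2 = 9/8 * d - 9/4 * a3"
    by (subst coeff2.simps) (simp add: sum_less_4 0 1 field_simps)
  show "coeff2 gamma_coeffs a3 d 3 = 53/48 * d - 53/24 * a3"
    by (subst coeff2.simps) (simp add: sum_less_4 0 1 2 field_simps)
qed

lemma coeff0_gamma_coeffs:
  "coeff0 gamma_coeffs a3 d 0 = 0" "coeff0 gamma_coeffs a3 d (Suc 0) = d / 2 - 2/3 * a3"
  "coeff0 gamma_coeffs a3 d 2 = 19/8 * d - 517/128 * a3" "coeff0 gamma_coeffs a3 d 3 = 161/48 * d - 247225/41472 * a3"
proof -
  show 0: "coeff0 gamma_coeffs a3 d 0 = 0" by (subst coeff0.simps) simp
  show 1: "coeff0 gamma_coeffs a3 d (Suc 0) = d / 2 - 2/3 * a3"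
    by (subst coeff0.simps) (simp add: 0 coeff2_gamma_coeffs)
  show 2: "coeff0 gamma_coeffs a3 d 2 = 19/8 * d - 517/128 * a3"
    by (subst coeff0.simps) (simp add: sum_less_4 0 1 coeff2_gamma_coeffs power2_eq_square power3_eq_cube field_simps)
  show "coeff0 gamma_coeffs a3 d 3 = 161/48 * d - 247225/41472 * a3"
    by (subst coeff0.simps) (simp add: sum_less_4 0 1 2 coeff2_gamma_coeffs power2_eq_square power3_eq_cube field_simps)
qed

text \<open>Multiplication of polynomials modulo a cubic, in the basis \<open>1, x, x^2\<close>.
  Identities between polynomials in \<open>gamma42\<close> thus reduce to exact rational arithmetic
  on three coordinates.\<close>

lemma quadratic_mult_mod_cubic:
  fixes x :: real
  assumes "x ^ 3 = r0 + r1 * x + r2 * x\<^sup>2"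
  shows "(p0 + p1 * x + p2 * x\<^sup>2) * (q0 + q1 * x + q2 * x\<^sup>2)
    = (p0 * q0 + (p1 * q2 + p2 * q1) * r0 + p2 * q2 * (r2 * r0))
      + (p0 * q1 + p1 * q0 + (p1 * q2 + p2 * q1) * r1 + p2 * q2 * (r0 + r2 * r1)) * x
      + (p0 * q2 + p1 * q1 + p2 * q0 + (p1 * q2 + p2 * q1) * r2 + p2 * q2 * (r1 + r2 * r2)) * x\<^sup>2"
proof -
  have "x ^ 4 = x * (r0 + r1 * x + r2 * x\<^sup>2)"
    unfolding assms[symmetric] by (simp add: eval_nat_numeral)
  also have "\<dots> = r0 * x + r1 * x\<^sup>2 + r2 * x ^ 3" by (simp add: eval_nat_numeral algebra_simps)
  finally have x4: "x ^ 4 = r0 * x + r1 * x\<^sup>2 + r2 * (r0 + r1 * x + r2 * x\<^sup>2)" unfolding assms .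
  have "(p0 + p1 * x + p2 * x\<^sup>2) * (q0 + q1 * x + q2 * x\<^sup>2)
    = p0 * q0 + (p0 * q1 + p1 * q0) * x + (p0 * q2 + p1 * q1 + p2 * q0) * x\<^sup>2 + (p1 * q2 + p2 * q1) * x ^ 3 + p2 * q2 * x ^ 4"
    by (simp add: eval_nat_numeral algebra_simps)
  then show ?thesis unfolding assms x4 by (simp add: power2_eq_square algebra_simps)
qed

text \<open>
  The coefficients of \<open>d\<close> and \<open>a3\<close> give two conditions for second order; both turn out to be
  multiples of the cubic satisfied by \<open>gamma42\<close>.
\<close>

lemma coeff0_gamma_coeffs_4:
  "coeff0 gamma_coeffs a3 d 4 = (stage_beta gamma_coeffs 4)\<^sup>2 / 2 * (d - 2 * a3)"
proof -
  define x y where "x = gamma42" and "y = gamma43"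
  define b where "b = 3/2 + 9/4 * x + 53/24 * y"
  have y: "y = 9228475485984/10138563378559 + (- 9349194548616/10138563378559) * x + 7254268197696/10138563378559 * x\<^sup>2"
    by (simp add: x_def y_def gamma43_eq add_divide_distrib diff_divide_distrib)
  have x3: "x ^ 3 = - 4153208362348/3627134098848 + (- 4763335146136/3627134098848) * x + (- 1368327589725/3627134098848) * x\<^sup>2"
    using gamma42_cubic by (simp add: x_def)
  have b: "b = 71174790198773/20277126757118 + 8662518560923/40554253514236 * x + 16019842269912/10138563378559 * x\<^sup>2"
    unfolding b_def y by (simp add: field_simps)
  have b2: "b\<^sup>2 = 256026396455939/20277126757118 + (- 40912312406729/40554253514236) * x + 80703733699368/10138563378559 * x\<^sup>2"
    unfolding power2_eq_square[of b] unfolding b unfolding quadratic_mult_mod_cubic[OF x3] by simp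
  \<comment> \<open>\<Lambda> and \<kappa> are the coefficients of \<open>b\<close> and of 1 when
    the terms \<open>G (b - s)\<close> of \<open>h\<close> are expanded; \<kappa> also absorbs the
    \<open>a3\<close> parts of \<open>coeff0\<close> and \<open>2 * coeff2\<close> of the earlier
    stages. The terms in \<open>b^2\<close> combine to \<open>- b^3 / 4\<close>, so the wanted
    \<open>h = - b^2\<close> amounts to the formula for \<kappa> below.\<close>
  define \<Lambda> where "\<Lambda> = 3/4 * (1/2 - x - y) + 3/2 * (1/2) + 201/64 * x + 7081/2304 * y"
  define \<kappa> where "\<kappa> = - 5/4 * (1/2 - x - y) + (- 5) * (1/2) + (- 3505/256) * x + (- 851603/55296) * y"
  have T: "- b\<^sup>2 / 6 + \<Lambda> + b = 565184769495539/121662760542708 + 1226180112708263/1946604168683328 * x + 77693716165949/40554253514236 * x\<^sup>2"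
    unfolding b2 \<Lambda>_def y unfolding b by (simp add: field_simps)
  have bT: "b * (- b\<^sup>2 / 6 + \<Lambda> + b) = 93469468078273057/5839812506049984 + (- 7097077834817581/11679625012099968) * x
      + 9854759621766943/973302084341664 * x\<^sup>2"
    unfolding T unfolding b unfolding quadratic_mult_mod_cubic[OF x3] by simp
  have \<kappa>: "\<kappa> = - (b * (- b\<^sup>2 / 6 + \<Lambda> + b))"
    unfolding bT \<kappa>_def y by (simp add: field_simps)
  \<comment> \<open>\<open>g\<close> and \<open>h\<close> are the coefficients of \<open>d\<close>
    and \<open>a3\<close>. The flow has \<open>f_tt = d - 2 a3\<close>, and \<open>b\<close> is the
    elapsed time in units of \<tau>; matching \<open>b^2 f_tt / 2\<close> asks for
    \<open>g = b^2 / 2\<close> and \<open>h = - b^2\<close>.\<close>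
  define g where "g = (1/2 - x - y) * (1/2) + 1/2 * 2 + x * (19/8 + 9/4 + 1/2) + y * (161/48 + 53/24 + 1/2)"
  define G where "G s = (s ^ 3 - 3 * s\<^sup>2 + 9 * s - 15) / 12" for s :: real
  define h where "h = (1/2 - x - y) * G b + 1/2 * (- 2/3 - 2 + G (b - 1)) + x * (- 517/128 - 9/2 + G (b - 9/4)) + y * (- 247225/41472 - 53/12 + G (b - 53/24))"
  have g: "g = b\<^sup>2 / 2"
    unfolding g_def b2 y by (simp add: field_simps)
  have G: "G (b - s) = b ^ 3 / 12 - (s + 1) / 4 * b\<^sup>2 + (3 * s\<^sup>2 + 6 * s + 9) / 12 * b + (- (s ^ 3) - 3 * s\<^sup>2 - 9 * s - 15) / 12" for s
    unfolding G_def by (simp add: power2_eq_square power3_eq_cube field_simps)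
  have "h = b ^ 3 / 12 - (1/2 - x - y + 1/2 * 2 + x * (13/4) + y * (77/24)) / 4 * b\<^sup>2 + \<Lambda> * b + \<kappa>"
    unfolding h_def G G[of 0, simplified] \<Lambda>_def \<kappa>_def by (simp add: power2_eq_square power3_eq_cube field_simps)
  also have "1/2 - x - y + 1/2 * 2 + x * (13/4) + y * (77/24) = b" by (simp add: b_def)
  also have "b ^ 3 / 12 - b / 4 * b\<^sup>2 + \<Lambda> * b + \<kappa> = - b\<^sup>2"
    unfolding \<kappa> by (simp add: power2_eq_square power3_eq_cube field_simps)
  finally have h: "h = - b\<^sup>2" .
  have beta: "stage_beta gamma_coeffs 4 = b" by (simp add: stage_beta_4 b_def x_def y_def)
  have "coeff0 gamma_coeffs a3 d 4 = g * d + h * a3"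
  proof -
    have "coeff0 gamma_coeffs a3 d 4 = (1/2 - x - y) * (d / 2 + a3 * G b) + 1/2 * ((d / 2 - 2/3 * a3) + 2 * (d / 2 - a3) + d / 2 + a3 * G (b - 1))
        + x * ((19/8 * d - 517/128 * a3) + 2 * (9/8 * d - 9/4 * a3) + d / 2 + a3 * G (b - 9/4))
        + y * ((161/48 * d - 247225/41472 * a3) + 2 * (53/48 * d - 53/24 * a3) + d / 2 + a3 * G (b - 53/24))"
      by (subst coeff0.simps) (simp add: sum_less_4 beta coeff2_gamma_coeffs coeff0_gamma_coeffs G_def flip: x_def y_def)
    then show ?thesis unfolding g_def h_def by (simp add: algebra_simps add_divide_distrib diff_divide_distrib)
  qed
  then show ?thesis unfolding beta g h by (simp add: field_simps)
qed

section \<open>From the expansions to the order of accuracy\<close>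

lemma admissible_profiles:
  fixes f :: "(real^'n::finite) \<times> real \<Rightarrow> real"
  assumes "admissible_graph f"
  shows "stage_profiles gamma_coeffs f 4"
proof
  show sm: "smooth_on halfspace f" using assms by (simp add: admissible_graph_def halfspace_def)
  show "f 0 = 0" using assms by (simp add: admissible_graph_def zero_prod_def)
  show "Dx i f 0 = 0" for i
    using assms partial_slice[OF sm order_refl, of i 0] by (simp add: admissible_graph_def zero_prod_def)
  show "(\<Sum>i<m. gamma_coeffs m i) = 1" if "1 \<le> m" "m \<le> 4" for m
    using gamma_coeffs_sum[of "m - 1"] that by simp
qed simp

lemma bigo_at_rightI:
  fixes g :: "real \<Rightarrow> real"
  assumes "\<And>t. 0 \<le> t \<Longrightarrow> t \<le> 1 \<Longrightarrow> \<bar>g t\<bar> \<le> B * t ^ n"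
  shows "g \<in> O[at_right 0](\<lambda>t. t ^ n)"
proof (rule bigoI)
  show "\<forall>\<^sub>F t in at_right 0. norm (g t) \<le> B * norm (t ^ n)"
    using eventually_at_right_real[OF zero_less_one] by eventually_elim (use assms in auto)
qed

text \<open>The crossing is known up to \<open>O(dt^3)\<close>, hence \<open>p <= 2\<close>; what
  remains is to compare a quadratic polynomial in \<open>dt\<close> with
  \<open>f (0, dt)\<close>.\<close>

lemma accurate_of_orderI:
  assumes "\<And>f :: (real^'n::finite) \<times> real \<Rightarrow> real. admissible_graph f \<Longrightarrow>
    \<exists>E. E \<in> O[at_right 0](\<lambda>dt. dt ^ (p + 1)) \<and>
      (\<forall>dt. kernel_time 4 gamma_coeffs dt * stage_profiles.P1 gamma_coeffs f 4 0
        + (kernel_time 4 gamma_coeffs dt)\<^sup>2 * stage_profiles.P3 gamma_coeffs f 4 0 - f (0, dt) = E dt)"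
    and "p \<le> 2"
  shows "accurate_of_order TYPE('n) 4 gamma_coeffs p"
  unfolding accurate_of_order_def
proof (intro allI impI)
  fix f :: "(real^'n) \<times> real \<Rightarrow> real"
  assume adm: "admissible_graph f"
  interpret stage_profiles gamma_coeffs f 4 by (rule admissible_profiles[OF adm])
  let ?\<tau> = "kernel_time 4 gamma_coeffs"
  obtain r z where r: "r > 0" and z: "\<forall>\<^sub>F dt in at_right 0. {s. \<bar>s\<bar> < r \<and> (0, s) \<in> frontier (threshold_step 4 gamma_coeffs dt S0)} = {z dt}"
    and zO: "(\<lambda>dt. z dt - (?\<tau> dt * P1 4 0 + (?\<tau> dt)\<^sup>2 * P3 4 0)) \<in> O[at_right 0](\<lambda>dt. dt ^ 3)"
    using threshold_expansion[OF stage_beta_4_pos] unfolding kernel_time_def by blast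
  obtain E where E: "E \<in> O[at_right 0](\<lambda>dt. dt ^ (p + 1))" "\<And>dt. ?\<tau> dt * P1 4 0 + (?\<tau> dt)\<^sup>2 * P3 4 0 - f (0, dt) = E dt"
    using assms(1)[OF adm] by blast
  have "(\<lambda>dt::real. dt ^ 3) \<in> O[at_right 0](\<lambda>dt. dt ^ (p + 1))"
    by (rule bigo_at_rightI[of _ 1]) (use assms(2) power_decreasing[of "p + 1" 3] in simp)
  from sum_in_bigo(1)[OF landau_o.big_trans[OF zO this] E(1)]
  have "(\<lambda>dt. z dt - f (0, dt)) \<in> O[at_right 0](\<lambda>dt. dt ^ (p + 1))"
    by (simp add: E(2)[symmetric])
  with r z show "\<exists>r>0. \<exists>z. (\<forall>\<^sub>F dt in at_right 0.
      {s. \<bar>s\<bar> < r \<and> (0, s) \<in> frontier (threshold_step 4 gamma_coeffs dt (subgraph (\<lambda>x. f (x, 0))))} = {z dt}) \<and>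
      (\<lambda>dt. z dt - f (0, dt)) \<in> O[at_right 0](\<lambda>dt. dt ^ (p + 1))"
    unfolding S0_def by blast
qed

text \<open>The term of order \<tau> is \<open>dt * Dt f 0\<close>, because the elapsed time is
  \<open>stage_beta gamma_coeffs 4\<close> kernel times and the flow starts with the Laplacian where
  the gradient vanishes. \<open>P3\<close> only enters the error, so its explicit form, known for
  curves, is not called for.\<close>

lemma gamma_coeffs_first_order: "accurate_of_order TYPE('n::finite) 4 gamma_coeffs 1"
proof (rule accurate_of_orderI)
  fix f :: "(real^'n) \<times> real \<Rightarrow> real"
  assume adm: "admissible_graph f"
  interpret stage_profiles gamma_coeffs f 4 by (rule admissible_profiles[OF adm])
  let ?\<tau> = "kernel_time 4 gamma_coeffs" and ?\<beta> = "stage_beta gamma_coeffs 4"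
  have mcf: "graph_mcf f" using adm by (simp add: admissible_graph_def)
  obtain B where B: "\<And>t. 0 \<le> t \<Longrightarrow> t \<le> 1 \<Longrightarrow> \<bar>f (0, t) - (\<Sum>i\<le>1. (Dt ^^ i) f (0, 0) * t ^ i / fact i)\<bar> \<le> B * t ^ Suc 1"
    using time_Taylor[OF smooth, of 0 1] by blast
  have "P1 4 0 = ?\<beta> * Dt f 0"
    using P1_eq[of 4 0] ray_deriv_scale[of 2 f 0] mcf_first_derivative[OF smooth mcf grad0] by simp
  then have "?\<tau> dt * P1 4 0 = dt * Dt f 0" for dt
    using stage_beta_4_pos by (simp add: kernel_time_def)
  moreover have "(\<Sum>i\<le>1. (Dt ^^ i) f (0, 0) * t ^ i / fact i) = t * Dt f 0" for t
    using f0 by (simp add: zero_prod_def)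
  ultimately have "?\<tau> dt * P1 4 0 + (?\<tau> dt)\<^sup>2 * P3 4 0 - f (0, dt)
     = - (f (0, dt) - (\<Sum>i\<le>1. (Dt ^^ i) f (0, 0) * dt ^ i / fact i)) + P3 4 0 / ?\<beta>\<^sup>2 * dt\<^sup>2" for dt
    by (simp add: kernel_time_def power_divide)
  moreover have "(\<lambda>dt. - (f (0, dt) - (\<Sum>i\<le>1. (Dt ^^ i) f (0, 0) * dt ^ i / fact i)) + P3 4 0 / ?\<beta>\<^sup>2 * dt\<^sup>2) \<in> O[at_right 0](\<lambda>dt. dt ^ (1 + 1))"
  proof (rule sum_in_bigo(1))
    show "(\<lambda>dt. - (f (0, dt) - (\<Sum>i\<le>1. (Dt ^^ i) f (0, 0) * dt ^ i / fact i))) \<in> O[at_right 0](\<lambda>dt. dt ^ (1 + 1))"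
      by (rule bigo_at_rightI[of _ B], unfold abs_minus_cancel) (use B in simp)
    show "(\<lambda>dt. P3 4 0 / ?\<beta>\<^sup>2 * dt\<^sup>2) \<in> O[at_right 0](\<lambda>dt. dt ^ (1 + 1))"
      by (rule bigo_at_rightI[of _ "\<bar>P3 4 0 / ?\<beta>\<^sup>2\<bar>"]) (simp add: abs_mult power2_eq_square)
  qed
  ultimately show "\<exists>E. E \<in> O[at_right 0](\<lambda>dt. dt ^ (1 + 1)) \<and>
      (\<forall>dt. ?\<tau> dt * P1 4 0 + (?\<tau> dt)\<^sup>2 * P3 4 0 - f (0, dt) = E dt)" by blast
qed simp

text \<open>In one base dimension \<open>coeff0_gamma_coeffs_4\<close> and
  \<open>mcf_second_derivative\<close> contain the same combination \<open>d - 2 a^3\<close>, so the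
  terms of order \<open>dt^2\<close> agree as well.\<close>

lemma gamma_coeffs_second_order:
  assumes k: "(UNIV :: 'n::finite set) = {k}"
  shows "accurate_of_order TYPE('n) 4 gamma_coeffs 2"
proof (rule accurate_of_orderI)
  fix f :: "(real^'n) \<times> real \<Rightarrow> real"
  assume adm: "admissible_graph f"
  interpret stage_profiles gamma_coeffs f 4 by (rule admissible_profiles[OF adm])
  let ?\<tau> = "kernel_time 4 gamma_coeffs" and ?\<beta> = "stage_beta gamma_coeffs 4"
  have mcf: "graph_mcf f" using adm by (simp add: admissible_graph_def)
  obtain B where B: "\<And>t. 0 \<le> t \<Longrightarrow> t \<le> 1 \<Longrightarrow> \<bar>f (0, t) - (\<Sum>i\<le>2. (Dt ^^ i) f (0, 0) * t ^ i / fact i)\<bar> \<le> B * t ^ Suc 2"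
    using time_Taylor[OF smooth, of 0 2] by blast
  have "P1 4 0 = ?\<beta> * Dt f 0"
    using P1_eq[of 4 0] ray_deriv_scale[of 2 f 0] mcf_first_derivative[OF smooth mcf grad0] by simp
  then have 1: "?\<tau> dt * P1 4 0 = dt * Dt f 0" for dt
    using stage_beta_4_pos by (simp add: kernel_time_def)
  have "P3 4 0 = ?\<beta>\<^sup>2 / 2 * Dt (Dt f) 0"
    using P3_eq[OF k, of 4 0] mcf_second_derivative[OF smooth mcf k grad0] by (simp add: coeff0_gamma_coeffs_4)
  then have 2: "(?\<tau> dt)\<^sup>2 * P3 4 0 = dt\<^sup>2 / 2 * Dt (Dt f) 0" for dt
    unfolding kernel_time_def power_divide using stage_beta_4_pos by (simp only:) simp
  have "{..2} = {0, 1, 2::nat}" by auto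
  then have "(\<Sum>i\<le>2. (Dt ^^ i) f (0, 0) * t ^ i / fact i) = t * Dt f 0 + t\<^sup>2 / 2 * Dt (Dt f) 0" for t
    using f0 by (simp add: zero_prod_def numeral_2_eq_2)
  then have "?\<tau> dt * P1 4 0 + (?\<tau> dt)\<^sup>2 * P3 4 0 - f (0, dt)
     = - (f (0, dt) - (\<Sum>i\<le>2. (Dt ^^ i) f (0, 0) * dt ^ i / fact i))" for dt
    by (simp add: 1 2)
  moreover have "(\<lambda>dt. - (f (0, dt) - (\<Sum>i\<le>2. (Dt ^^ i) f (0, 0) * dt ^ i / fact i))) \<in> O[at_right 0](\<lambda>dt. dt ^ (2 + 1))"
    by (rule bigo_at_rightI[of _ B], unfold abs_minus_cancel) (use B in simp)
  ultimately show "\<exists>E. E \<in> O[at_right 0](\<lambda>dt. dt ^ (2 + 1)) \<and>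
      (\<forall>dt. ?\<tau> dt * P1 4 0 + (?\<tau> dt)\<^sup>2 * P3 4 0 - f (0, dt) = E dt)" by blast
qed simp

theorem theorem5p3:
  shows "energy_stable TYPE((real^'n::finite) \<times> real) 4 gamma_coeffs \<and>
         accurate_of_order TYPE('n) 4 gamma_coeffs 1 \<and>
         (DIM((real^'n) \<times> real) = 2 \<longrightarrow> accurate_of_order TYPE('n) 4 gamma_coeffs 2)"
proof (intro conjI impI)
  assume "DIM((real^'n) \<times> real) = 2"
  then have "CARD('n) = 1" by simp
  then obtain k where "(UNIV :: 'n set) = {k}" by (auto simp: card_1_singleton_iff)
  then show "accurate_of_order TYPE('n) 4 gamma_coeffs 2" by (rule gamma_coeffs_second_order)
qed (rule gamma_coeffs_energy_stable gamma_coeffs_first_order)+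

end
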